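(* Let $G$ be $\mathrm{Path}(\mathbf{k})$ or $\mathrm{Cycle}(\mathbf{k})$ with the lab framing, let $P$ be its $\mathbf{g}$-polytope, and let $R$ and $S$ be routes in $G$. (i) If both $R$ and $S$ are anomalous: (a) $S\in \mathrm{NW}(R)\cup \mathrm{SE}(R)$ if and only if $R$ and $S$ are in conflict, and in this case the entire polytope $P$ is the minimal face containing both $R$ and $S$. (b) If $R$ and $S$ are coherent: (1) if one of $R$ or $S$ is exceptional, the minimal face containing them is $P$; (2) otherwise, the minimal face containing them is the edge from $R$ to $S$. (ii) If $R$ and $S$ are not both anomalous: (a) $S\in \mathrm{NW}(R)\cup \mathrm{SE}(R)$ if and only if $S$ is in conflict with $R$. Further, writing $\{R,S,T_1,T_2\}$ for the 2-by-2 array subtended by $R$ and $S$: (1) if one of $T_1,T_2$ is exceptional, then $R$ and $S$ lie on different facets of $P$; (2) otherwise, the convex hull of the routes in this 2-by-2 array forms the minimal face of $P$ containing $R$ and $S$. (b) $S\in \mathrm{NE}(R)\cup \mathrm{SW}(R)$ if and only if $S$ is coherent with $R$ and the line segment from $R$ to $S$ is not an edge of $P$. (c) $S$ lies outside of $\mathrm{NW}(R)\cup \mathrm{NE}(R)\cup \mathrm{SE}(R)\cup \mathrm{SW}(R)$ if and only if $S$ is coherent with $R$ and the line segment from $R$ to $S$ is an edge of $P$. (Routes are identified with their $\mathbf{g}$-vectors when speaking of faces of $P$.)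
   Context: DAGs. All DAGs are finite acyclic directed multigraphs with one source $s$ and one sink $t$; inner vertices are the other vertices; a DAG is full if every inner vertex has indegree and outdegree $2$. The inner graph is the subgraph induced by inner vertices; an inner route is a maximal directed path in it. A route is a directed path from $s$ to $t$. $\mathrm{Path}(\mathbf{k})$, $\mathbf{k}=(k_1,\dots,k_r)$ a sequence of positive integers, $r\ge1$: the full DAG with inner vertices $1,\dots,n$, $n=k_1+\cdots+k_r+1$, with one inner edge between $i$ and $i+1$ for each $i<n$; the first $k_1$ inner edges are directed $i\to i+1$, the next $k_2$ are directed $i+1\to i$, and so on alternating. Edges from $s$ and to $t$ (possibly parallel pairs) are added to make it full; there is no edge $s\to t$. $\mathrm{Cycle}(\mathbf{k})$, $r$ even: same, with $n=k_1+\cdots+k_r$ inner vertices and inner edges between $i$ and $i+1$ modulo $n$ (so the $r$-th inner route starts at vertex $1$ and runs $1\to n\to n-1\to\cdots$). Lab framing: edges are labeled by $\{1,2\}$; inner edges of odd-numbered inner routes (first, third, ...) get label $2$, those of even-numbered inner routes get label $1$, and source and sink edges are labeled so that at each inner vertex the two incoming edges have distinct labels and the two outgoing edges have distinct labels. An inner route with constant label $j$ is called a $j$-leg (here every inner route is a leg). A route is exceptional if all its edges have the same label; an exceptional route is long if it contains a leg and short otherwise (a short one consists of one source edge and one sink edge at an inner vertex). Each edge lies on a unique exceptional route. Every route other than a short exceptional one lies on a unique leg (its intersection with the inner graph is contained in that leg). Coherence: let $[u,v]$ be a maximal common subpath of routes $R,S$ with $u,v$ inner vertices (possibly $u=v$),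 so they enter $u$ by distinct edges and leave $v$ by distinct edges. They are in conflict at $[u,v]$ if the one entering $u$ by the smaller label leaves $v$ by the larger label. $R,S$ are in conflict if they are in conflict at some $[u,v]$, and coherent otherwise. $\mathbf{g}$-polytope: $\mathbf{g}(R)=(a_v)_v\in\mathbb{Z}^n$ with $a_v=-1$ if $R$ enters $v$ with label $1$ and leaves with label $2$, $a_v=1$ if it enters with label $2$ and leaves with label $1$, and $a_v=0$ otherwise. $P$ is the convex hull of all $\mathbf{g}(R)$. Edge names: a source or sink edge at inner vertex $i$ is named $i$ if it lies on a short exceptional route; if it lies on a long exceptional route it is named $i^-$ if it is a source edge labeled $2$ or a sink edge labeled $1$, and $i^+$ if it is a sink edge labeled $2$ or a source edge labeled $1$. Names are ordered $1^-<1<1^+<2^-<2<2^+<\cdots<n^-<n<n^+$. Coherence diagram: an array of boxes in bijection with the routes. Rows are indexed top to bottom by source-edge names, columns left to right by sink-edge names, both in increasing order, and a route with source edge $a$ and sink edge $b$ is the box in row $a$, column $b$. For $\mathrm{Cycle}(\mathbf{k})$, two additional rows indexed $1^-,1^+$ are placed at the bottom; routes with source edge $1^-$ or $1^+$ lying on the $r$-th leg (a $1$-leg) are placed in these bottom rows and the other routes with these source edges in the top rows. The left boundary of the top two rows is identified with the right boundary of the bottom two rows; i.e. each bottom row $1^\pm$, read left to right, is continued to the east by the top row $1^\pm$. Regions: $\mathrm{N}(R),\mathrm{S}(R),\mathrm{E}(R),\mathrm{W}(R)$ are the sets of boxes strictly above $R$ in its column, strictly below $R$ in its column, strictly to the right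 of $R$ in its row, strictly to the left of $R$ in its row (rows $1^\pm$ continuing across the identification in the cycle case). Further, - $R'\in\mathrm{NW}(R)$ iff there are $T_1,T_2$ with $\{T_1\}=\mathrm{W}(R)\cap\mathrm{S}(R')$, $\{T_2\}=\mathrm{N}(R)\cap\mathrm{E}(R')$; - $R'\in\mathrm{NE}(R)$ iff there are $T_1,T_2$ with $\{T_1\}=\mathrm{E}(R)\cap\mathrm{S}(R')$, $\{T_2\}=\mathrm{N}(R)\cap\mathrm{W}(R')$; - $R'\in\mathrm{SW}(R)$ iff there are $T_1,T_2$ with $\{T_1\}=\mathrm{W}(R)\cap\mathrm{N}(R')$, $\{T_2\}=\mathrm{S}(R)\cap\mathrm{E}(R')$; - $R'\in\mathrm{SE}(R)$ iff there are $T_1,T_2$ with $\{T_1\}=\mathrm{E}(R)\cap\mathrm{N}(R')$, $\{T_2\}=\mathrm{S}(R)\cap\mathrm{W}(R')$. If one of $R,S$ is in the $\mathrm{NW}$ region of the other, the 2-by-2 array subtended by $R$ and $S$ is $\{R,S,T_1,T_2\}$ with $T_1,T_2$ the routes in the definition of that region. Anomalous routes: in $\mathrm{Cycle}(k_1,k_2)$ (two legs), the eight routes contained in the union of the edge sets of the two long exceptional routes. For all other $G$ there are no anomalous routes.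
   Formalization: T1,T2 in the NW/NE/SW/SE regions need only lie in the intersections, not be their sole elements; in (ii)(b),(c) "coherent, not an edge ⇒ NE/SW" and "outside ⇒ edge" are stated only for distinct non-exceptional R,S; (i)(b)(2) assumes R≠S. *)

theory Defs
  imports
    "HOL-Analysis.Analysis"
    "Graph_Theory.Arc_Walk"
    "Graph_Theory.Digraph_Component"
begin

section \<open>The DAGs Path(k) and Cycle(k) with the lab framing\<close>

datatype shape = Path "nat list" | Cycle "nat list"

fun wf_shape :: "shape \<Rightarrow> bool" where
  "wf_shape (Path ks) \<longleftrightarrow> ks \<noteq> [] \<and> (\<forall>k\<in>set ks. 0 < k)"
| "wf_shape (Cycle ks) \<longleftrightarrow> ks \<noteq> [] \<and> (\<forall>k\<in>set ks. 0 < k) \<and> even (length ks)"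

fun seq :: "shape \<Rightarrow> nat list" where
  "seq (Path ks) = ks"
| "seq (Cycle ks) = ks"

fun num_inner :: "shape \<Rightarrow> nat" where
  "num_inner (Path ks) = sum_list ks + 1"
| "num_inner (Cycle ks) = sum_list ks"

fun next_vertex :: "shape \<Rightarrow> nat \<Rightarrow> nat" where
  "next_vertex (Path ks) i = i + 1"
| "next_vertex (Cycle ks) i = (if i = sum_list ks then 1 else i + 1)"

text \<open>The inner edges are numbered from 1 to the sum of the sequence, the edge with number
  \<open>i\<close> joining \<open>i\<close> and its successor vertex.  The first \<open>k\<^sub>1\<close> of them form block 1, the next
  \<open>k\<^sub>2\<close> form block 2, and so on; the \<open>m\<close>-th block is the edge set of the \<open>m\<close>-th inner route.\<close>

definition block :: "shape \<Rightarrow> nat \<Rightarrow> nat" where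
  "block K i = (LEAST m. i \<le> sum_list (take m (seq K)))"

datatype vertex = Source | Sink | Inner nat

text \<open>Source and sink edges are identified by their inner vertex and their label.  This is
  possible because the two incoming (outgoing) edges at an inner vertex have distinct labels.\<close>

datatype edge = SourceEdge nat nat | InnerEdge nat | SinkEdge nat nat

fun label :: "shape \<Rightarrow> edge \<Rightarrow> nat" where
  "label K (SourceEdge v l) = l"
| "label K (SinkEdge v l) = l"
| "label K (InnerEdge i) = (if odd (block K i) then 2 else 1)"

fun edge_tail :: "shape \<Rightarrow> edge \<Rightarrow> vertex" where
  "edge_tail K (SourceEdge v l) = Source"
| "edge_tail K (SinkEdge v l) = Inner v"
| "edge_tail K (InnerEdge i) = Inner (if odd (block K i) then i else next_vertex K i)"

fun edge_head :: "shape \<Rightarrow> edge \<Rightarrow> vertex" where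
  "edge_head K (SourceEdge v l) = Inner v"
| "edge_head K (SinkEdge v l) = Sink"
| "edge_head K (InnerEdge i) = Inner (if odd (block K i) then next_vertex K i else i)"

definition inner_vertices :: "shape \<Rightarrow> vertex set" where
  "inner_vertices K = Inner ` {1..num_inner K}"

definition inner_edges :: "shape \<Rightarrow> edge set" where
  "inner_edges K = InnerEdge ` {1..sum_list (seq K)}"

text \<open>A source edge (sink edge) is added for each label not yet present among the inner edges
  entering (leaving) the vertex.\<close>

definition source_edges :: "shape \<Rightarrow> edge set" where
  "source_edges K = {SourceEdge v l | v l. v \<in> {1..num_inner K} \<and> l \<in> {1, 2} \<and>
     \<not> (\<exists>e\<in>inner_edges K. edge_head K e = Inner v \<and> label K e = l)}"

definition sink_edges :: "shape \<Rightarrow> edge set" where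
  "sink_edges K = {SinkEdge v l | v l. v \<in> {1..num_inner K} \<and> l \<in> {1, 2} \<and>
     \<not> (\<exists>e\<in>inner_edges K. edge_tail K e = Inner v \<and> label K e = l)}"

definition dag :: "shape \<Rightarrow> (vertex, edge) pre_digraph" where
  "dag K = \<lparr> verts = {Source, Sink} \<union> inner_vertices K,
             arcs = source_edges K \<union> inner_edges K \<union> sink_edges K,
             tail = edge_tail K, head = edge_head K \<rparr>"

lemma next_vertex_inj:
  assumes "i \<in> {1..sum_list (seq K)}" "j \<in> {1..sum_list (seq K)}"
    and "next_vertex K i = next_vertex K j"
  shows "i = j"
proof (cases K)
  case (Path ks)
  then show ?thesis using assms(3) by simp
next
  case (Cycle ks)
  have "1 \<le> i" "1 \<le> j" using assms(1,2) by simp_all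
  then show ?thesis
    using assms(3) unfolding Cycle next_vertex.simps
    by (cases "i = sum_list ks"; cases "j = sum_list ks") simp_all
qed

lemma arcs_iff:
  "InnerEdge i \<in> arcs (dag K) \<longleftrightarrow> i \<in> {1..sum_list (seq K)}"
  "SourceEdge v l \<in> arcs (dag K) \<longleftrightarrow> v \<in> {1..num_inner K} \<and> l \<in> {1, 2} \<and>
     (\<forall>i\<in>{1..sum_list (seq K)}.
        edge_head K (InnerEdge i) = Inner v \<longrightarrow> label K (InnerEdge i) \<noteq> l)"
  "SinkEdge v l \<in> arcs (dag K) \<longleftrightarrow> v \<in> {1..num_inner K} \<and> l \<in> {1, 2} \<and>
     (\<forall>i\<in>{1..sum_list (seq K)}.
        edge_tail K (InnerEdge i) = Inner v \<longrightarrow> label K (InnerEdge i) \<noteq> l)"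
  unfolding dag_def inner_edges_def source_edges_def sink_edges_def by auto

text \<open>At every inner vertex each of the labels 1, 2 occurs exactly once among the incoming edges
  and exactly once among the outgoing edges; in particular the DAG is full.\<close>

lemma framing_in:
  assumes "v \<in> {1..num_inner K}" "l \<in> {1, 2}"
  shows "\<exists>!e. e \<in> arcs (dag K) \<and> head (dag K) e = Inner v \<and> label K e = l"
proof -
  let ?P = "\<lambda>e. e \<in> arcs (dag K) \<and> edge_head K e = Inner v \<and> label K e = l"
  have ex: "\<exists>e. ?P e"
  proof (cases "?P (SourceEdge v l)")
    case False
    then obtain i where "?P (InnerEdge i)"
      using assms unfolding arcs_iff by auto
    then show ?thesis by blast
  qed blast
  have new: "\<not> ?P (SourceEdge v l)" if "?P (InnerEdge i)" for i
    using that arcs_iff(1)[of i K] arcs_iff(2)[of v l K] by blast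
  have uniq: "e = e'" if "?P e" "?P e'" for e e'
  proof (cases e)
    case e: (InnerEdge i)
    show ?thesis
    proof (cases e')
      case (InnerEdge j)
      then show ?thesis
        using that e next_vertex_inj[of i K j] arcs_iff(1)[of i K] arcs_iff(1)[of j K]
        by (cases "odd (block K i)"; cases "odd (block K j)") simp_all
    next
      case (SourceEdge w m)
      then have "e' = SourceEdge v l" using that by simp
      then show ?thesis using that e new by blast
    next
      case (SinkEdge w m)
      then show ?thesis using that by simp
    qed
  next
    case e: (SourceEdge w m)
    show ?thesis
    proof (cases e')
      case (InnerEdge j)
      moreover have "e = SourceEdge v l" using that e by simp
      ultimately show ?thesis using that new by blast
    qed (use that e in simp_all)
  next
    case (SinkEdge w m)
    then show ?thesis using that by simp
  qed
  have "\<exists>!e. ?P e" using ex uniq by blast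
  then show ?thesis by (simp add: dag_def)
qed

lemma framing_out:
  assumes "v \<in> {1..num_inner K}" "l \<in> {1, 2}"
  shows "\<exists>!e. e \<in> arcs (dag K) \<and> tail (dag K) e = Inner v \<and> label K e = l"
proof -
  let ?P = "\<lambda>e. e \<in> arcs (dag K) \<and> edge_tail K e = Inner v \<and> label K e = l"
  have ex: "\<exists>e. ?P e"
  proof (cases "?P (SinkEdge v l)")
    case False
    then obtain i where "?P (InnerEdge i)"
      using assms unfolding arcs_iff by auto
    then show ?thesis by blast
  qed blast
  have new: "\<not> ?P (SinkEdge v l)" if "?P (InnerEdge i)" for i
    using that arcs_iff(1)[of i K] arcs_iff(3)[of v l K] by blast
  have uniq: "e = e'" if "?P e" "?P e'" for e e'
  proof (cases e)
    case e: (InnerEdge i)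
    show ?thesis
    proof (cases e')
      case (InnerEdge j)
      then show ?thesis
        using that e next_vertex_inj[of i K j] arcs_iff(1)[of i K] arcs_iff(1)[of j K]
        by (cases "odd (block K i)"; cases "odd (block K j)") simp_all
    next
      case (SinkEdge w m)
      then have "e' = SinkEdge v l" using that by simp
      then show ?thesis using that e new by blast
    next
      case (SourceEdge w m)
      then show ?thesis using that by simp
    qed
  next
    case e: (SinkEdge w m)
    show ?thesis
    proof (cases e')
      case (InnerEdge j)
      moreover have "e = SinkEdge v l" using that e by simp
      ultimately show ?thesis using that new by blast
    qed (use that e in simp_all)
  next
    case (SourceEdge w m)
    then show ?thesis using that by simp
  qed
  have "\<exists>!e. ?P e" using ex uniq by blast
  then show ?thesis by (simp add: dag_def)
qed


section \<open>Routes, legs and coherence\<close>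

type_synonym route = "edge list"

definition routes :: "shape \<Rightarrow> route set" where
  "routes K = {R. pre_digraph.awalk (dag K) Source R Sink}"

definition inner_graph :: "shape \<Rightarrow> (vertex, edge) pre_digraph" where
  "inner_graph K = dag K \<restriction> inner_vertices K"

definition inner_route :: "shape \<Rightarrow> edge list \<Rightarrow> bool" where
  "inner_route K p \<longleftrightarrow>
     (\<exists>u v. pre_digraph.awalk (inner_graph K) u p v \<and>
        in_arcs (inner_graph K) u = {} \<and> out_arcs (inner_graph K) v = {})"

definition leg :: "shape \<Rightarrow> nat \<Rightarrow> edge list \<Rightarrow> bool" where
  "leg K j p \<longleftrightarrow> inner_route K p \<and> (\<forall>e\<in>set p. label K e = j)"

definition exceptional :: "shape \<Rightarrow> route \<Rightarrow> bool" where
  "exceptional K R \<longleftrightarrow> R \<in> routes K \<and> (\<exists>j. \<forall>e\<in>set R. label K e = j)"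

definition long_exceptional :: "shape \<Rightarrow> route \<Rightarrow> bool" where
  "long_exceptional K R \<longleftrightarrow> exceptional K R \<and> (\<exists>j p. leg K j p \<and> set p \<subseteq> set R)"

definition short_exceptional :: "shape \<Rightarrow> route \<Rightarrow> bool" where
  "short_exceptional K R \<longleftrightarrow> exceptional K R \<and> \<not> long_exceptional K R"

text \<open>Here \<open>c\<close> is the maximal common subpath; it is the empty list when its two end vertices
  coincide.  The routes enter it by \<open>a \<noteq> a'\<close> and leave it by \<open>b \<noteq> b'\<close>.\<close>

definition conflict :: "shape \<Rightarrow> route \<Rightarrow> route \<Rightarrow> bool" where
  "conflict K R S \<longleftrightarrow>
     (\<exists>p a c b q p' a' b' q'.
        R = p @ [a] @ c @ [b] @ q \<and> S = p' @ [a'] @ c @ [b'] @ q' \<and>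
        head (dag K) a = head (dag K) a' \<and> a \<noteq> a' \<and>
        tail (dag K) b = tail (dag K) b' \<and> b \<noteq> b' \<and>
        (label K a < label K a' \<and> label K b > label K b' \<or>
         label K a' < label K a \<and> label K b' > label K b))"

definition coherent :: "shape \<Rightarrow> route \<Rightarrow> route \<Rightarrow> bool" where
  "coherent K R S \<longleftrightarrow> \<not> conflict K R S"

definition anomalous :: "shape \<Rightarrow> route \<Rightarrow> bool" where
  "anomalous K R \<longleftrightarrow>
     (\<exists>k\<^sub>1 k\<^sub>2. K = Cycle [k\<^sub>1, k\<^sub>2]) \<and> R \<in> routes K \<and>
     set R \<subseteq> (\<Union>L\<in>{L. long_exceptional K L}. set L)"


section \<open>The g-polytope\<close>

definition passes :: "shape \<Rightarrow> route \<Rightarrow> nat \<Rightarrow> nat \<Rightarrow> nat \<Rightarrow> bool" where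
  "passes K R v l l' \<longleftrightarrow>
     (\<exists>p a b q. R = p @ [a, b] @ q \<and> head (dag K) a = Inner v \<and> label K a = l \<and> label K b = l')"

text \<open>The coordinates are indexed by a finite type \<open>'n\<close>, which \<open>vtx\<close> is meant to map
  bijectively onto \<open>{1..num_inner K}\<close>.\<close>

definition gvec :: "('n::finite \<Rightarrow> nat) \<Rightarrow> shape \<Rightarrow> route \<Rightarrow> real ^ 'n" where
  "gvec vtx K R = (\<chi> i. if passes K R (vtx i) 1 2 then -1
                        else if passes K R (vtx i) 2 1 then 1 else 0)"

definition gpolytope :: "('n::finite \<Rightarrow> nat) \<Rightarrow> shape \<Rightarrow> (real ^ 'n) set" where
  "gpolytope vtx K = convex hull (gvec vtx K ` routes K)"

definition minimal_face :: "'a::real_vector set \<Rightarrow> 'a set \<Rightarrow> 'a set" where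
  "minimal_face P A = \<Inter>{F. F face_of P \<and> A \<subseteq> F}"

text \<open>Two points lie on different facets if each of them is on a facet, but no facet contains
  both.\<close>

definition on_different_facets :: "'a::euclidean_space set \<Rightarrow> 'a \<Rightarrow> 'a \<Rightarrow> bool" where
  "on_different_facets P x y \<longleftrightarrow>
     (\<exists>F. F facet_of P \<and> x \<in> F) \<and> (\<exists>F. F facet_of P \<and> y \<in> F) \<and>
     \<not> (\<exists>F. F facet_of P \<and> x \<in> F \<and> y \<in> F)"


section \<open>The coherence diagram\<close>

text \<open>The names \<open>i\<^sup>-\<close>, \<open>i\<close>, \<open>i\<^sup>+\<close> are encoded by the integers \<open>3i - 1\<close>, \<open>3i\<close>, \<open>3i + 1\<close>, which
  respects their order.\<close>

fun edge_vertex :: "edge \<Rightarrow> nat" where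
  "edge_vertex (SourceEdge v l) = v"
| "edge_vertex (SinkEdge v l) = v"
| "edge_vertex (InnerEdge i) = undefined"

definition edge_name :: "shape \<Rightarrow> edge \<Rightarrow> int" where
  "edge_name K e =
     (if \<exists>R. short_exceptional K R \<and> e \<in> set R then 3 * int (edge_vertex e)
      else if e \<in> source_edges K \<and> label K e = 2 \<or> e \<in> sink_edges K \<and> label K e = 1
      then 3 * int (edge_vertex e) - 1
      else 3 * int (edge_vertex e) + 1)"

definition row :: "shape \<Rightarrow> route \<Rightarrow> int" where
  "row K R = edge_name K (hd R)"

definition col :: "shape \<Rightarrow> route \<Rightarrow> int" where
  "col K R = edge_name K (last R)"

text \<open>The routes placed in the two additional bottom rows: those with source edge \<open>1\<^sup>-\<close> or \<open>1\<^sup>+\<close>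
  lying on the last leg.\<close>

fun bottom :: "shape \<Rightarrow> route \<Rightarrow> bool" where
  "bottom (Path ks) R \<longleftrightarrow> False"
| "bottom (Cycle ks) R \<longleftrightarrow>
     row (Cycle ks) R \<in> {3 * 1 - 1, 3 * 1 + 1} \<and>
     (\<forall>i. InnerEdge i \<in> set R \<longrightarrow> block (Cycle ks) i = length ks)"

definition above :: "shape \<Rightarrow> route \<Rightarrow> route \<Rightarrow> bool" where
  "above K R R' \<longleftrightarrow> col K R = col K R' \<and>
     (\<not> bottom K R \<and> bottom K R' \<or> bottom K R = bottom K R' \<and> row K R < row K R')"

text \<open>A bottom row \<open>1\<^sup>\<plusminus>\<close> is continued to the east by the top row with the same name.\<close>

definition left_of :: "shape \<Rightarrow> route \<Rightarrow> route \<Rightarrow> bool" where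
  "left_of K R R' \<longleftrightarrow> row K R = row K R' \<and>
     (bottom K R \<and> \<not> bottom K R' \<or> bottom K R = bottom K R' \<and> col K R < col K R')"

definition regN :: "shape \<Rightarrow> route \<Rightarrow> route set" where
  "regN K R = {T \<in> routes K. above K T R}"

definition regS :: "shape \<Rightarrow> route \<Rightarrow> route set" where
  "regS K R = {T \<in> routes K. above K R T}"

definition regE :: "shape \<Rightarrow> route \<Rightarrow> route set" where
  "regE K R = {T \<in> routes K. left_of K R T}"

definition regW :: "shape \<Rightarrow> route \<Rightarrow> route set" where
  "regW K R = {T \<in> routes K. left_of K T R}"

text \<open>The corners are required to be elements, not the only elements, of the respective
  intersections.  This makes a difference only between anomalous routes: in \<open>Cycle [k\<^sub>1, k\<^sub>2]\<close> the
  row \<open>1\<^sup>\<plusminus>\<close>, continued across the identification, meets the column of an anomalous route twice.\<close>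

definition NW_corners :: "shape \<Rightarrow> route \<Rightarrow> route \<Rightarrow> route \<Rightarrow> route \<Rightarrow> bool" where
  "NW_corners K R R' T\<^sub>1 T\<^sub>2 \<longleftrightarrow> T\<^sub>1 \<in> regW K R \<inter> regS K R' \<and> T\<^sub>2 \<in> regN K R \<inter> regE K R'"

definition regNW :: "shape \<Rightarrow> route \<Rightarrow> route set" where
  "regNW K R = {R' \<in> routes K. \<exists>T\<^sub>1 T\<^sub>2. NW_corners K R R' T\<^sub>1 T\<^sub>2}"

definition regNE :: "shape \<Rightarrow> route \<Rightarrow> route set" where
  "regNE K R = {R' \<in> routes K. \<exists>T\<^sub>1 T\<^sub>2.
     T\<^sub>1 \<in> regE K R \<inter> regS K R' \<and> T\<^sub>2 \<in> regN K R \<inter> regW K R'}"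

definition regSW :: "shape \<Rightarrow> route \<Rightarrow> route set" where
  "regSW K R = {R' \<in> routes K. \<exists>T\<^sub>1 T\<^sub>2.
     T\<^sub>1 \<in> regW K R \<inter> regN K R' \<and> T\<^sub>2 \<in> regS K R \<inter> regE K R'}"

definition regSE :: "shape \<Rightarrow> route \<Rightarrow> route set" where
  "regSE K R = {R' \<in> routes K. \<exists>T\<^sub>1 T\<^sub>2.
     T\<^sub>1 \<in> regE K R \<inter> regN K R' \<and> T\<^sub>2 \<in> regS K R \<inter> regW K R'}"

text \<open>\<open>{R, S, T\<^sub>1, T\<^sub>2}\<close> is the 2-by-2 array subtended by \<open>R\<close> and \<open>S\<close>.\<close>

definition subtended :: "shape \<Rightarrow> route \<Rightarrow> route \<Rightarrow> route \<Rightarrow> route \<Rightarrow> bool" where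
  "subtended K R S T\<^sub>1 T\<^sub>2 \<longleftrightarrow> NW_corners K R S T\<^sub>1 T\<^sub>2 \<or> NW_corners K S R T\<^sub>1 T\<^sub>2"

end

theory Submission
  imports Defs
begin

text \<open>Every route lies on one leg and is determined by the positions at which it enters and leaves
  the leg.  Its \<open>g\<close>-vector is \<open>e\<^sub>b - e\<^sub>a\<close> for two nodes \<open>a\<close>, \<open>b\<close>, where
  \<open>e\<^sub>0 = 0\<close>; so the polytope is the root polytope of a digraph \<open>D\<close> on \<open>{0, \<dots>, n}\<close> in which 0 is joined
  to all nodes in both directions, and a linear functional is a potential on the nodes.  A face
  that contains the zero vector is the whole polytope, because every arc closes up to a cycle
  through 0.

  The corners of a 2-by-2 array satisfy \<open>g(R) + g(S) = g(T\<^sub>1) + g(T\<^sub>2)\<close>, so a face containing \<open>R\<close>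
  and \<open>S\<close> contains \<open>T\<^sub>1\<close> and \<open>T\<^sub>2\<close>, and it is everything if one of these is exceptional.
  Conversely, explicit potentials show that nothing else lies in the minimal face.  Both conflict
  and the position of \<open>S\<close> relative to \<open>R\<close> in the diagram depend only on how the two pairs of
  positions interlace, or on how the routes meet at the turning vertex of two consecutive legs.\<close>

section \<open>Faces of root polytopes\<close>

text \<open>Direction and label of a leg alternate together: even legs run upwards with label 2, odd
  legs downwards with label 1. Hence the lower end of a route is always its change from 1 to 2 and
  the upper end its change from 2 to 1, while an end on the long exceptional edge is no change and
  gives node 0. So one formula serves all legs.

  \<open>below\<close> (conflict) and \<open>nested\<close> are the two diagonals of one kind of
  array: the ends of two overlapping intervals of a leg are exchanged, or the two end edges at a
  turning vertex. For any other pair of nonexceptional routes the arcs share a node or an exchanged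
  arc is missing, and the potentials exploit just that.

  The obstacle is the cycle. Its diagram is cut open at vertex 1, called the seam below, so that the
  identification survives as a single relation between the last leg and leg 0. In a cycle with two
  legs each leg is next to the other at both ends: an array can then close up across the seam in a
  second way, and \<open>below\<close> and \<open>nested\<close> can hold together. This is what
  sets the anomalous pairs apart.\<close>

lemma minimal_face_eqI:
  assumes "F face_of P" "A \<subseteq> F" "\<And>F'. F' face_of P \<Longrightarrow> A \<subseteq> F' \<Longrightarrow> F \<subseteq> F'"
  shows "minimal_face P A = F"
  unfolding minimal_face_def using assms by blast

text \<open>The midpoint of \<open>a\<close> and \<open>b\<close> is also that of \<open>c\<close>
  and \<open>d\<close>. If \<open>c\<close> and \<open>d\<close> differ, it lies in the open segment
  between them, and a face meeting that open segment contains both ends.\<close>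

lemma face_of_exchange:
  fixes a b c d :: "'a::real_vector"
  assumes "F face_of P" "a \<in> F" "b \<in> F" "c \<in> P" "d \<in> P" "a + b = c + d"
  shows "c \<in> F \<and> d \<in> F"
proof -
  have "midpoint a b \<in> F"
    using assms(1-3) face_of_imp_convex midpoint_in_closed_segment closed_segment_subset
    by blast
  then have m: "midpoint c d \<in> F"
    using assms(6) by (simp add: midpoint_def)
  show ?thesis
  proof (cases "c = d")
    case True
    then show ?thesis using m by simp
  next
    case False
    then show ?thesis
      using m assms(1,4,5) face_ofD[OF assms(1)] midpoint_in_open_segment by blast
  qed
qed

text \<open>With \<open>vtx\<close> mapping onto \<open>{1..n}\<close>, no coordinate has number 0,
  so node 0 gets the zero vector.\<close>

definition node_vec :: "('n::finite \<Rightarrow> nat) \<Rightarrow> nat \<Rightarrow> real ^ 'n" where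
  "node_vec vtx v = (\<chi> i. if vtx i = v then 1 else 0)"

definition arc_vec :: "('n::finite \<Rightarrow> nat) \<Rightarrow> nat \<times> nat \<Rightarrow> real ^ 'n" where
  "arc_vec vtx a = node_vec vtx (snd a) - node_vec vtx (fst a)"

text \<open>Loops in \<open>D\<close> are allowed: the exceptional routes, whose g-vector is 0,
  become loops.\<close>

locale root_polytope =
  fixes vtx :: "'n::finite \<Rightarrow> nat" and n :: nat and D :: "(nat \<times> nat) set"
  assumes vtx: "bij_betw vtx UNIV {1..n}"
    and nodes: "\<And>u v. (u, v) \<in> D \<Longrightarrow> u \<le> n \<and> v \<le> n"
    and star: "\<And>v. v \<in> {1..n} \<Longrightarrow> (0, v) \<in> D \<and> (v, 0) \<in> D"
    and two_nodes: "2 \<le> n"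
begin

abbreviation "g \<equiv> arc_vec vtx"

definition P :: "(real ^ 'n) set" where "P = convex hull (g ` D)"

lemma finite_D: "finite D"
  by (rule finite_subset[of _ "{..n} \<times> {..n}"]) (use nodes in auto)

lemma in_P: "a \<in> D \<Longrightarrow> g a \<in> P"
  unfolding P_def by (simp add: hull_inc)

text \<open>Coordinates can be prescribed at the nodes 1 to n only; the functional therefore
  reproduces \<open>\<phi>\<close> up to the constant \<open>\<phi> 0\<close>, which cancels along
  an arc.\<close>

lemma potential:
  fixes \<phi> :: "nat \<Rightarrow> real"
  obtains c :: "real ^ 'n" where "\<And>u v. u \<le> n \<Longrightarrow> v \<le> n \<Longrightarrow> c \<bullet> g (u, v) = \<phi> v - \<phi> u"
proof
  let ?c = "\<chi> i. \<phi> (vtx i) - \<phi> 0"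
  have inj: "inj vtx" and img: "range vtx = {1..n}"
    using vtx by (auto simp: bij_betw_def)
  have *: "?c \<bullet> node_vec vtx v = \<phi> v - \<phi> 0" if "v \<le> n" for v
  proof (cases "v = 0")
    case True
    have "0 \<notin> range vtx" using img by simp
    then have "vtx i \<noteq> 0" for i by (metis rangeI)
    then have "node_vec vtx 0 = 0" by (simp add: node_vec_def vec_eq_iff)
    then show ?thesis using True by simp
  next
    case False
    then have "v \<in> range vtx" using that img by simp
    then obtain i where i: "vtx i = v" by blast
    then have "vtx j = v \<longleftrightarrow> j = i" for j using inj by (auto dest: injD)
    then have "?c \<bullet> node_vec vtx v = (\<Sum>j\<in>UNIV. if j = i then \<phi> (vtx j) - \<phi> 0 else 0)"
      by (simp add: inner_vec_def node_vec_def if_distrib cong: if_cong)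
    then show ?thesis using i by (simp add: sum.delta)
  qed
  show "?c \<bullet> g (u, v) = \<phi> v - \<phi> u" if "u \<le> n" "v \<le> n" for u v
    using that by (simp add: arc_vec_def inner_diff_right *)
qed

text \<open>The supporting hyperplane at level \<open>M\<close> cuts out a face, which is the hull
  of those generators that lie on it.\<close>

lemma face_of_potential:
  fixes \<phi> :: "nat \<Rightarrow> real"
  assumes le: "\<And>u v. (u, v) \<in> D \<Longrightarrow> \<phi> v - \<phi> u \<le> M"
    and E: "\<And>u v. (u, v) \<in> D \<Longrightarrow> \<phi> v - \<phi> u = M \<Longrightarrow> (u, v) \<in> E"
    and ED: "\<And>u v. (u, v) \<in> E \<Longrightarrow> (u, v) \<in> D \<and> \<phi> v - \<phi> u = M"
  shows "convex hull (g ` E) face_of P"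
proof -
  obtain c :: "real ^ 'n" where c: "\<And>u v. u \<le> n \<Longrightarrow> v \<le> n \<Longrightarrow> c \<bullet> g (u, v) = \<phi> v - \<phi> u"
    using potential by blast
  have cD: "c \<bullet> g a = \<phi> (snd a) - \<phi> (fst a)" if "a \<in> D" for a
    using c nodes that by (cases a) auto
  let ?F = "P \<inter> {x. c \<bullet> x = M}"
  have "P \<subseteq> {x. c \<bullet> x \<le> M}"
    unfolding P_def
    by (rule hull_minimal) (use cD le convex_halfspace_le in auto)
  then have face: "?F face_of P"
    by (intro face_of_Int_supporting_hyperplane_le) (auto simp: P_def)
  then obtain G where G: "G \<subseteq> g ` D" "?F = convex hull G"
    using face_of_convex_hull_subset[of "g ` D" ?F] finite_D
    by (auto simp: P_def finite_imp_compact)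
  have "G \<subseteq> g ` E"
  proof
    fix x assume x: "x \<in> G"
    then obtain u v where uv: "(u, v) \<in> D" "x = g (u, v)" using G(1) by auto
    have "c \<bullet> x = M" using x G(2) hull_inc[of x G convex] by auto
    then show "x \<in> g ` E" using uv cD E by fastforce
  qed
  then have "?F \<subseteq> convex hull (g ` E)" unfolding G(2) by (rule hull_mono)
  moreover have "convex hull (g ` E) \<subseteq> ?F"
  proof (rule hull_minimal)
    show "g ` E \<subseteq> ?F" using ED cD in_P by fastforce
    show "convex ?F" using face face_of_imp_convex by blast
  qed
  ultimately show ?thesis using face by simp
qed

text \<open>The vectors of \<open>(u, v)\<close>, \<open>(v, 0)\<close> and \<open>(0, u)\<close>
  sum to 0. So 0 divides the segment from \<open>g a\<close> to the midpoint of the other two, and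
  the face property forces \<open>g a\<close> into \<open>F\<close>.\<close>

lemma face_containing_0:
  assumes F: "F face_of P" and 0: "0 \<in> F"
  shows "F = P"
proof -
  have "g a \<in> F" if a: "a \<in> D" for a
  proof (cases "g a = 0")
    case True
    then show ?thesis using 0 by simp
  next
    case False
    obtain u v where uv: "a = (u, v)" by force
    have z: "node_vec vtx 0 = 0"
    proof -
      have "0 \<notin> range vtx" using vtx by (simp add: bij_betw_def)
      then have "vtx i \<noteq> 0" for i by (metis rangeI)
      then show ?thesis by (simp add: node_vec_def vec_eq_iff)
    qed
    have "- node_vec vtx v \<in> P" "node_vec vtx u \<in> P"
    proof -
      \<comment> \<open>For an arc with an end at node 0 one of the closing vectors is 0 itself, so
        0 has to be in \<open>P\<close> first.\<close>
      have "0 = g (0, 1) + g (1, 0)" by (simp add: arc_vec_def)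
      then have "0 \<in> P"
        using in_P star[of 1] two_nodes midpoint_in_closed_segment[of "g (0,1)" "g (1,0)"]
          closed_segment_subset[of "g (0,1)" P "g (1,0)"]
        by (auto simp: midpoint_def P_def)
      then have "- node_vec vtx w \<in> P \<and> node_vec vtx w \<in> P" if "w \<le> n" for w
        using star[of w] that in_P[of "(0, w)"] in_P[of "(w, 0)"] z
        by (cases "w = 0") (auto simp: arc_vec_def)
      then show "- node_vec vtx v \<in> P" "node_vec vtx u \<in> P"
        using nodes a uv by auto
    qed
    then have m: "midpoint (- node_vec vtx v) (node_vec vtx u) \<in> P" (is "?m \<in> P")
      using midpoint_in_closed_segment closed_segment_subset convex_convex_hull
      unfolding P_def by blast
    have ga: "g a = - 2 *\<^sub>R ?m" by (simp add: midpoint_def uv arc_vec_def)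
    have "g a \<noteq> ?m"
    proof
      assume "g a = ?m"
      then have "3 *\<^sub>R g a = g a + 2 *\<^sub>R ?m" by (simp add: scaleR_left.add[of 1 2, simplified])
      then show False using False ga by simp
    qed
    moreover have "0 = (1 - 2/3) *\<^sub>R g a + (2/3) *\<^sub>R ?m" by (simp add: ga)
    ultimately have "0 \<in> open_segment (g a) ?m"
      unfolding in_segment(2) by (intro conjI exI[of _ "2/3"]) auto
    then show ?thesis using face_ofD[OF F _ in_P[OF a] m 0] by blast
  qed
  then have "P \<subseteq> F"
    unfolding P_def using F face_of_imp_convex by (intro hull_minimal) auto
  then show ?thesis using F face_of_imp_subset by blast
qed

lemma face_of_self: "P face_of P"
  by (simp add: P_def face_of_refl)

text \<open>A non-loop arc gives a vertex of \<open>P\<close>, different ones giving different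
  vertices: the potential 1 at \<open>v\<close>, -1 at \<open>u\<close>, 0 elsewhere has value 2 on
  \<open>(u, v)\<close> and at most 1 on every other arc.\<close>

lemma arc_in_segment:
  assumes "u \<noteq> v" "u \<le> n" "v \<le> n" "g (u, v) \<in> closed_segment (g a) (g b)"
    and "a \<in> D" "b \<in> D"
  shows "a = (u, v) \<or> b = (u, v)"
proof (rule ccontr)
  assume neg: "\<not> ?thesis"
  define \<phi> :: "nat \<Rightarrow> real" where "\<phi> w = (if w = v then 1 else if w = u then -1 else 0)" for w
  obtain c :: "real ^ 'n" where c: "\<And>u v. u \<le> n \<Longrightarrow> v \<le> n \<Longrightarrow> c \<bullet> g (u, v) = \<phi> v - \<phi> u"
    using potential by blast
  have "c \<bullet> g e \<le> 1" if e: "e \<in> D" "e \<noteq> (u, v)" for e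
  proof -
    obtain s t where st: "e = (s, t)" by force
    then have "c \<bullet> g e = \<phi> t - \<phi> s" using c nodes e by blast
    then show ?thesis using st e(2) by (simp add: \<phi>_def)
  qed
  then have "c \<bullet> g a \<le> 1" "c \<bullet> g b \<le> 1" using assms neg by blast+
  then have "closed_segment (g a) (g b) \<subseteq> {x. c \<bullet> x \<le> 1}"
    by (intro closed_segment_subset) (auto simp: convex_halfspace_le)
  then have "c \<bullet> g (u, v) \<le> 1" using assms(4) by blast
  then show False using c[OF assms(2,3)] assms(1) by (simp add: \<phi>_def)
qed

text \<open>The arcs \<open>(0, 1)\<close>, \<open>(1, 0)\<close> and \<open>(0, 2)\<close> give
  three vertices, but a segment has only two ends.\<close>

lemma P_not_segment:
  assumes "a \<in> D" "b \<in> D"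
  shows "closed_segment (g a) (g b) \<noteq> P"
proof
  assume eq: "closed_segment (g a) (g b) = P"
  have *: "(0, 1) \<in> D" "(1, 0) \<in> D" "(0, 2) \<in> D" using star two_nodes by auto
  have "a = (0, 1) \<or> b = (0, 1)" "a = (1, 0) \<or> b = (1, 0)" "a = (0, 2) \<or> b = (0, 2)"
    using arc_in_segment[OF _ _ _ _ assms] in_P * two_nodes eq by auto
  then show False by auto
qed

lemma proper_face_arc:
  assumes "(u, v) \<in> D" "u \<noteq> v"
  shows "{g (u, v)} face_of P" "{g (u, v)} \<noteq> P"
proof -
  have "convex hull (g ` {(u, v)}) face_of P"
    by (rule face_of_potential[where \<phi> = "\<lambda>w. if w = v then 1 else if w = u then -1 else 0" and M = 2])
      (use assms in \<open>auto split: if_splits\<close>)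
  then show "{g (u, v)} face_of P" by simp
  show "{g (u, v)} \<noteq> P" using P_not_segment[OF assms(1) assms(1)] by simp
qed

lemma sum_arcs:
  assumes "F face_of P" "g a \<in> F" "g b \<in> F" "c \<in> D" "d \<in> D" "g a + g b = g c + g d"
  shows "g c \<in> F" "g d \<in> F"
  using face_of_exchange[OF assms(1-3) in_P in_P assms(6)] assms(4,5) by auto

lemma minimal_face_all:
  assumes "\<And>F. F face_of P \<Longrightarrow> g a \<in> F \<Longrightarrow> g b \<in> F \<Longrightarrow> 0 \<in> F" "a \<in> D" "b \<in> D"
  shows "minimal_face P {g a, g b} = P"
  by (rule minimal_face_eqI) (use face_of_self assms in_P face_containing_0 in auto)

text \<open>Each vertex is a proper face of a polyhedron and so lies on a facet. A facet through
  both would contain 0 and be all of \<open>P\<close>.\<close>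

lemma different_facets:
  assumes ab: "a \<in> D" "b \<in> D" "fst a \<noteq> snd a" "fst b \<noteq> snd b"
    and 0: "\<And>F. F face_of P \<Longrightarrow> g a \<in> F \<Longrightarrow> g b \<in> F \<Longrightarrow> 0 \<in> F"
  shows "on_different_facets P (g a) (g b)"
proof -
  have "polyhedron P"
    unfolding P_def by (intro polyhedron_convex_hull finite_imageI finite_D)
  then have "\<exists>F. F facet_of P \<and> g e \<in> F" if "e \<in> D" "fst e \<noteq> snd e" for e
    using that proper_face_arc[of "fst e" "snd e"] face_of_polyhedron_subset_facet[of P "{g e}"]
    by auto
  moreover have False if "F facet_of P" "g a \<in> F" "g b \<in> F" for F
  proof -
    have "F = P" using 0 that face_containing_0 facet_of_imp_face_of by blast
    then show False using that by (simp add: facet_of_def)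
  qed
  ultimately show ?thesis unfolding on_different_facets_def using ab by blast
qed

lemma edge_iff_face:
  assumes "g a \<noteq> g b" "convex hull (g ` {a, b}) face_of P"
  shows "closed_segment (g a) (g b) edge_of P"
    "minimal_face P {g a, g b} = closed_segment (g a) (g b)"
proof -
  have seg: "convex hull (g ` {a, b}) = closed_segment (g a) (g b)"
    by (simp add: segment_convex_hull)
  have "aff_dim (convex hull {g a, g b}) = 1" using assms(1) by (simp add: aff_dim_convex_hull aff_dim_2)
  then show "closed_segment (g a) (g b) edge_of P"
    using assms(2) unfolding edge_of_def by (simp add: segment_convex_hull)
  show "minimal_face P {g a, g b} = closed_segment (g a) (g b)"
  proof (rule minimal_face_eqI)
    show "closed_segment (g a) (g b) \<subseteq> F" if "F face_of P" "{g a, g b} \<subseteq> F" for F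
      using that face_of_imp_convex closed_segment_subset by blast
  qed (use assms(2) seg in auto)
qed

text \<open>The point \<open>g c\<close> would lie on the segment. As a vertex it would be one of
  the ends; if \<open>c\<close> is a loop, the segment contains 0 and would be all of
  \<open>P\<close>.\<close>

lemma not_edge:
  assumes "a \<in> D" "b \<in> D" "c \<in> D" "d \<in> D" "g a + g b = g c + g d" "c \<noteq> a" "c \<noteq> b"
  shows "\<not> closed_segment (g a) (g b) edge_of P"
proof
  assume "closed_segment (g a) (g b) edge_of P"
  then have face: "closed_segment (g a) (g b) face_of P" by (simp add: edge_of_def)
  have gc: "g c \<in> closed_segment (g a) (g b)"
    using sum_arcs[OF face _ _ assms(3-5)] by simp
  show False
  proof (cases "fst c = snd c")
    case True
    then have "g c = 0" by (simp add: arc_vec_def)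
    then show False using face_containing_0[OF face] gc P_not_segment assms by auto
  next
    case False
    then show False
      using arc_in_segment[of "fst c" "snd c" a b] gc assms nodes[of "fst c" "snd c"] by auto
  qed
qed

section \<open>Squares and edges cut out by explicit potentials\<close>

lemma minimal_face_quad:
  assumes "a \<in> D" "b \<in> D" "c \<in> D" "d \<in> D" "g a + g b = g c + g d"
    and "convex hull (g ` {a, b, c, d}) face_of P"
  shows "minimal_face P {g a, g b} = convex hull (g ` {a, b, c, d})"
proof (rule minimal_face_eqI)
  show "{g a, g b} \<subseteq> convex hull (g ` {a, b, c, d})" by (auto intro: hull_inc)
  show "convex hull (g ` {a, b, c, d}) \<subseteq> F" if "F face_of P" "{g a, g b} \<subseteq> F" for F
    using sum_arcs[of F a b c d] that assms face_of_imp_convex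
    by (intro hull_minimal) auto
qed (rule assms(6))

text \<open>With -1 at both tails and 1 at both heads, exactly the arcs from one of the tails to one
  of the heads reach 2. The nodes may coincide as \<open>a = c\<close> or \<open>b = d\<close>,
  which gives the edge between two arcs with a common end.\<close>

lemma face_crossing:
  assumes D: "(a, b) \<in> D" "(c, d) \<in> D" "(a, d) \<in> D" "(c, b) \<in> D"
    and ne: "a \<noteq> b" "a \<noteq> d" "c \<noteq> b" "c \<noteq> d"
  shows "convex hull (g ` {(a, b), (c, d), (a, d), (c, b)}) face_of P"
proof -
  define \<phi> :: "nat \<Rightarrow> real" where
    "\<phi> w = (if w \<in> {a, c} then -1 else if w \<in> {b, d} then 1 else 0)" for w
  have le: "\<phi> w \<le> 1" "-1 \<le> \<phi> w" for w by (simp_all add: \<phi>_def)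
  have tail: "\<phi> u = -1 \<Longrightarrow> u \<in> {a, c}" and head: "\<phi> v = 1 \<Longrightarrow> v \<in> {b, d}" for u v
    by (simp_all add: \<phi>_def split: if_splits)
  have val: "\<phi> a = -1" "\<phi> c = -1" "\<phi> b = 1" "\<phi> d = 1"
    using ne by (simp_all add: \<phi>_def)
  show ?thesis
  proof (rule face_of_potential[where \<phi> = \<phi> and M = 2])
    fix u v
    show "\<phi> v - \<phi> u \<le> 2" using le(1)[of v] le(2)[of u] by linarith
    show "(u, v) \<in> {(a, b), (c, d), (a, d), (c, b)}" if "\<phi> v - \<phi> u = 2"
    proof -
      have "\<phi> v = 1" "\<phi> u = -1" using le(1)[of v] le(2)[of u] that by linarith+
      then show ?thesis using tail head by blast
    qed
    show "(u, v) \<in> D \<and> \<phi> v - \<phi> u = 2" if "(u, v) \<in> {(a, b), (c, d), (a, d), (c, b)}"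
      using that D val by fastforce
  qed
qed

lemma edge_common_tail:
  assumes "(a, b) \<in> D" "(a, d) \<in> D" "a \<noteq> b" "a \<noteq> d"
  shows "convex hull (g ` {(a, b), (a, d)}) face_of P"
  using face_crossing[of a b a d] assms by (simp add: insert_commute)

lemma edge_common_head:
  assumes "(a, b) \<in> D" "(c, b) \<in> D" "a \<noteq> b" "c \<noteq> b"
  shows "convex hull (g ` {(a, b), (c, b)}) face_of P"
  using face_crossing[of a b c b] assms by (simp add: insert_commute)

text \<open>The potential is tilted so that both given arcs have value 3, \<open>(a, d)\<close> only
  2, and the missing arc \<open>(c, b)\<close> is the only one that could exceed 3.\<close>

lemma edge_missing_corner:
  assumes D: "(a, b) \<in> D" "(c, d) \<in> D" "(c, b) \<notin> D"
    and ne: "a \<noteq> b" "a \<noteq> d" "c \<noteq> b" "c \<noteq> d" "a \<noteq> c" "b \<noteq> d"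
  shows "convex hull (g ` {(a, b), (c, d)}) face_of P"
proof -
  define \<phi> :: "nat \<Rightarrow> real" where
    "\<phi> w = (if w = a then -1 else if w = c then -2 else if w = b then 2
      else if w = d then 1 else 0)" for w
  have val: "\<phi> a = -1" "\<phi> c = -2" "\<phi> b = 2" "\<phi> d = 1"
    using ne by (simp_all add: \<phi>_def)
  have bnd: "\<phi> w \<le> 2" "-2 \<le> \<phi> w" "w \<noteq> b \<Longrightarrow> \<phi> w \<le> 1" "w \<noteq> c \<Longrightarrow> -1 \<le> \<phi> w" for w
    by (simp_all add: \<phi>_def)
  have tail: "\<phi> u = -1 \<Longrightarrow> u = a" and head: "\<phi> v = 1 \<Longrightarrow> v = d" for u v
    by (simp_all add: \<phi>_def split: if_splits)
  have main: "\<phi> v - \<phi> u \<le> 3 \<and> (\<phi> v - \<phi> u = 3 \<longrightarrow> (u, v) \<in> {(a, b), (c, d)})"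
    if uv: "(u, v) \<in> D" for u v
  proof -
    consider "u = c" "v \<noteq> b" | "u \<noteq> c" "v = b" | "u \<noteq> c" "v \<noteq> b" using uv D(3) by blast
    then show ?thesis
    proof cases
      case 1
      then show ?thesis using bnd(3)[of v] head[of v] val by auto
    next
      case 2
      then show ?thesis using bnd(4)[of u] tail[of u] val by auto
    next
      case 3
      then have "\<phi> v - \<phi> u < 3" using bnd(3)[of v] bnd(4)[of u] by linarith
      then show ?thesis by simp
    qed
  qed
  show ?thesis
    by (rule face_of_potential[where \<phi> = \<phi> and M = 3]) (use main D val in fastforce)+
qed

text \<open>The potential is negative at the nodes reached from \<open>x\<close> and positive at the nodes leading
  to \<open>y\<close>, so that only the two-step walks through \<open>0\<close> and \<open>z\<close> gain 1 in both steps.\<close>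

lemma face_two_step:
  assumes D: "(x, z) \<in> D" "(z, y) \<in> D" "(x, 0) \<in> D" "(0, y) \<in> D" "(x, y) \<notin> D"
    and ne: "x \<noteq> 0" "y \<noteq> 0" "x \<noteq> y" "x \<noteq> z" "z \<noteq> y"
    and mid: "\<And>w. (x, w) \<in> D \<Longrightarrow> (w, y) \<in> D \<Longrightarrow> w = 0 \<or> w = z"
  shows "convex hull (g ` {(x, z), (z, y), (x, 0), (0, y)}) face_of P"
proof -
  \<comment> \<open>Any number strictly between 0 and 1/2 could replace 1/3: an arc from
    \<open>x\<close> to such a node, from such a node to \<open>y\<close>, or between two such nodes
    then stays below 1.\<close>
  define \<phi> :: "nat \<Rightarrow> real" where
    "\<phi> w = (if w = x then -1 else if w = y then 1 else if w = 0 \<or> w = z then 0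
      else if (x, w) \<in> D then -1/3 else if (w, y) \<in> D then 1/3 else 0)" for w
  have val: "\<phi> x = -1" "\<phi> y = 1" "\<phi> 0 = 0" "\<phi> z = 0"
    using ne by (simp_all add: \<phi>_def)
  have bnd: "\<phi> w \<le> 1" "-1 \<le> \<phi> w" "w \<noteq> y \<Longrightarrow> \<phi> w \<le> 1/3" "w \<noteq> x \<Longrightarrow> -1/3 \<le> \<phi> w" for w
    by (simp_all add: \<phi>_def)
  have out: "w \<in> {0, z} \<or> \<phi> w < 0" if "(x, w) \<in> D" for w
    using that D(5) unfolding \<phi>_def by (cases "w = x"; cases "w = y") simp_all
  have inn: "w \<in> {0, z} \<or> 0 < \<phi> w" if w: "(w, y) \<in> D" for w
  proof (cases "w \<in> {0, z}")
    case False
    then have "(x, w) \<notin> D" using mid w by blast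
    moreover have "w \<noteq> x" using w D(5) by blast
    ultimately show ?thesis using w False unfolding \<phi>_def by (cases "w = y") simp_all
  qed simp
  have main: "\<phi> v - \<phi> u \<le> 1 \<and> (\<phi> v - \<phi> u = 1 \<longrightarrow> (u, v) \<in> {(x, z), (z, y), (x, 0), (0, y)})"
    if uv: "(u, v) \<in> D" for u v
  proof -
    consider "u = x" | "v = y" "u \<noteq> x" | "u \<noteq> x" "v \<noteq> y" by blast
    then show ?thesis
    proof cases
      case 1
      then show ?thesis using out[of v] uv val by fastforce
    next
      case 2
      then show ?thesis using inn[of u] uv val by fastforce
    next
      case 3
      then have "\<phi> v - \<phi> u < 1" using bnd(3)[of v] bnd(4)[of u] by linarith
      then show ?thesis by simp
    qed
  qed
  show ?thesis
    by (rule face_of_potential[where \<phi> = \<phi> and M = 1]) (use main D val in fastforce)+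
qed

end

section \<open>Adjacent edges\<close>

definition adjacent :: "'a list \<Rightarrow> 'a \<Rightarrow> 'a \<Rightarrow> bool" where
  "adjacent xs e f \<longleftrightarrow> (\<exists>p q. xs = p @ [e, f] @ q)"

lemma adjacent_Cons: "adjacent (a # b # xs) e f \<longleftrightarrow> a = e \<and> b = f \<or> adjacent (b # xs) e f"
proof
  assume "adjacent (a # b # xs) e f"
  then obtain p q where "a # b # xs = p @ [e, f] @ q" by (auto simp: adjacent_def)
  then show "a = e \<and> b = f \<or> adjacent (b # xs) e f"
    by (cases p) (auto simp: adjacent_def)
next
  assume "a = e \<and> b = f \<or> adjacent (b # xs) e f"
  then show "adjacent (a # b # xs) e f"
  proof
    assume "adjacent (b # xs) e f"
    then obtain p q where "b # xs = p @ [e, f] @ q" by (auto simp: adjacent_def)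
    then have "a # b # xs = (a # p) @ [e, f] @ q" by simp
    then show ?thesis unfolding adjacent_def by blast
  next
    assume "a = e \<and> b = f"
    then have "a # b # xs = [] @ [e, f] @ xs" by simp
    then show ?thesis unfolding adjacent_def by blast
  qed
qed

lemma adjacent_rev: "adjacent (rev xs) e f \<longleftrightarrow> adjacent xs f e"
proof -
  have "adjacent (rev xs) e f" if "adjacent xs f e" for xs :: "'a list" and e f
  proof -
    from that obtain p q where "xs = p @ [f, e] @ q" by (auto simp: adjacent_def)
    then have "rev xs = rev q @ [e, f] @ rev p" by simp
    then show ?thesis unfolding adjacent_def by blast
  qed
  from this[of xs f e] this[of "rev xs" e f] show ?thesis by auto
qed

text \<open>The possible consecutive pairs in the list \<open>L\<close>, \<open>InnerEdge a\<close>,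
  ..., \<open>InnerEdge (b - 1)\<close>, \<open>H\<close>. Only the upward order is treated; a route
  on an odd leg is such a list reversed.\<close>

inductive interval_step :: "edge \<Rightarrow> nat \<Rightarrow> nat \<Rightarrow> edge \<Rightarrow> edge \<Rightarrow> edge \<Rightarrow> bool" for L a b H where
  none: "a = b \<Longrightarrow> interval_step L a b H L H"
| first: "a < b \<Longrightarrow> interval_step L a b H L (InnerEdge a)"
| mid: "a \<le> i \<Longrightarrow> Suc i < b \<Longrightarrow> interval_step L a b H (InnerEdge i) (InnerEdge (Suc i))"
| last: "a \<le> i \<Longrightarrow> Suc i = b \<Longrightarrow> interval_step L a b H (InnerEdge i) H"

lemma adjacent_interval:
  assumes "a \<le> b"
  shows "adjacent (L # map InnerEdge [a..<b] @ [H]) e f \<longleftrightarrow> interval_step L a b H e f"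
  using assms
proof (induction a arbitrary: L rule: inc_induct)
  case base
  have "\<not> adjacent [H] e f" by (simp add: adjacent_def Cons_eq_append_conv)
  then show ?case by (auto simp: adjacent_Cons interval_step.simps)
next
  case (step a)
  have "adjacent (L # map InnerEdge [a..<b] @ [H]) e f \<longleftrightarrow>
      L = e \<and> InnerEdge a = f \<or> interval_step (InnerEdge a) (Suc a) b H e f"
    using step by (simp add: upt_conv_Cons adjacent_Cons)
  also have "\<dots> \<longleftrightarrow> interval_step L a b H e f"
    using step.hyps unfolding interval_step.simps
    by (auto simp: le_eq_less_or_eq Suc_le_eq dest: Suc_lessI)
  finally show ?case .
qed

section \<open>Positions on the legs\<close>

definition is_path :: "shape \<Rightarrow> bool" where
  "is_path K \<longleftrightarrow> (\<exists>ks. K = Path ks)"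

locale lab_framing =
  fixes K :: shape
  assumes wf: "wf_shape K"
begin

abbreviation "r \<equiv> length (seq K)"
abbreviation "n \<equiv> num_inner K"
abbreviation "N \<equiv> sum_list (seq K)"

text \<open>Legs are numbered from 0, and leg \<open>m\<close> occupies the positions from \<open>turn m\<close> to
  \<open>turn (Suc m)\<close>.  In a cycle the last position \<open>Suc N\<close> is a second copy of the vertex 1.\<close>

definition turn :: "nat \<Rightarrow> nat" where "turn m = Suc (sum_list (take m (seq K)))"

definition vx :: "nat \<Rightarrow> nat" where "vx x = (if \<not> is_path K \<and> x = Suc N then 1 else x)"

text \<open>The inner edge \<open>i\<close> joins the positions \<open>i\<close> and
  \<open>i + 1\<close>. Read as a position, \<open>i\<close> lies on leg \<open>m\<close> but is not
  its upper end; in both readings the leg is unique.\<close>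

definition inleg :: "nat \<Rightarrow> nat \<Rightarrow> bool" where
  "inleg m i \<longleftrightarrow> m < r \<and> turn m \<le> i \<and> i < turn (Suc m)"

lemma r_pos: "0 < r"
  using wf by (cases K) auto

lemma seq_pos: "m < r \<Longrightarrow> 0 < seq K ! m"
  using wf by (cases K) auto

lemma cycle_even: "\<not> is_path K \<Longrightarrow> even r"
  using wf by (cases K) (auto simp: is_path_def)

lemma cycle_r: "\<not> is_path K \<Longrightarrow> 2 \<le> r"
  using cycle_even r_pos by (cases r) (auto elim: oddE)

lemma n_eq: "n = (if is_path K then Suc N else N)"
  by (cases K) (auto simp: is_path_def)

lemma turn_0 [simp]: "turn 0 = 1" by (simp add: turn_def)

lemma turn_r: "turn r = Suc N" by (simp add: turn_def)

lemma turn_pos: "0 < turn m" by (simp add: turn_def)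

lemma turn_Suc: "m < r \<Longrightarrow> turn m < turn (Suc m)"
  using seq_pos by (simp add: turn_def take_Suc_conv_app_nth)

lemma turn_mono: "m \<le> m' \<Longrightarrow> turn m \<le> turn m'"
proof -
  have *: "turn m \<le> turn (Suc m)" for m
    by (cases "m < r") (simp_all add: turn_def take_Suc_conv_app_nth)
  show "m \<le> m' \<Longrightarrow> turn m \<le> turn m'"
    using lift_Suc_mono_le[of turn] * by blast
qed

lemma turn_less: "m < m' \<Longrightarrow> m' \<le> r \<Longrightarrow> turn m < turn m'"
  using turn_Suc[of m] turn_mono[of "Suc m" m'] by linarith

lemma turn_inj: "m \<le> r \<Longrightarrow> m' \<le> r \<Longrightarrow> turn m = turn m' \<Longrightarrow> m = m'"
  using turn_less by (metis less_irrefl linorder_neqE_nat)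

lemma turn_le_iff: "m \<le> r \<Longrightarrow> m' \<le> r \<Longrightarrow> turn m \<le> turn m' \<longleftrightarrow> m \<le> m'"
  using turn_less turn_mono by (meson leD leI)

lemma turn_less_iff: "m \<le> r \<Longrightarrow> m' \<le> r \<Longrightarrow> turn m < turn m' \<longleftrightarrow> m < m'"
  using turn_le_iff by (meson not_le)

lemma turn_le_N: "m \<le> r \<Longrightarrow> turn m \<le> Suc N"
  using turn_mono[of m r] turn_r by simp

lemma turn_less_N: "m < r \<Longrightarrow> turn m \<le> N"
  using turn_less[of m r] turn_r by simp

lemma inleg_unique:
  assumes "inleg m i" "inleg m' i" shows "m = m'"
proof -
  have "\<not> Suc m \<le> m'" "\<not> Suc m' \<le> m"
    using assms turn_mono[of "Suc m" m'] turn_mono[of "Suc m'" m] by (auto simp: inleg_def)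
  then show ?thesis by simp
qed

lemma inleg_bounds: "inleg m i \<Longrightarrow> 1 \<le> i \<and> i \<le> N"
  unfolding inleg_def using turn_pos[of m] turn_le_N[of "Suc m"] by linarith

lemma inleg_ex: assumes "1 \<le> i" "i \<le> N" obtains m where "inleg m i"
proof -
  let ?m = "LEAST m. i < turn (Suc m)"
  have "i < turn (Suc (r - 1))" using assms r_pos turn_r by simp
  then have 1: "i < turn (Suc ?m)" and 2: "?m \<le> r - 1"
    by (rule LeastI, rule Least_le)
  have "turn ?m \<le> i"
  proof (cases ?m)
    case (Suc k)
    then have "\<not> i < turn (Suc k)" using not_less_Least[of k "\<lambda>m. i < turn (Suc m)"] by simp
    then show ?thesis using Suc by simp
  qed (use assms in simp)
  moreover have "?m < r" using 2 r_pos by linarith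
  ultimately show ?thesis using that[of ?m] 1 unfolding inleg_def by blast
qed

lemma block_inleg: "inleg m i \<Longrightarrow> block K i = Suc m"
  unfolding block_def
proof (rule Least_equality)
  assume i: "inleg m i"
  then show "i \<le> sum_list (take (Suc m) (seq K))"
    unfolding inleg_def turn_def by linarith
  show "Suc m \<le> k" if k: "i \<le> sum_list (take k (seq K))" for k
  proof (rule ccontr)
    assume "\<not> Suc m \<le> k"
    then have "turn k \<le> turn m" using turn_mono by simp
    then show False using k i unfolding inleg_def by (simp add: turn_def)
  qed
qed

lemma next_vertex: "i \<le> N \<Longrightarrow> 1 \<le> i \<Longrightarrow> next_vertex K i = vx (Suc i)"
  unfolding vx_def is_path_def by (cases K) auto

lemma vx_le [simp]: "x \<le> N \<Longrightarrow> vx x = x"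
  by (simp add: vx_def)

lemma vx_turn [simp]: "m < r \<Longrightarrow> vx (turn m) = turn m"
  using turn_less_N by simp

text \<open>The last leg of a cycle is odd because \<open>r\<close> is even, so an even leg never
  ends at the seam.\<close>

lemma vx_turn_even: "m < r \<Longrightarrow> even m \<Longrightarrow> vx (turn (Suc m)) = turn (Suc m)"
proof (cases "Suc m = r")
  case True
  assume "m < r" "even m"
  then have "is_path K" using True cycle_even by (metis even_Suc)
  then show ?thesis by (simp add: vx_def)
qed simp

lemma vx_bounds: "1 \<le> x \<Longrightarrow> x \<le> Suc N \<Longrightarrow> 1 \<le> vx x \<and> vx x \<le> n"
  using n_eq turn_less_N[of 0] r_pos by (auto simp: vx_def)

lemma inner_arc:
  assumes "inleg m i"
  shows "label K (InnerEdge i) = (if even m then 2 else 1)"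
    "edge_tail K (InnerEdge i) = Inner (if even m then i else vx (Suc i))"
    "edge_head K (InnerEdge i) = Inner (if even m then vx (Suc i) else i)"
  using block_inleg[OF assms] next_vertex inleg_bounds[OF assms] by auto

lemma inner_edge_iff: "InnerEdge i \<in> arcs (dag K) \<longleftrightarrow> (\<exists>m. inleg m i)"
  unfolding arcs_iff using inleg_bounds inleg_ex by (metis atLeastAtMost_iff)

lemma ball_inleg: "(\<forall>i\<in>{1..N}. A i) \<longleftrightarrow> (\<forall>m i. inleg m i \<longrightarrow> A i)"
  using inleg_bounds inleg_ex by (metis (no_types) atLeastAtMost_iff)

lemma source_edge_iff:
  "SourceEdge v l \<in> arcs (dag K) \<longleftrightarrow> v \<in> {1..n} \<and> l \<in> {1, 2} \<and>
     (\<forall>m i. inleg m i \<longrightarrow> (if even m then vx (Suc i) else i) = v \<longrightarrow> (if even m then 2 else 1) \<noteq> l)"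
  unfolding arcs_iff ball_inleg
  by (simp add: inner_arc del: edge_head.simps label.simps if_split cong: imp_cong)

lemma sink_edge_iff:
  "SinkEdge v l \<in> arcs (dag K) \<longleftrightarrow> v \<in> {1..n} \<and> l \<in> {1, 2} \<and>
     (\<forall>m i. inleg m i \<longrightarrow> (if even m then i else vx (Suc i)) = v \<longrightarrow> (if even m then 2 else 1) \<noteq> l)"
  unfolding arcs_iff ball_inleg
  by (simp add: inner_arc del: edge_tail.simps label.simps if_split cong: imp_cong)

text \<open>The lower positions \<open>x\<close> and the upper positions \<open>y\<close> at which a route on leg \<open>m\<close> may enter or
  leave the leg: routes run upwards on even legs (label 2) and downwards on odd legs (label 1).
  The positions \<open>turn m - 1\<close> and \<open>turn (Suc m) + 1\<close> encode that the route uses the edge of the long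
  exceptional route of its leg at the respective end.\<close>

definition lov :: "nat \<Rightarrow> nat \<Rightarrow> bool" where
  "lov m x \<longleftrightarrow> m < r \<and> turn m \<le> Suc x \<and> (x < turn (Suc m) \<or> is_path K \<and> Suc m = r \<and> x = turn (Suc m))"

definition hiv :: "nat \<Rightarrow> nat \<Rightarrow> bool" where
  "hiv m y \<longleftrightarrow> m < r \<and> y \<le> Suc (turn (Suc m)) \<and> (turn m < y \<or> is_path K \<and> m = 0 \<and> y = turn m)"

definition valid :: "nat \<Rightarrow> nat \<Rightarrow> nat \<Rightarrow> bool" where
  "valid m x y \<longleftrightarrow> lov m x \<and> hiv m y \<and> x \<le> y"

text \<open>Clamping sends the virtual position \<open>turn m - 1\<close> to the vertex that is
  actually visited.\<close>

definition lo :: "nat \<Rightarrow> nat \<Rightarrow> nat" where "lo m x = max x (turn m)"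
definition hi :: "nat \<Rightarrow> nat \<Rightarrow> nat" where "hi m y = min y (turn (Suc m))"

text \<open>An edge of the long exceptional route has the label of its leg, any other end edge the
  opposite label; the lower end is the source end exactly on even legs.\<close>

definition lo_edge :: "nat \<Rightarrow> nat \<Rightarrow> edge" where
  "lo_edge m x = (if even m then SourceEdge (vx (lo m x)) (if x < turn m then 2 else 1)
     else SinkEdge (vx (lo m x)) (if x < turn m then 1 else 2))"

definition hi_edge :: "nat \<Rightarrow> nat \<Rightarrow> edge" where
  "hi_edge m y = (if even m then SinkEdge (vx (hi m y)) (if turn (Suc m) < y then 2 else 1)
     else SourceEdge (vx (hi m y)) (if turn (Suc m) < y then 1 else 2))"

definition rt :: "nat \<Rightarrow> nat \<Rightarrow> nat \<Rightarrow> edge list" where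
  "rt m x y = (if even m then lo_edge m x # map InnerEdge [lo m x..<hi m y] @ [hi_edge m y]
     else hi_edge m y # map InnerEdge (rev [lo m x..<hi m y]) @ [lo_edge m x])"

lemma vx_eq: "1 \<le> x \<Longrightarrow> x \<le> Suc N \<Longrightarrow> 1 \<le> y \<Longrightarrow> y \<le> Suc N \<Longrightarrow> vx x = vx y \<longleftrightarrow>
   x = y \<or> \<not> is_path K \<and> (x = 1 \<and> y = Suc N \<or> x = Suc N \<and> y = 1)"
  by (auto simp: vx_def)

lemma lo_bounds: "lov m x \<Longrightarrow> turn m \<le> lo m x \<and> lo m x \<le> turn (Suc m)"
  unfolding lov_def lo_def using turn_Suc[of m] by auto

lemma hi_bounds: "hiv m y \<Longrightarrow> turn m \<le> hi m y \<and> hi m y \<le> turn (Suc m)"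
  unfolding hiv_def hi_def using turn_Suc[of m] by auto

lemma lo_le_hi: "valid m x y \<Longrightarrow> lo m x \<le> hi m y"
  unfolding valid_def lov_def hiv_def hi_def lo_def using turn_Suc[of m] by auto

section \<open>Existence of the end edges\<close>

lemma inleg_below_turn:
  assumes "m \<le> r" "inleg m' i" "Suc i = turn m" shows "m = Suc m'"
proof -
  have "turn m' < turn m" "turn m \<le> turn (Suc m')" using assms by (auto simp: inleg_def)
  then show ?thesis using assms turn_less_iff[of m' m] turn_le_iff[of m "Suc m'"]
    by (auto simp: inleg_def)
qed

lemma inleg_at_turn: "m \<le> r \<Longrightarrow> inleg m' (turn m) \<Longrightarrow> m = m'"
  using turn_le_iff[of m' m] turn_less_iff[of m "Suc m'"] by (auto simp: inleg_def)

text \<open>Neighbouring legs have opposite directions, also across the seam since \<open>r\<close>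
  is even. So no inner edge of the same direction arrives at the lower turn of leg \<open>m\<close>,
  and the label of the leg is still free there for an end edge.\<close>

lemma parallel_not_at_start:
  assumes that: "m < r" "inleg m' i" "even m \<longleftrightarrow> even m'"
  shows "vx (Suc i) \<noteq> turn m"
proof
  assume eq: "vx (Suc i) = turn m"
  have i: "1 \<le> i" "i \<le> N" using inleg_bounds that by auto
  show False
  proof (cases "Suc i = turn m")
    case True
    then show False using inleg_below_turn[of m m' i] that by auto
  next
    case False
    then have c: "\<not> is_path K" "Suc i = turn r" "turn m = 1"
      using eq by (auto simp: vx_def turn_r split: if_splits)
    then have "r = Suc m'" "m = 0" using inleg_below_turn[of r m' i] that turn_inj[of m 0] by auto
    then show False using cycle_even[OF c(1)] that by simp
  qed
qed

lemma parallel_not_at_end: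
  assumes that: "m < r" "inleg m' i" "even m \<longleftrightarrow> even m'"
  shows "i \<noteq> vx (turn (Suc m))"
proof
  assume eq: "i = vx (turn (Suc m))"
  show False
  proof (cases "vx (turn (Suc m)) = turn (Suc m)")
    case True
    then show False using inleg_at_turn[of "Suc m" m'] that eq by auto
  next
    case False
    then have c: "\<not> is_path K" "turn (Suc m) = turn r" "i = turn 0"
      using eq by (auto simp: vx_def turn_r split: if_splits)
    then have "r = Suc m" "m' = 0"
      using inleg_at_turn[of 0 m'] that turn_inj[of "Suc m" r] by auto
    then show False using cycle_even[OF c(1)] that by simp
  qed
qed

text \<open>At a turning vertex two legs meet head to head or tail to tail, so both incoming or both
  outgoing edges are inner. This is why \<open>lov\<close> stops before the upper turn of the leg:
  the required end edge does not exist there, except at the end of a path.\<close>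

lemma lo_edge_arc:
  assumes "lov m x" shows "lo_edge m x \<in> arcs (dag K)"
proof -
  have m: "m < r" using assms by (simp add: lov_def)
  have lo: "turn m \<le> lo m x" "lo m x \<le> turn (Suc m)" using lo_bounds[OF assms] by auto
  have b: "1 \<le> lo m x" "lo m x \<le> Suc N" using lo turn_pos[of m] turn_le_N[of "Suc m"] m by linarith+
  have vb: "1 \<le> vx (lo m x)" "vx (lo m x) \<le> n" using vx_bounds b by auto
  have ev: "vx (lo m x) = lo m x"
  proof (cases "lo m x \<le> N")
    case False
    then have "is_path K"
      using assms b turn_le_N[of "Suc m"] turn_less_N[of m] m unfolding lov_def lo_def by auto
    then show ?thesis by (simp add: vx_def)
  qed simp
  have far: "i \<noteq> lo m x" if "inleg m' i" "turn m \<le> x" "m' \<noteq> m" for m' i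
  proof
    assume i: "i = lo m x"
    then have "inleg m i \<or> is_path K \<and> Suc m = r \<and> i = turn (Suc m)"
      using assms that unfolding lov_def lo_def inleg_def by auto
    then show False using that inleg_unique[of m i m'] inleg_bounds[of m' i] turn_r by auto
  qed
  show ?thesis
  proof (cases "even m")
    case True
    show ?thesis
    proof (cases "x < turn m")
      case x: True
      then have "lo m x = turn m" by (simp add: lo_def)
      then show ?thesis using True x vb parallel_not_at_start ev m by (auto simp: lo_edge_def source_edge_iff)
    next
      case False
      then show ?thesis using True vb far ev by (auto simp: lo_edge_def source_edge_iff)
    qed
  next
    case odd: False
    show ?thesis
    proof (cases "x < turn m")
      case x: True
      then have "lo m x = turn m" by (simp add: lo_def)
      then show ?thesis using odd x vb parallel_not_at_start ev m by (auto simp: lo_edge_def sink_edge_iff)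
    next
      case False
      then show ?thesis using odd vb far ev by (auto simp: lo_edge_def sink_edge_iff)
    qed
  qed
qed

lemma hi_edge_arc:
  assumes "hiv m y" shows "hi_edge m y \<in> arcs (dag K)"
proof -
  have m: "m < r" using assms by (simp add: hiv_def)
  have hi: "turn m \<le> hi m y" "hi m y \<le> turn (Suc m)" using hi_bounds[OF assms] by auto
  have b: "1 \<le> hi m y" "hi m y \<le> Suc N" using hi turn_pos[of m] turn_le_N[of "Suc m"] m by linarith+
  have vb: "1 \<le> vx (hi m y)" "vx (hi m y) \<le> n" using vx_bounds b by auto
  have far: "vx (Suc i) \<noteq> vx (hi m y)" if "inleg m' i" "y \<le> turn (Suc m)" "m' \<noteq> m" for m' i
  proof
    assume eq: "vx (Suc i) = vx (hi m y)"
    have i: "1 \<le> i" "i \<le> N" using inleg_bounds that by auto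
    have "hi m y = y" using that by (simp add: hi_def)
    moreover have "turn m < y \<or> is_path K \<and> y = 1" using assms by (auto simp: hiv_def)
    ultimately have "Suc i = y"
      using eq i b vx_eq[of "Suc i" "hi m y"] turn_pos[of m] by auto
    then have "inleg m i"
      using that \<open>turn m < y \<or> is_path K \<and> y = 1\<close> i m by (auto simp: inleg_def)
    then show False using that inleg_unique by blast
  qed
  show ?thesis
  proof (cases "even m")
    case True
    show ?thesis
    proof (cases "turn (Suc m) < y")
      case y: True
      then have "hi m y = turn (Suc m)" by (simp add: hi_def)
      then show ?thesis using True y vb parallel_not_at_end m by (auto simp: hi_edge_def sink_edge_iff)
    next
      case False
      then show ?thesis using True vb far by (auto simp: hi_edge_def sink_edge_iff)
    qed
  next
    case odd: False
    show ?thesis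
    proof (cases "turn (Suc m) < y")
      case y: True
      then have "hi m y = turn (Suc m)" by (simp add: hi_def)
      then show ?thesis using odd y vb parallel_not_at_end m by (auto simp: hi_edge_def source_edge_iff)
    next
      case False
      then show ?thesis using odd vb far by (auto simp: hi_edge_def source_edge_iff)
    qed
  qed
qed

section \<open>Routes as pairs of positions on a leg\<close>

abbreviation "cas \<equiv> pre_digraph.cas (dag K)"

lemmas cas_simps [simp] = pre_digraph.cas.simps

lemma dag_simps [simp]: "tail (dag K) = edge_tail K" "head (dag K) = edge_head K"
  "verts (dag K) = {Source, Sink} \<union> inner_vertices K"
  by (simp_all add: dag_def)

lemma inleg_le: "inleg m i \<Longrightarrow> vx i = i"
  using inleg_bounds by simp

lemma cas_up:
  assumes "even m" "m < r" "turn m \<le> a" "a \<le> b" "b \<le> turn (Suc m)"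
  shows "cas (Inner (vx a)) (map InnerEdge [a..<b] @ es) w = cas (Inner (vx b)) es w"
  using assms(4,3,5)
proof (induction a rule: inc_induct)
  case (step a)
  then have "inleg m a" using assms(2) by (simp add: inleg_def)
  then show ?case
    using step assms(1) inner_arc[of m a] inleg_le[of m a]
    by (simp add: upt_conv_Cons del: edge_head.simps edge_tail.simps)
qed simp

lemma cas_down:
  assumes "odd m" "m < r" "turn m \<le> a" "a \<le> b" "b \<le> turn (Suc m)"
  shows "cas (Inner (vx b)) (map InnerEdge (rev [a..<b]) @ es) w = cas (Inner (vx a)) es w"
  using assms(4,5)
proof (induction b rule: dec_induct)
  case (step b)
  then have "inleg m b" using assms(2,3) by (simp add: inleg_def)
  then show ?case
    using step assms(1) inner_arc[of m b] inleg_le[of m b]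
    by (simp del: edge_head.simps edge_tail.simps)
qed simp

lemma rt_route:
  assumes v: "valid m x y"
  shows "rt m x y \<in> routes K"
proof -
  have lov: "lov m x" and hiv: "hiv m y" using v by (auto simp: valid_def)
  have m: "m < r" using lov by (simp add: lov_def)
  have b: "turn m \<le> lo m x" "lo m x \<le> hi m y" "hi m y \<le> turn (Suc m)"
    using lo_bounds[OF lov] hi_bounds[OF hiv] lo_le_hi[OF v] by auto
  have "InnerEdge i \<in> arcs (dag K)" if "i \<in> {lo m x..<hi m y}" for i
    using that b m inner_edge_iff by (force simp: inleg_def)
  then have arcs: "set (rt m x y) \<subseteq> arcs (dag K)"
    using lo_edge_arc[OF lov] hi_edge_arc[OF hiv] by (auto simp: rt_def)
  have "cas Source (rt m x y) Sink"
    using cas_up[of m "lo m x" "hi m y"] cas_down[of m "lo m x" "hi m y"] b m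
    by (simp add: rt_def lo_edge_def hi_edge_def)
  then show ?thesis
    using arcs by (simp add: routes_def pre_digraph.awalk_def)
qed

text \<open>The shape of a route after its source edge: it stays on one leg and keeps its direction.
  Which labels can occur at the ends is settled only in \<open>route_form\<close>.\<close>

inductive walk_to_sink :: "nat \<Rightarrow> edge list \<Rightarrow> bool" where
  short: "walk_to_sink v [SinkEdge v l]"
| up: "walk_to_sink a (map InnerEdge [a..<b] @ [SinkEdge (vx b) l])"
    if "m < r" "turn m \<le> a" "a < b" "b \<le> turn (Suc m)" "even m"
| down: "walk_to_sink (vx b) (map InnerEdge (rev [a..<b]) @ [SinkEdge (vx a) l])"
    if "m < r" "turn m \<le> a" "a < b" "b \<le> turn (Suc m)" "odd m"

text \<open>Induction along the walk: behind an inner edge the walk has to go on along the same leg,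
  as the next leg points the opposite way at the turning vertex.\<close>

lemma walk_to_sinkI:
  assumes "set es \<subseteq> arcs (dag K)" "cas (Inner v) es Sink"
  shows "walk_to_sink v es"
  using assms
proof (induction es arbitrary: v)
  case (Cons e es)
  show ?case
  proof (cases e)
    case (SourceEdge w l)
    then show ?thesis using Cons.prems by simp
  next
    case (SinkEdge w l)
    have "es = []"
    proof (rule ccontr)
      assume "es \<noteq> []"
      then obtain e' es' where "es = e' # es'" by (cases es) auto
      then have "edge_tail K e' = Sink" using Cons.prems SinkEdge by simp
      then show False by (cases e') auto
    qed
    then show ?thesis using SinkEdge Cons.prems by (auto intro: short)
  next
    case (InnerEdge i)
    obtain m where m: "inleg m i" using Cons.prems InnerEdge inner_edge_iff by auto
    have i: "1 \<le> i" "i \<le> N" "m < r" "turn m \<le> i" "i < turn (Suc m)"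
      using inleg_bounds m by (auto simp: inleg_def)
    have es: "set es \<subseteq> arcs (dag K)" using Cons.prems by simp
    have e: "edge_tail K (InnerEdge i) = Inner v" "cas (edge_head K (InnerEdge i)) es Sink"
      using Cons.prems(2) by (simp_all add: InnerEdge del: edge_head.simps edge_tail.simps)
    show ?thesis
    proof (cases "even m")
      case True
      have v: "v = i" and c: "cas (Inner (vx (Suc i))) es Sink"
        using e True unfolding inner_arc[OF m] by simp_all
      have no_wrap: "vx (Suc i) = Suc i"
      proof (cases "Suc i = turn (Suc m)")
        case False
        then have "Suc i \<le> N" using i turn_le_N[of "Suc m"] by linarith
        then show ?thesis by simp
      qed (use vx_turn_even[OF i(3) True] in simp)
      from Cons.IH[OF es c] show ?thesis
      proof cases
        case (short l)
        then have "e # es = map InnerEdge [i..<Suc i] @ [SinkEdge (vx (Suc i)) l]"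
          by (simp add: InnerEdge)
        then show ?thesis using i True v up[of m i "Suc i" l] by simp
      next
        case (up m' b l)
        note 2 = up[unfolded no_wrap]
        then have m': "inleg m' (Suc i)" by (simp add: inleg_def)
        \<comment> \<open>At \<open>Suc i = turn (Suc m)\<close> the continuation would lie on leg
          \<open>Suc m\<close>, which runs downwards.\<close>
        have "m' = m"
        proof (cases "Suc i < turn (Suc m)")
          case True
          then show ?thesis using m' i inleg_unique[of m "Suc i" m'] by (simp add: inleg_def)
        next
          case False
          then have "Suc i = turn (Suc m)" using i by linarith
          then have "Suc m = m'" using m' i inleg_at_turn[of "Suc m" m'] by simp
          then show ?thesis using True 2 by auto
        qed
        moreover have "e # es = map InnerEdge [i..<b] @ [SinkEdge (vx b) l]"
          using 2 by (simp add: InnerEdge upt_conv_Cons)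
        ultimately show ?thesis using i 2 v walk_to_sink.up[of m i b l] by (simp only: Suc_lessD)
      next
        case (down m' a b l)
        note 3 = down
        \<comment> \<open>A downward continuation from \<open>Suc i\<close> would begin with the
          edge \<open>i\<close> itself, which belongs to the upward leg \<open>m\<close>.\<close>
        have "Suc i = vx b" using 3(1) no_wrap by simp
        then have "b = Suc i" using i 3(5) by (cases "b \<le> N") (simp_all add: vx_def split: if_splits)
        then have "inleg m' i" using 3 by (simp add: inleg_def)
        then have "m' = m" using m inleg_unique by blast
        then show ?thesis using True 3 by simp
      qed
    next
      case False
      have v: "v = vx (Suc i)" and c: "cas (Inner i) es Sink"
        using e False unfolding inner_arc[OF m] by simp_all
      from Cons.IH[OF es c] show ?thesis
      proof cases
        case (short l)
        then have "e # es = map InnerEdge (rev [i..<Suc i]) @ [SinkEdge (vx i) l]"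
          using i by (simp add: InnerEdge)
        then show ?thesis using i False v down[of m i "Suc i" l] by simp
      next
        case (up m' b)
        then have "inleg m' i" by (simp add: inleg_def)
        then have "m' = m" using m inleg_unique by blast
        then show ?thesis using False up by simp
      next
        case (down m' a b l)
        note 3 = down
        \<comment> \<open>Otherwise vertex 1 is met as position \<open>Suc N\<close>; then
          \<open>i = 1\<close> lies on leg 0, which runs upwards.\<close>
        have "b = i"
        proof (rule ccontr)
          assume "b \<noteq> i"
          then have "i = 1" using 3 by (auto simp: vx_def split: if_splits)
          then have "m = 0" using m inleg_at_turn[of 0 m] by simp
          then show False using False by simp
        qed
        have "m' = m"
        proof (cases "b < turn (Suc m')")
          case True
          then have "inleg m' i" using 3(3-6) \<open>b = i\<close> by (simp add: inleg_def)
          then show ?thesis using m inleg_unique by blast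
        next
          case f: False
          then have "Suc m' = m" using 3(3,6) \<open>b = i\<close> m inleg_at_turn[of "Suc m'" m] by simp
          then show ?thesis using False 3(7) by auto
        qed
        moreover have "e # es = map InnerEdge (rev [a..<Suc b]) @ [SinkEdge (vx a) l]"
          using 3(2,5) \<open>b = i\<close> by (simp add: InnerEdge)
        ultimately show ?thesis using i 3(3-7) v \<open>b = i\<close> walk_to_sink.down[of m a "Suc b" l] by simp
      qed
    qed
  qed
qed simp

lemma rt_up:
  assumes "even m" "lo m x = a" "hi m y = b" "l = (if x < turn m then 2 else 1)"
    "l' = (if turn (Suc m) < y then 2 else 1)"
  shows "rt m x y = SourceEdge (vx a) l # map InnerEdge [a..<b] @ [SinkEdge (vx b) l']"
  using assms by (simp add: rt_def lo_edge_def hi_edge_def)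

lemma rt_down:
  assumes "odd m" "lo m x = a" "hi m y = b" "l = (if turn (Suc m) < y then 1 else 2)"
    "l' = (if x < turn m then 1 else 2)"
  shows "rt m x y = SourceEdge (vx b) l # map InnerEdge (rev [a..<b]) @ [SinkEdge (vx a) l']"
  using assms by (simp add: rt_def lo_edge_def hi_edge_def)

lemma inleg_last: "inleg (r - 1) N"
  using r_pos turn_r turn_less_N[of "r - 1"] by (simp add: inleg_def)

text \<open>Routes with two edges. Inside a leg they are short exceptional; at an end of a path one
  edge may also belong to the long exceptional route; at a turning vertex there are none, since both
  incoming or both outgoing edges are inner.\<close>

lemma short_form:
  assumes so: "SourceEdge v l \<in> arcs (dag K)" and si: "SinkEdge v l' \<in> arcs (dag K)"
  shows "\<exists>m x y. valid m x y \<and> [SourceEdge v l, SinkEdge v l'] = rt m x y"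
proof -
  have v: "1 \<le> v" "v \<le> n" and l: "l = 1 \<or> l = 2" and l': "l' = 1 \<or> l' = 2"
    using so si by (auto simp: source_edge_iff sink_edge_iff)
  have so': "(if even m then vx (Suc i) else i) = v \<Longrightarrow> (if even m then 2 else 1) \<noteq> l"
    and si': "(if even m then i else vx (Suc i)) = v \<Longrightarrow> (if even m then 2 else 1) \<noteq> l'"
    if "inleg m i" for m i
    using so si that unfolding source_edge_iff sink_edge_iff by blast+
  show ?thesis
  proof (cases "v \<le> N")
    case False
    then have p: "is_path K" and vN: "v = Suc N" using v n_eq by (auto split: if_splits)
    let ?m = "r - 1"
    have m: "?m < r" "Suc ?m = r" using r_pos by auto
    have t: "turn ?m < v" "turn (Suc ?m) = v" using turn_less_N[OF m(1)] vN m turn_r by auto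
    have [simp]: "vx v = v" and wN: "vx (Suc N) = v" using p vN by (simp_all add: vx_def)
    show ?thesis
    proof (cases "even ?m")
      case True
      then have l1: "l = 1" using so'[OF inleg_last] l wN by simp
      let ?y = "if l' = 2 then Suc v else v"
      have "valid ?m v ?y" using p m t by (auto simp: valid_def lov_def hiv_def)
      moreover have "rt ?m v ?y = SourceEdge (vx v) l # map InnerEdge [v..<v] @ [SinkEdge (vx v) l']"
        using True t l1 l' by (intro rt_up) (auto simp: lo_def hi_def)
      moreover from this have "[SourceEdge v l, SinkEdge v l'] = rt ?m v ?y" by simp
      ultimately show ?thesis by blast
    next
      case False
      then have l1: "l' = 2" using si'[OF inleg_last] l' wN by simp
      let ?y = "if l = 1 then Suc v else v"
      have "valid ?m v ?y" using p m t by (auto simp: valid_def lov_def hiv_def)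
      moreover have "rt ?m v ?y = SourceEdge (vx v) l # map InnerEdge (rev [v..<v]) @ [SinkEdge (vx v) l']"
        using False t l1 l by (intro rt_down) (auto simp: lo_def hi_def)
      moreover from this have "[SourceEdge v l, SinkEdge v l'] = rt ?m v ?y" by simp
      ultimately show ?thesis by blast
    qed
  next
    case vN: True
    obtain m where m: "inleg m v" using inleg_ex v vN by blast
    then have mr: "m < r" "turn m \<le> v" "v < turn (Suc m)" by (auto simp: inleg_def)
    have [simp]: "vx v = v" using vN by simp
    show ?thesis
    proof (cases "turn m < v")
      case True
      then have m1: "inleg m (v - 1)" "Suc (v - 1) = v" using m by (auto simp: inleg_def)
      have "valid m v v" using True mr by (auto simp: valid_def lov_def hiv_def)
      moreover have "[SourceEdge v l, SinkEdge v l'] = rt m v v"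
        using so'[OF m] so'[OF m1(1)] si'[OF m] si'[OF m1(1)] m1(2) mr l l'
        by (cases "even m") (auto simp: rt_def lo_def hi_def lo_edge_def hi_edge_def)
      ultimately show ?thesis by blast
    next
      case False
      then have vt: "v = turn m" using mr by simp
      show ?thesis
      proof (cases "m = 0")
        case True
        show ?thesis
        proof (cases "is_path K")
          case p: True
          have "l' = 1" using si'[OF m] True l' by auto
          let ?x = "if l = 2 then 0 else 1"
          have "valid 0 ?x 1" using p mr True vt by (auto simp: valid_def lov_def hiv_def)
          moreover have "[SourceEdge v l, SinkEdge v l'] = rt 0 ?x 1"
            using \<open>l' = 1\<close> mr l True vt \<open>vx v = v\<close>
            by (auto simp: rt_def lo_def hi_def lo_edge_def hi_edge_def)
          ultimately show ?thesis by blast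
        next
          case False
          then have "odd (r - 1)" using cycle_even r_pos by auto
          then have "l' \<noteq> 1" using si'[OF inleg_last] False vt True by (auto simp: vx_def)
          then show ?thesis using si'[OF m] True l' by auto
        qed
      next
        case False
        then obtain k where k: "m = Suc k" by (cases m) auto
        have "inleg k (v - 1)" "Suc (v - 1) = v"
          using vt k mr turn_less[of k m] v by (auto simp: inleg_def)
        then show ?thesis
          using so'[OF m] so'[of k "v - 1"] si'[OF m] si'[of k "v - 1"] l l' k
          by (cases "even m") auto
      qed
    qed
  qed
qed

text \<open>An end edge carrying the label of the leg must sit at the turn, because elsewhere an
  inner edge already has this label at the vertex. So its label decides between the real and the
  virtual position.\<close>

lemma route_form:
  assumes "R \<in> routes K"
  obtains m x y where "valid m x y" "R = rt m x y"
proof -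
  have R: "set R \<subseteq> arcs (dag K)" "cas Source R Sink"
    using assms by (auto simp: routes_def pre_digraph.awalk_def)
  then obtain e es where e: "R = e # es" by (cases R) auto
  then have "edge_tail K e = Source" using R by simp
  then obtain v l where vl: "e = SourceEdge v l" by (cases e) auto
  have so: "SourceEdge v l \<in> arcs (dag K)" and es: "set es \<subseteq> arcs (dag K)" "cas (Inner v) es Sink"
    using R e vl by auto
  have l: "l = 1 \<or> l = 2" using so by (auto simp: source_edge_iff)
  have so': "(if even m then vx (Suc i) else i) = v \<Longrightarrow> (if even m then 2 else 1) \<noteq> l"
    if "inleg m i" for m i
    using so that unfolding source_edge_iff by blast
  from walk_to_sinkI[OF es] have "\<exists>m x y. valid m x y \<and> R = rt m x y"
  proof cases
    case (short l')
    then show ?thesis using short_form[OF so] es e vl by auto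
  next
    case (up m b l')
    define a where "a = v"
    note 2 = up[folded a_def] a_def
    have si: "SinkEdge (vx b) l' \<in> arcs (dag K)" using es 2 by simp
    then have l': "l' = 1 \<or> l' = 2" by (auto simp: sink_edge_iff)
    have aN: "vx a = a" using 2 by (intro inleg_le[of m]) (simp add: inleg_def)
    have si': "(if even m then i else vx (Suc i)) = vx b \<Longrightarrow> (if even m then 2 else 1) \<noteq> l'"
      if "inleg m i" for m i
      using si that unfolding sink_edge_iff by blast
    have a: "a = turn m" if "l = 2"
    proof (rule ccontr)
      assume "a \<noteq> turn m"
      then have "inleg m (a - 1)" "Suc (a - 1) = a" using 2 by (auto simp: inleg_def)
      then show False using so'[of m "a - 1"] 2 that aN by simp
    qed
    have b: "b = turn (Suc m)" if "l' = 2"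
    proof (rule ccontr)
      assume "b \<noteq> turn (Suc m)"
      then have "inleg m b" using 2 by (auto simp: inleg_def)
      then show False using si'[of m b] 2 that inleg_le[of m b] by simp
    qed
    let ?x = "if l = 2 then turn m - 1 else a" and ?y = "if l' = 2 then Suc (turn (Suc m)) else b"
    have "valid m ?x ?y" using 2 a b by (auto simp: valid_def lov_def hiv_def)
    moreover have "rt m ?x ?y = SourceEdge (vx a) l # map InnerEdge [a..<b] @ [SinkEdge (vx b) l']"
    proof (rule rt_up)
      show "lo m ?x = a" "hi m ?y = b" using 2 a b by (simp_all add: lo_def hi_def)
      show "l = (if ?x < turn m then 2 else 1)" using l 2 turn_pos[of m] by auto
      show "l' = (if turn (Suc m) < ?y then 2 else 1)" using l' 2 by auto
    qed (rule 2)
    moreover from this have "R = rt m ?x ?y" using e vl 2 aN by simp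
    ultimately show ?thesis by blast
  next
    case (down m a b l')
    note 3 = down
    have si: "SinkEdge (vx a) l' \<in> arcs (dag K)" using es 3 by simp
    then have l': "l' = 1 \<or> l' = 2" by (auto simp: sink_edge_iff)
    have aN: "vx a = a" using 3 by (intro inleg_le[of m]) (simp add: inleg_def)
    have si': "(if even m then i else vx (Suc i)) = vx a \<Longrightarrow> (if even m then 2 else 1) \<noteq> l'"
      if "inleg m i" for m i
      using si that unfolding sink_edge_iff by blast
    have a: "a = turn m" if "l' = 1"
    proof (rule ccontr)
      assume "a \<noteq> turn m"
      then have "inleg m (a - 1)" "Suc (a - 1) = a" using 3 by (auto simp: inleg_def)
      then show False using si'[of m "a - 1"] 3 that aN by simp
    qed
    have b: "b = turn (Suc m)" if "l = 1"
    proof (rule ccontr)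
      assume "b \<noteq> turn (Suc m)"
      then have "inleg m b" using 3 by (auto simp: inleg_def)
      then show False using so'[of m b] 3 that inleg_le[of m b] by simp
    qed
    let ?x = "if l' = 1 then turn m - 1 else a" and ?y = "if l = 1 then Suc (turn (Suc m)) else b"
    have "valid m ?x ?y" using 3 a b by (auto simp: valid_def lov_def hiv_def)
    moreover have "rt m ?x ?y = SourceEdge (vx b) l # map InnerEdge (rev [a..<b]) @ [SinkEdge (vx a) l']"
    proof (rule rt_down)
      show "lo m ?x = a" "hi m ?y = b" using 3 a b by (simp_all add: lo_def hi_def)
      show "l' = (if ?x < turn m then 1 else 2)" using l' 3 turn_pos[of m] by auto
      show "l = (if turn (Suc m) < ?y then 1 else 2)" using l 3 by auto
    qed (rule 3)
    moreover from this have "R = rt m ?x ?y" using e vl 3 by simp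
    ultimately show ?thesis by blast
  qed
  then show ?thesis using that by blast
qed

section \<open>Exceptional routes\<close>

definition lab :: "nat \<Rightarrow> nat" where "lab m = (if even m then 2 else 1)"

definition star_lo :: "nat \<Rightarrow> nat \<Rightarrow> bool" where "star_lo m x \<longleftrightarrow> x < turn m"
definition star_hi :: "nat \<Rightarrow> nat \<Rightarrow> bool" where "star_hi m y \<longleftrightarrow> turn (Suc m) < y"

lemma label_lo_edge: "label K (lo_edge m x) = (if star_lo m x then lab m else 3 - lab m)"
  by (simp add: lo_edge_def lab_def star_lo_def)

lemma label_hi_edge: "label K (hi_edge m y) = (if star_hi m y then lab m else 3 - lab m)"
  by (simp add: hi_edge_def lab_def star_hi_def)

lemma label_inner: "inleg m i \<Longrightarrow> label K (InnerEdge i) = lab m"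
  using inner_arc(1) by (simp add: lab_def)

lemma lab_neq: "3 - lab m \<noteq> lab m" "lab m \<noteq> 3 - lab m"
  by (simp_all add: lab_def)

lemma validD:
  assumes "valid m x y"
  shows "m < r" "lov m x" "hiv m y" "x \<le> y" "turn m < turn (Suc m)" "lo m x \<le> hi m y"
    "turn m \<le> lo m x" "hi m y \<le> turn (Suc m)"
  using assms turn_Suc[of m] lo_le_hi lo_bounds[of m x] hi_bounds[of m y]
  by (auto simp: valid_def lov_def)

lemma inleg_between: "valid m x y \<Longrightarrow> lo m x \<le> i \<Longrightarrow> i < hi m y \<Longrightarrow> inleg m i"
  using validD[of m x y] by (auto simp: inleg_def)

lemma set_rt: "set (rt m x y) = {lo_edge m x, hi_edge m y} \<union> InnerEdge ` {lo m x..<hi m y}"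
  by (auto simp: rt_def)

text \<open>A route without inner edges is short exceptional, or it sits at an end of a path with
  exactly one of its two edges on the long exceptional route.\<close>

lemma lo_eq_hi:
  assumes "valid m x y" "lo m x = hi m y"
  shows "x = y \<or> star_lo m x \<and> \<not> star_hi m y \<or> \<not> star_lo m x \<and> star_hi m y"
  using assms validD[OF assms(1)] by (auto simp: lo_def hi_def star_lo_def star_hi_def max_def min_def split: if_splits)

lemma short_pos:
  assumes "valid m x x" shows "lo m x = x" "hi m x = x" "\<not> star_lo m x" "\<not> star_hi m x"
  using assms validD[OF assms] by (auto simp: lov_def hiv_def lo_def hi_def star_lo_def star_hi_def)

text \<open>The end edges must both have the label of the leg or both the other one; in the latter
  case an inner edge would break constancy, so there is none.\<close>

lemma exceptional_rt:
  assumes v: "valid m x y"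
  shows "exceptional K (rt m x y) \<longleftrightarrow> x = y \<or> star_lo m x \<and> star_hi m y"
proof -
  have "exceptional K (rt m x y) \<longleftrightarrow> (\<exists>j. \<forall>e\<in>set (rt m x y). label K e = j)"
    using rt_route[OF v] by (simp add: exceptional_def)
  also have "\<dots> \<longleftrightarrow> (\<exists>j. label K (lo_edge m x) = j \<and> label K (hi_edge m y) = j \<and>
      (\<forall>i\<in>{lo m x..<hi m y}. lab m = j))"
  proof -
    have "label K (InnerEdge i) = lab m" if "i \<in> {lo m x..<hi m y}" for i
      using label_inner inleg_between[OF v] that by simp
    then show ?thesis unfolding set_rt by (auto simp del: label.simps)
  qed
  also have "\<dots> \<longleftrightarrow> star_lo m x = star_hi m y \<and> (lo m x < hi m y \<longrightarrow> star_lo m x)"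
    using lab_neq[of m] by (auto simp: label_lo_edge label_hi_edge)
  also have "\<dots> \<longleftrightarrow> x = y \<or> star_lo m x \<and> star_hi m y"
  proof (cases "x = y")
    case True
    then show ?thesis using short_pos v by auto
  next
    case False
    then show ?thesis using lo_eq_hi[OF v] validD[OF v] by auto
  qed
  finally show ?thesis .
qed

lemma inner_vertex: "inleg m i \<Longrightarrow> Inner i \<in> inner_vertices K \<and> Inner (vx (Suc i)) \<in> inner_vertices K"
  using inleg_bounds[of m i] vx_bounds[of i] vx_bounds[of "Suc i"] by (auto simp: inner_vertices_def)

lemma inner_graph_arcs: "arcs (inner_graph K) = {InnerEdge i | i m. inleg m i}"
proof -
  have "e \<in> arcs (inner_graph K) \<longleftrightarrow> (\<exists>i m. e = InnerEdge i \<and> inleg m i)" for e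
  proof (cases e)
    case (InnerEdge i)
    then show ?thesis
      using inner_edge_iff[of i] inner_arc inner_vertex
      by (auto simp: inner_graph_def induce_subgraph_def simp del: edge_head.simps edge_tail.simps)
  qed (auto simp: inner_graph_def induce_subgraph_def inner_vertices_def)
  then show ?thesis by blast
qed

lemma inner_graph_simps [simp]: "tail (inner_graph K) = edge_tail K" "head (inner_graph K) = edge_head K"
  "verts (inner_graph K) = inner_vertices K"
  by (simp_all add: inner_graph_def induce_subgraph_def)

lemma inner_graph_cas: "pre_digraph.cas (inner_graph K) u p v \<longleftrightarrow> cas u p v"
  by (induction p arbitrary: u) simp_all

definition leg_edges :: "nat \<Rightarrow> edge list" where
  "leg_edges m = map InnerEdge (if even m then [turn m..<turn (Suc m)] else rev [turn m..<turn (Suc m)])"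

text \<open>Maximality holds because the leg meets its neighbours tail to tail at its first vertex
  and head to head at its last, so no inner edge precedes or follows it.\<close>

lemma leg_leg_edges:
  assumes m: "m < r" shows "leg K (lab m) (leg_edges m)"
proof -
  let ?P = "turn m" and ?Q = "turn (Suc m)"
  have PQ: "?P < ?Q" using turn_Suc m by simp
  have all: "inleg m i" if "?P \<le> i" "i < ?Q" for i using that m by (simp add: inleg_def)
  then have ex: "\<exists>m. inleg m i" if "?P \<le> i" "i < ?Q" for i using that by blast
  let ?u = "Inner (if even m then ?P else vx ?Q)" and ?v = "Inner (if even m then vx ?Q else ?P)"
  have no_start: "i = ?P \<Longrightarrow> even m \<longleftrightarrow> even m'" "vx (Suc i) = vx ?Q \<Longrightarrow> even m \<longleftrightarrow> even m'"
    if i: "inleg m' i" for m' i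
  proof -
    show "even m \<longleftrightarrow> even m'" if "i = ?P"
      using i that inleg_at_turn[of m m'] m by simp
    show "even m \<longleftrightarrow> even m'" if "vx (Suc i) = vx ?Q"
    proof -
      have "1 \<le> i" "i \<le> N" using inleg_bounds i by auto
      then have "Suc i = ?Q"
        using that vx_eq[of "Suc i" ?Q] turn_pos[of m] PQ turn_le_N[of "Suc m"] m by auto
      then show ?thesis using i inleg_below_turn[of "Suc m" m' i] m by simp
    qed
  qed
  have "in_arcs (inner_graph K) ?u = {}" "out_arcs (inner_graph K) ?v = {}"
    using parallel_not_at_start[OF m] parallel_not_at_end[OF m] no_start inner_arc
    by (auto simp: in_arcs_def out_arcs_def inner_graph_arcs simp del: edge_head.simps edge_tail.simps
        split: if_splits; metis)+
  moreover have "pre_digraph.awalk (inner_graph K) ?u (leg_edges m) ?v"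
    unfolding pre_digraph.awalk_def inner_graph_cas
    using cas_up[of m ?P ?Q "[]"] cas_down[of m ?P ?Q "[]"] m PQ all inner_vertex[OF all] 
      inner_vertex[OF all[of "?Q - 1"]] inner_vertex[OF all[of "?P"]]
    by (auto simp: leg_edges_def inner_graph_arcs ex)
  ultimately have "inner_route K (leg_edges m)"
    unfolding inner_route_def by blast
  then show ?thesis
    using label_inner all by (auto simp: leg_def leg_edges_def simp del: label.simps)
qed

text \<open>An inner route without edges would be an isolated vertex of the inner graph, but every
  inner vertex lies on an inner edge. Hence a short route contains no leg.\<close>

lemma leg_contains_inner:
  assumes "leg K j p" shows "\<exists>i. InnerEdge i \<in> set p"
proof -
  obtain u v where w: "pre_digraph.awalk (inner_graph K) u p v"
    and u: "in_arcs (inner_graph K) u = {}" and v: "out_arcs (inner_graph K) v = {}"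
    using assms by (auto simp: leg_def inner_route_def)
  have "p \<noteq> []"
  proof
    assume "p = []"
    then have "u = v" "u \<in> inner_vertices K" using w by (auto simp: pre_digraph.awalk_def)
    then obtain w where w: "u = Inner w" "1 \<le> w" "w \<le> n" by (auto simp: inner_vertices_def)
    have "\<exists>m i. inleg m i \<and> (w = i \<or> w = vx (Suc i))"
    proof (cases "w \<le> N")
      case True
      then show ?thesis using inleg_ex w by metis
    next
      case False
      then have "w = vx (Suc N)" using w n_eq by (auto simp: vx_def split: if_splits)
      then show ?thesis using inleg_last by blast
    qed
    then obtain m i where i: "inleg m i" "w = i \<or> w = vx (Suc i)" by blast
    then have "InnerEdge i \<in> in_arcs (inner_graph K) u \<or> InnerEdge i \<in> out_arcs (inner_graph K) u"
      using inner_arc[OF i(1)] w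
      by (auto simp: in_arcs_def out_arcs_def inner_graph_arcs simp del: edge_head.simps edge_tail.simps)
    then show False unfolding u v[folded \<open>u = v\<close>] by blast
  qed
  then obtain e where "e \<in> set p" by (cases p) auto
  moreover have "set p \<subseteq> arcs (inner_graph K)" using w by (simp add: pre_digraph.awalk_def)
  ultimately show ?thesis by (auto simp: inner_graph_arcs)
qed

lemma long_exceptional_rt:
  assumes v: "valid m x y"
  shows "long_exceptional K (rt m x y) \<longleftrightarrow> star_lo m x \<and> star_hi m y"
proof
  assume l: "long_exceptional K (rt m x y)"
  then obtain j p where p: "leg K j p" "set p \<subseteq> set (rt m x y)"
    by (auto simp: long_exceptional_def)
  then obtain i where "InnerEdge i \<in> set (rt m x y)" using leg_contains_inner by blast
  then have "lo m x < hi m y" by (auto simp: set_rt lo_edge_def hi_edge_def split: if_splits)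
  then have "x \<noteq> y" using short_pos v by auto
  then show "star_lo m x \<and> star_hi m y"
    using l exceptional_rt[OF v] by (simp add: long_exceptional_def)
next
  assume *: "star_lo m x \<and> star_hi m y"
  then have "lo m x = turn m" "hi m y = turn (Suc m)"
    by (simp_all add: star_lo_def star_hi_def lo_def hi_def)
  then have "set (leg_edges m) \<subseteq> set (rt m x y)" by (auto simp: set_rt leg_edges_def)
  then show "long_exceptional K (rt m x y)"
    using exceptional_rt[OF v] * leg_leg_edges validD(1)[OF v] by (auto simp: long_exceptional_def)
qed

lemma short_exceptional_rt:
  assumes v: "valid m x y"
  shows "short_exceptional K (rt m x y) \<longleftrightarrow> x = y"
  using exceptional_rt[OF v] long_exceptional_rt[OF v] short_pos v
  by (auto simp: short_exceptional_def)

section \<open>The g-vectors and conflicts\<close>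

definition step :: "nat \<Rightarrow> nat \<Rightarrow> nat \<Rightarrow> edge \<Rightarrow> edge \<Rightarrow> bool" where
  "step m x y = interval_step (lo_edge m x) (lo m x) (hi m y) (hi_edge m y)"

lemma adjacent_rt:
  assumes "valid m x y"
  shows "adjacent (rt m x y) e f \<longleftrightarrow> (if even m then step m x y e f else step m x y f e)"
proof (cases "even m")
  case True
  then show ?thesis
    using adjacent_interval[OF validD(6)[OF assms]] by (simp add: rt_def step_def)
next
  case False
  then have "rt m x y = rev (lo_edge m x # map InnerEdge [lo m x..<hi m y] @ [hi_edge m y])"
    by (simp add: rt_def rev_map)
  then show ?thesis
    unfolding step_def adjacent_interval[OF validD(6)[OF assms], symmetric]
    using False adjacent_rev by metis
qed

lemma cas_append: "cas u (p @ q) w \<longleftrightarrow> (\<exists>v. cas u p v \<and> cas v q w)"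
  by (induction p arbitrary: u) auto

lemma adjacent_route: "R \<in> routes K \<Longrightarrow> adjacent R e f \<Longrightarrow> edge_head K e = edge_tail K f"
  by (auto simp: routes_def pre_digraph.awalk_def adjacent_def cas_append
      simp del: edge_head.simps edge_tail.simps)

lemma passes_adjacent:
  "passes K R v l l' \<longleftrightarrow> (\<exists>e f. adjacent R e f \<and> edge_head K e = Inner v \<and> label K e = l \<and> label K f = l')"
  by (auto simp: passes_def adjacent_def simp del: edge_head.simps label.simps)

lemma edge_not_inner [simp]: "lo_edge m x \<noteq> InnerEdge i" "hi_edge m y \<noteq> InnerEdge i"
  "InnerEdge i \<noteq> lo_edge m x" "InnerEdge i \<noteq> hi_edge m y"
  by (simp_all add: lo_edge_def hi_edge_def)

lemma lo_neq_hi_edge [simp]: "lo_edge m x \<noteq> hi_edge m y" "hi_edge m y \<noteq> lo_edge m x"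
  by (simp_all add: lo_edge_def hi_edge_def)

text \<open>All inner edges carry the label of the leg, so another label can only come from an end
  edge.\<close>

lemma step_lo:
  assumes v: "valid m x y" and s: "step m x y e f" and l: "label K e \<noteq> lab m"
  shows "e = lo_edge m x \<and> \<not> star_lo m x"
  using s[unfolded step_def] l
proof cases
  case (mid i)
  then show ?thesis using l label_inner[OF inleg_between[OF v]] by auto
next
  case (last i)
  then show ?thesis using l label_inner[OF inleg_between[OF v]] by auto
qed (auto simp: label_lo_edge)

lemma step_hi:
  assumes v: "valid m x y" and s: "step m x y e f" and l: "label K f \<noteq> lab m"
  shows "f = hi_edge m y \<and> \<not> star_hi m y"
  using s[unfolded step_def] l
proof cases
  case (mid i)
  then show ?thesis using l label_inner[OF inleg_between[OF v], of "Suc i"] by auto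
next
  case (first)
  then show ?thesis using l label_inner[OF inleg_between[OF v], of "lo m x"] by auto
qed (auto simp: label_hi_edge)

definition junction :: "nat \<Rightarrow> edge \<Rightarrow> edge \<Rightarrow> vertex" where
  "junction m e f = (if even m then edge_head K e else edge_head K f)"

lemma junction_step:
  assumes v: "valid m x y" and s: "step m x y e f"
  shows "e = lo_edge m x \<Longrightarrow> junction m e f = Inner (vx (lo m x))"
    "f = hi_edge m y \<Longrightarrow> junction m e f = Inner (vx (hi m y))"
proof -
  have adj: "edge_head K f = edge_tail K e" if "odd m"
    using that s adjacent_route[OF rt_route[OF v], of f e] adjacent_rt[OF v, of f e] by simp
  have adj': "edge_head K e = edge_tail K f" if "even m"
    using that s adjacent_route[OF rt_route[OF v], of e f] adjacent_rt[OF v, of e f] by simp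
  show "e = lo_edge m x \<Longrightarrow> junction m e f = Inner (vx (lo m x))"
    using adj by (cases "even m") (simp_all add: junction_def lo_edge_def)
  show "f = hi_edge m y \<Longrightarrow> junction m e f = Inner (vx (hi m y))"
    using adj' by (cases "even m") (simp_all add: junction_def hi_edge_def)
qed

lemma passes_rt:
  assumes v: "valid m x y"
  shows "passes K (rt m x y) w l l' \<longleftrightarrow>
    (\<exists>e f. step m x y e f \<and> junction m e f = Inner w \<and>
       (if even m then label K e = l \<and> label K f = l' else label K f = l \<and> label K e = l'))"
  unfolding passes_adjacent adjacent_rt[OF v] junction_def by auto

lemma first_step: assumes "valid m x y" obtains f where "step m x y (lo_edge m x) f"
  using validD(6)[OF assms] interval_step.none interval_step.first
  unfolding step_def by (metis le_neq_implies_less)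

lemma last_step: assumes "valid m x y" obtains e where "step m x y e (hi_edge m y)"
  using validD(6)[OF assms] interval_step.none interval_step.last[of "lo m x" "hi m y - 1" "hi m y"]
  unfolding step_def by (metis Suc_diff_1 Suc_leI diff_Suc_1 le_neq_implies_less less_Suc_eq_le less_nat_zero_code not_gr_zero)

lemma step_label_first:
  assumes v: "valid m x y" and "x \<noteq> y" "\<not> star_lo m x" "step m x y (lo_edge m x) f"
  shows "label K f = lab m"
  using assms(4)[unfolded step_def]
proof cases
  case none
  then show ?thesis using lo_eq_hi[OF v] assms(2,3) by (simp add: label_hi_edge)
next
  case first
  then show ?thesis using label_inner[OF inleg_between[OF v], of "lo m x"] by simp
qed simp_all

lemma step_label_last:
  assumes v: "valid m x y" and "x \<noteq> y" "\<not> star_hi m y" "step m x y e (hi_edge m y)"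
  shows "label K e = lab m"
  using assms(4)[unfolded step_def]
proof cases
  case none
  then show ?thesis using lo_eq_hi[OF v] assms(2,3) by (simp add: label_lo_edge)
next
  case (last i)
  then show ?thesis using label_inner[OF inleg_between[OF v], of i] by simp
qed simp_all

text \<open>An even leg is entered at its lower end by label 1 and continued with its own label 2;
  an odd leg arrives at the lower end with its own label 1 and leaves by 2. The pair is the same in
  both directions.\<close>

lemma passes_out:
  assumes v: "valid m x y"
  shows "passes K (rt m x y) w 1 2 \<longleftrightarrow> x \<noteq> y \<and> \<not> star_lo m x \<and> w = vx x"
proof
  assume "passes K (rt m x y) w 1 2"
  then obtain e f where s: "step m x y e f" and j: "junction m e f = Inner w"
    and l: "label K e \<noteq> lab m" "label K f = lab m"
    unfolding passes_rt[OF v] by (auto simp: lab_def split: if_splits)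
  have *: "e = lo_edge m x" "\<not> star_lo m x" using step_lo[OF v s l(1)] by auto
  moreover have "x \<noteq> y"
  proof
    assume "x = y"
    then have "f = hi_edge m y" using s * short_pos v by (auto simp: step_def interval_step.simps)
    then show False using l short_pos v \<open>x = y\<close> lab_neq by (auto simp: label_hi_edge)
  qed
  ultimately show "x \<noteq> y \<and> \<not> star_lo m x \<and> w = vx x"
    using junction_step(1)[OF v s] j by (simp add: lo_def star_lo_def)
next
  assume *: "x \<noteq> y \<and> \<not> star_lo m x \<and> w = vx x"
  obtain f where f: "step m x y (lo_edge m x) f" using first_step[OF v] by blast
  then have "label K f = lab m" "label K (lo_edge m x) = 3 - lab m"
    using step_label_first[OF v] * by (simp_all add: label_lo_edge)
  moreover have "junction m (lo_edge m x) f = Inner w"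
    using junction_step(1)[OF v f] * by (simp add: lo_def star_lo_def)
  ultimately show "passes K (rt m x y) w 1 2"
    unfolding passes_rt[OF v] using f by (intro exI[of _ "lo_edge m x"] exI[of _ f]) (simp add: lab_def)
qed

lemma passes_in:
  assumes v: "valid m x y"
  shows "passes K (rt m x y) w 2 1 \<longleftrightarrow> x \<noteq> y \<and> \<not> star_hi m y \<and> w = vx y"
proof
  assume "passes K (rt m x y) w 2 1"
  then obtain e f where s: "step m x y e f" and j: "junction m e f = Inner w"
    and l: "label K f \<noteq> lab m" "label K e = lab m"
    unfolding passes_rt[OF v] by (auto simp: lab_def split: if_splits)
  have *: "f = hi_edge m y" "\<not> star_hi m y" using step_hi[OF v s l(1)] by auto
  moreover have "x \<noteq> y"
  proof
    assume "x = y"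
    then have "e = lo_edge m x" using s * short_pos v by (auto simp: step_def interval_step.simps)
    then show False using l short_pos v \<open>x = y\<close> lab_neq by (auto simp: label_lo_edge)
  qed
  ultimately show "x \<noteq> y \<and> \<not> star_hi m y \<and> w = vx y"
    using junction_step(2)[OF v s] j by (simp add: hi_def star_hi_def)
next
  assume *: "x \<noteq> y \<and> \<not> star_hi m y \<and> w = vx y"
  obtain e where e: "step m x y e (hi_edge m y)" using last_step[OF v] by blast
  then have "label K e = lab m" "label K (hi_edge m y) = 3 - lab m"
    using step_label_last[OF v] * by (simp_all add: label_hi_edge)
  moreover have "junction m e (hi_edge m y) = Inner w"
    using junction_step(2)[OF v e] * by (simp add: hi_def star_hi_def)
  ultimately show "passes K (rt m x y) w 2 1"
    unfolding passes_rt[OF v] using e by (intro exI[of _ e] exI[of _ "hi_edge m y"]) (simp add: lab_def)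
qed

text \<open>The \<open>g\<close>-vector of a route is \<open>e\<^sub>b - e\<^sub>a\<close> for its end nodes \<open>a\<close> and \<open>b\<close>, where node 0 stands
  for the zero vector.\<close>

definition lonode :: "nat \<Rightarrow> nat \<Rightarrow> nat" where "lonode m x = (if star_lo m x then 0 else vx x)"
definition hinode :: "nat \<Rightarrow> nat \<Rightarrow> nat" where "hinode m y = (if star_hi m y then 0 else vx y)"

section \<open>Which nodes belong to which legs\<close>

lemma leg_not_closed:
  assumes "m < r" "\<not> is_path K" shows "turn m \<noteq> 1 \<or> turn (Suc m) \<noteq> Suc N"
  using assms cycle_r turn_inj[of m 0] turn_inj[of "Suc m" r] turn_r by auto

lemma lo_pos: "lov m x \<Longrightarrow> \<not> star_lo m x \<Longrightarrow> 1 \<le> x \<and> x \<le> Suc N \<and> turn m \<le> x \<and> x \<le> turn (Suc m)"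
  using turn_pos[of m] turn_le_N[of "Suc m"] by (auto simp: lov_def star_lo_def)

lemma hi_pos: "hiv m y \<Longrightarrow> \<not> star_hi m y \<Longrightarrow> 1 \<le> y \<and> y \<le> Suc N \<and> turn m \<le> y \<and> y \<le> turn (Suc m)"
  using turn_pos[of m] turn_le_N[of "Suc m"] by (auto simp: hiv_def star_hi_def)

text \<open>The seam identifies \<open>1\<close> and \<open>Suc N\<close>; as a cycle has at least
  two legs, these are never on one leg.\<close>

lemma same_leg_vx:
  assumes "m < r" "turn m \<le> x" "x \<le> turn (Suc m)" "turn m \<le> y" "y \<le> turn (Suc m)"
  shows "vx x = vx y \<longleftrightarrow> x = y"
  using assms leg_not_closed[of m] vx_eq[of x y] turn_pos[of m] turn_le_N[of "Suc m"] by auto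

lemma lonode_eq_hinode:
  assumes v: "valid m x y"
  shows "lonode m x = hinode m y \<longleftrightarrow> exceptional K (rt m x y)"
proof -
  have b: "0 < vx x" if "\<not> star_lo m x" using that lo_pos[of m x] vx_bounds[of x] validD[OF v] by auto
  have b': "0 < vx y" if "\<not> star_hi m y" using that hi_pos[of m y] vx_bounds[of y] validD[OF v] by auto
  show ?thesis
    using b b' same_leg_vx[of m x y] lo_pos[of m x] hi_pos[of m y] validD[OF v] short_pos v
    by (auto simp: exceptional_rt[OF v] lonode_def hinode_def)
qed

text \<open>On a path the last leg is sent to \<open>r\<close>, which is not a leg;
  \<open>nxt m < r\<close>, or validity on leg \<open>nxt m\<close>, rules this out.\<close>

definition nxt :: "nat \<Rightarrow> nat" where "nxt m = (if \<not> is_path K \<and> Suc m = r then 0 else Suc m)"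

lemma nxt_vx: "m < r \<Longrightarrow> nxt m < r \<Longrightarrow> vx (turn (Suc m)) = turn (nxt m)"
  by (auto simp: nxt_def vx_def turn_r dest: turn_less_N split: if_splits)

lemma nxt_neq: "m < r \<Longrightarrow> nxt m \<noteq> m"
  using cycle_r by (auto simp: nxt_def)

lemma nxt_parity: "m < r \<Longrightarrow> nxt m < r \<Longrightarrow> even (nxt m) \<longleftrightarrow> odd m"
proof (cases "\<not> is_path K \<and> Suc m = r")
  case True
  then have "even r" and r: "Suc m = r" using cycle_even by blast+
  then have "even (Suc m)" by (simp only: r)
  then have "odd m" by simp
  then show ?thesis using True by (simp add: nxt_def)
qed (auto simp: nxt_def)

lemma lov_vx: "lov m x \<Longrightarrow> \<not> star_lo m x \<Longrightarrow> vx x = x"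
  using turn_le_N[of "Suc m"] by (auto simp: lov_def star_lo_def vx_def)

lemma lov_cases:
  assumes "lov m x" "\<not> star_lo m x"
  shows "inleg m x \<or> is_path K \<and> Suc m = r \<and> x = Suc N"
  using assms turn_r by (auto simp: lov_def star_lo_def inleg_def)

lemma hiv_cases:
  assumes "hiv m y" "\<not> star_hi m y"
  obtains z where "y = Suc z" "inleg m z" | "is_path K" "m = 0" "y = 1"
  using assms by (cases y) (auto simp: hiv_def star_hi_def inleg_def)

lemma node_pos: "lov m x \<Longrightarrow> lonode m x = 0 \<longleftrightarrow> star_lo m x"
   "hiv m y \<Longrightarrow> hinode m y = 0 \<longleftrightarrow> star_hi m y"
  using lo_pos[of m x] hi_pos[of m y] vx_bounds[of x] vx_bounds[of y]
  by (auto simp: lonode_def hinode_def)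

lemma lonode_le: "lov m x \<Longrightarrow> lonode m x \<le> n"
  using lo_pos[of m x] vx_bounds[of x] by (auto simp: lonode_def)

lemma hinode_le: "hiv m y \<Longrightarrow> hinode m y \<le> n"
  using hi_pos[of m y] vx_bounds[of y] by (auto simp: hinode_def)

text \<open>Apart from the end of a path, the real lower positions of leg \<open>m\<close> run from
  \<open>turn m\<close> up to but excluding \<open>turn (Suc m)\<close>, and these intervals are
  disjoint.\<close>

lemma lonode_inj:
  assumes "lov m x" "lov m' x'" "lonode m x = lonode m' x'" "\<not> star_lo m x"
  shows "m = m' \<and> x = x'"
proof -
  have s: "\<not> star_lo m' x'" using assms node_pos by metis
  then have "x = x'" using assms lov_vx by (simp add: lonode_def)
  then show ?thesis
    using lov_cases[OF assms(1,4)] lov_cases[OF assms(2) s] inleg_unique[of m x m']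
      inleg_bounds[of m x] inleg_bounds[of m' x] by auto
qed

text \<open>The real upper positions fill the intervals open below and closed above, apart from the
  start of a path; in a cycle vertex 1 occurs among them only as \<open>Suc N\<close>.\<close>

lemma hinode_inj:
  assumes "hiv m y" "hiv m' y'" "hinode m y = hinode m' y'" "\<not> star_hi m y"
  shows "m = m' \<and> y = y'"
proof -
  have s: "\<not> star_hi m' y'" using assms node_pos by metis
  have gt: "1 < y" if "hiv m y" "\<not> is_path K" for m y
    using that turn_pos[of m] by (auto simp: hiv_def)
  have "vx y = vx y'" using assms s by (simp add: hinode_def)
  then have y: "y = y'"
    using vx_eq[of y y'] hi_pos[OF assms(1,4)] hi_pos[OF assms(2) s] gt[OF assms(1)] gt[OF assms(2)]
    by auto
  from hiv_cases[OF assms(1,4)] show ?thesis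
  proof cases
    case (1 z)
    from hiv_cases[OF assms(2) s] show ?thesis
    proof cases
      case (1 z')
      then show ?thesis using \<open>y = Suc z\<close> \<open>inleg m z\<close> y inleg_unique by auto
    next
      case 2
      then show ?thesis using 1 y inleg_bounds[of m z] by simp
    qed
  next
    case 2
    from hiv_cases[OF assms(2) s] show ?thesis
    proof cases
      case (1 z')
      then show ?thesis using 2 y inleg_bounds[of m' z'] by simp
    next
      case 2
      then show ?thesis using \<open>m = 0\<close> y by simp
    qed
  qed
qed

text \<open>The two families of half-open intervals differ only at the turns, so a node can be lower
  on one leg and upper on another only at the turn between them. Hence the second clause of
  \<open>below\<close>.\<close>

lemma lonode_hinode:
  assumes lo: "lov m x" "\<not> star_lo m x" and hi: "hiv m' y" "\<not> star_hi m' y"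
    and eq: "lonode m x = hinode m' y"
  shows "m = m' \<and> x = y \<or> m = nxt m' \<and> x = turn m \<and> y = turn (Suc m')"
proof -
  have m: "m < r" "m' < r" using lo hi by (simp_all add: lov_def hiv_def)
  have x: "vx y = x" using lo lov_vx[of m x] hi eq by (simp add: lonode_def hinode_def)
  show ?thesis
  proof (cases "y = x")
    case False
    then have c: "\<not> is_path K" "y = Suc N" "x = 1" using x by (auto simp: vx_def split: if_splits)
    have "turn m \<le> 1" using lo_pos[OF lo] c by simp
    then have "m = 0" using turn_less[of 0 m] m by (cases m) auto
    moreover have "Suc m' = r"
      using hi_pos[OF hi] c turn_less_N[of "Suc m'"] m by (cases "Suc m' = r") auto
    ultimately show ?thesis using c turn_r by (simp add: nxt_def)
  next
    case True
    from lov_cases[OF lo] show ?thesis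
    proof
      assume e: "is_path K \<and> Suc m = r \<and> x = Suc N"
      then have "Suc m' = r"
        using hi_pos[OF hi] True turn_less_N[of "Suc m'"] m by (cases "Suc m' = r") auto
      then show ?thesis using e True by auto
    next
      assume i: "inleg m x"
      show ?thesis
      proof (cases "y = turn (Suc m')")
        case y: True
        then have "m = Suc m'" using i True inleg_at_turn[of "Suc m'" m] m by auto
        then show ?thesis using y True m by (auto simp: nxt_def)
      next
        case y: False
        from hiv_cases[OF hi] show ?thesis
        proof cases
          case (1 z)
          then have "inleg m' y" using y hi_pos[OF hi] by (auto simp: inleg_def)
          then show ?thesis using i True inleg_unique by blast
        next
          case 2
          then show ?thesis using i True inleg_at_turn[of 0 m] by simp
        qed
      qed
    qed
  qed
qed

lemma gvec_rt:
  assumes v: "valid m x y" and vtx: "bij_betw vtx UNIV {1..n}"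
  shows "gvec vtx K (rt m x y) = arc_vec vtx (lonode m x, hinode m y)"
proof -
  have pos: "vtx i \<noteq> 0" for i
  proof -
    have "vtx i \<in> {1..n}" using vtx by (auto simp: bij_betw_def)
    then show ?thesis by simp
  qed
  have "(if passes K (rt m x y) (vtx i) 1 2 then - 1 else if passes K (rt m x y) (vtx i) 2 1 then 1 else 0) =
      (if vtx i = hinode m y then 1 else 0) - (if vtx i = lonode m x then (1::real) else 0)" for i
  proof (cases "x = y")
    case True
    then have "lonode m x = hinode m y" using lonode_eq_hinode[OF v] exceptional_rt[OF v] by simp
    then show ?thesis using True unfolding passes_in[OF v] passes_out[OF v] by simp
  next
    case False
    have "lonode m x = hinode m y \<longleftrightarrow> star_lo m x \<and> star_hi m y"
      using lonode_eq_hinode[OF v] exceptional_rt[OF v] False by simp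
    then show ?thesis using False pos[of i]
      unfolding passes_in[OF v] passes_out[OF v] by (auto simp: lonode_def hinode_def)
  qed
  then show ?thesis by (simp add: gvec_def arc_vec_def node_vec_def vec_eq_iff)
qed

text \<open>In the second case the two routes meet only at the turning vertex between two consecutive
  legs.\<close>

definition below :: "nat \<Rightarrow> nat \<Rightarrow> nat \<Rightarrow> nat \<Rightarrow> nat \<Rightarrow> nat \<Rightarrow> bool" where
  "below m' x' y' m x y \<longleftrightarrow>
     m = m' \<and> x' < x \<and> x \<le> y' \<and> y' < y \<or> m = nxt m' \<and> x = turn m \<and> y' = turn (Suc m')"

section \<open>Conflict in terms of positions\<close>

lemma conflict_sym: "conflict K R S \<longleftrightarrow> conflict K S R"
proof -
  have "conflict K S R" if "conflict K R S" for R S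
  proof -
    from that obtain p a c b q p' a' b' q' where
      *: "R = p @ [a] @ c @ [b] @ q \<and> S = p' @ [a'] @ c @ [b'] @ q' \<and>
        head (dag K) a = head (dag K) a' \<and> a \<noteq> a' \<and> tail (dag K) b = tail (dag K) b' \<and> b \<noteq> b' \<and>
        (label K a < label K a' \<and> label K b > label K b' \<or>
         label K a' < label K a \<and> label K b' > label K b)"
      unfolding conflict_def by (elim exE)
    show ?thesis
      unfolding conflict_def
      by (rule exI[of _ p'], rule exI[of _ a'], rule exI[of _ c], rule exI[of _ b'], rule exI[of _ q'],
          rule exI[of _ p], rule exI[of _ a], rule exI[of _ b], rule exI[of _ q])
        (use * in auto)
  qed
  then show ?thesis by blast
qed

lemma conflict_passes:
  assumes "R \<in> routes K" "S \<in> routes K" "passes K R v 1 2" "passes K S v 2 1"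
  shows "conflict K R S"
proof -
  obtain p a b q where R: "R = p @ [a, b] @ q" "edge_head K a = Inner v" "label K a = 1" "label K b = 2"
    using assms(3) by (auto simp: passes_def simp del: edge_head.simps label.simps)
  obtain p' a' b' q' where S: "S = p' @ [a', b'] @ q'" "edge_head K a' = Inner v" "label K a' = 2" "label K b' = 1"
    using assms(4) by (auto simp: passes_def simp del: edge_head.simps label.simps)
  have "adjacent R a b" "adjacent S a' b'" using R S by (auto simp: adjacent_def)
  then have tl: "edge_tail K b = edge_tail K b'"
    using adjacent_route[OF assms(1)] adjacent_route[OF assms(2)] R S by metis
  show ?thesis
    unfolding conflict_def dag_simps
    by (rule exI[of _ p], rule exI[of _ a], rule exI[of _ "[]"], rule exI[of _ b], rule exI[of _ q],
        rule exI[of _ p'], rule exI[of _ a'], rule exI[of _ b'], rule exI[of _ q'])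
      (use R S tl in auto)
qed

text \<open>If \<open>z\<close> is the lower turn itself, then \<open>x\<close> is the virtual
  position and the edge entering \<open>z\<close> is the long exceptional one, which has the label
  of the leg as well.\<close>

lemma start_segment:
  assumes v: "valid m x y" and z: "x < z" "turn m \<le> z" "z \<le> turn (Suc m)"
  obtains p e where "lo_edge m x # map InnerEdge [lo m x..<z] = p @ [e]" "label K e = lab m"
    "(if even m then edge_head K e else edge_tail K e) = Inner (vx z)"
proof (cases "lo m x < z")
  case True
  then obtain w where w: "z = Suc w" by (cases z) auto
  have i: "inleg m w" "lo m x \<le> w"
    using validD(1,7)[OF v] z True by (simp_all add: inleg_def w)
  have "lo_edge m x # map InnerEdge [lo m x..<z] =
      (lo_edge m x # map InnerEdge [lo m x..<w]) @ [InnerEdge w]" using i by (simp add: w)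
  then show ?thesis
    by (rule that) (use label_inner[OF i(1)] inner_arc[OF i(1)] w in simp_all)
next
  case False
  then have "star_lo m x" "lo m x = z" using z by (auto simp: lo_def star_lo_def)
  then show ?thesis
    using that[of "[]" "lo_edge m x"] label_lo_edge[of m x] by (simp add: lo_edge_def)
qed

lemma end_segment:
  assumes v: "valid m x y" and z: "z < y" "turn m \<le> z" "z \<le> turn (Suc m)"
  obtains q e where "map InnerEdge [z..<hi m y] @ [hi_edge m y] = e # q" "label K e = lab m"
    "(if even m then edge_tail K e else edge_head K e) = Inner (vx z)"
proof (cases "z < hi m y")
  case True
  then have i: "inleg m z"
    using validD(1,8)[OF v] z(2) by (simp add: inleg_def)
  have "map InnerEdge [z..<hi m y] @ [hi_edge m y] = InnerEdge z # (map InnerEdge [Suc z..<hi m y] @ [hi_edge m y])"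
    using True by (simp add: upt_conv_Cons)
  then show ?thesis
    by (rule that) (use label_inner[OF i] inner_arc[OF i] inleg_le[OF i] in simp_all)
next
  case False
  then have "star_hi m y" "hi m y = z" using z by (auto simp: hi_def star_hi_def)
  then show ?thesis
    using that[of "hi_edge m y" "[]"] label_hi_edge[of m y] by (simp add: hi_edge_def)
qed

text \<open>The common subpath lies between \<open>x\<close> and \<open>y'\<close>. At
  \<open>x\<close> only the route \<open>(x, y)\<close> uses a label other than that of the leg, at
  \<open>y'\<close> only \<open>(x', y')\<close> does.\<close>

lemma conflict_same_leg:
  assumes v: "valid m x y" and v': "valid m x' y'" and *: "x' < x" "x \<le> y'" "y' < y"
  shows "conflict K (rt m x y) (rt m x' y')"
proof -
  have ns: "\<not> star_lo m x" "\<not> star_hi m y'"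
    using v v' * by (auto simp: valid_def lov_def hiv_def star_lo_def star_hi_def)
  then have x: "lo m x = x" "turn m \<le> x" "x \<le> turn (Suc m)" and y: "hi m y' = y'" "turn m \<le> y'" "y' \<le> turn (Suc m)"
    using v v' by (auto simp: valid_def lov_def hiv_def star_lo_def star_hi_def lo_def hi_def)
  obtain p e where p: "lo_edge m x' # map InnerEdge [lo m x'..<x] = p @ [e]" "label K e = lab m"
    "(if even m then edge_head K e else edge_tail K e) = Inner (vx x)"
    using start_segment[OF v' *(1) x(2,3)] by blast
  obtain q f where q: "map InnerEdge [y'..<hi m y] @ [hi_edge m y] = f # q" "label K f = lab m"
    "(if even m then edge_tail K f else edge_head K f) = Inner (vx y')"
    using end_segment[OF v *(3) y(2,3)] by blast
  let ?c = "map InnerEdge [x..<y']"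
  have "y' \<le> hi m y" "lo m x' \<le> x" using * x y by (auto simp: hi_def lo_def)
  then have "[x..<hi m y] = [x..<y'] @ [y'..<hi m y]" "[lo m x'..<y'] = [lo m x'..<x] @ [x..<y']"
    using *(2) upt_add_eq_append[of x y' "hi m y - y'"] upt_add_eq_append[of "lo m x'" x "y' - x"]
    by simp_all
  then have R: "lo_edge m x # map InnerEdge [lo m x..<hi m y] @ [hi_edge m y] = lo_edge m x # ?c @ f # q"
    and S: "lo_edge m x' # map InnerEdge [lo m x'..<hi m y'] @ [hi_edge m y'] = p @ e # ?c @ [hi_edge m y']"
    using p(1) q(1) x y by auto
  have l: "label K (lo_edge m x) = 3 - lab m" "label K (hi_edge m y') = 3 - lab m"
    using ns by (simp_all add: label_lo_edge label_hi_edge)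
  show ?thesis
  proof (cases "even m")
    case True
    have R': "rt m x y = [] @ [lo_edge m x] @ ?c @ [f] @ q"
      and S': "rt m x' y' = p @ [e] @ ?c @ [hi_edge m y'] @ []"
      using True R S by (simp_all add: rt_def)
    show ?thesis
      unfolding conflict_def dag_simps
      by (rule exI[of _ "[]"], rule exI[of _ "lo_edge m x"], rule exI[of _ ?c], rule exI[of _ f],
          rule exI[of _ q], rule exI[of _ p], rule exI[of _ e], rule exI[of _ "hi_edge m y'"], rule exI[of _ "[]"])
        (use R' S' True p q l x y in \<open>auto simp: lab_def lo_edge_def hi_edge_def\<close>)
  next
    case False
    have R': "rt m x y = rev q @ [f] @ rev ?c @ [lo_edge m x] @ []"
      and S': "rt m x' y' = [] @ [hi_edge m y'] @ rev ?c @ [e] @ rev p"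
      using False arg_cong[OF R, of rev] arg_cong[OF S, of rev] by (simp_all add: rt_def rev_map)
    show ?thesis
      unfolding conflict_def dag_simps
      by (rule exI[of _ "rev q"], rule exI[of _ f], rule exI[of _ "rev ?c"], rule exI[of _ "lo_edge m x"],
          rule exI[of _ "[]"], rule exI[of _ "[]"], rule exI[of _ "hi_edge m y'"], rule exI[of _ e], rule exI[of _ "rev p"])
        (use R' S' False p q l x y in \<open>auto simp: lab_def lo_edge_def hi_edge_def\<close>)
  qed
qed

lemma below_conflict:
  assumes v: "valid m x y" and v': "valid m' x' y'" and b: "below m' x' y' m x y"
  shows "conflict K (rt m x y) (rt m' x' y')"
proof (cases "m = m' \<and> x' < x \<and> x \<le> y' \<and> y' < y")
  case True
  then show ?thesis using conflict_same_leg v v' by blast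
next
  case False
  then have *: "m = nxt m'" "x = turn m" "y' = turn (Suc m')" using b by (auto simp: below_def)
  have m: "m < r" "m' < r" using validD v v' by auto
  have "x \<noteq> y" using v * by (auto simp: valid_def hiv_def nxt_def split: if_splits)
  then have "passes K (rt m x y) (vx x) 1 2"
    unfolding passes_out[OF v] using * by (simp add: star_lo_def)
  moreover have "x' \<noteq> y'"
    using v' * m by (auto simp: valid_def lov_def nxt_def split: if_splits)
  then have "passes K (rt m' x' y') (vx x) 2 1"
    unfolding passes_in[OF v'] using * nxt_vx[of m'] m by (simp add: star_hi_def)
  ultimately show ?thesis using conflict_passes rt_route v v' by blast
qed

text \<open>If the common subpath is one vertex, one route changes there from 1 to 2 and the other
  from 2 to 1, so \<open>lonode_hinode\<close> applies. Otherwise its first and last edges are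
  inner, which puts both routes on one leg, and the labels next to them reveal the
  positions.\<close>

lemma conflict_below:
  assumes v: "valid m x y" and v': "valid m' x' y'"
    and R: "rt m x y = p @ [a] @ c @ [b] @ q" and S: "rt m' x' y' = p' @ [a'] @ c @ [b'] @ q'"
    and h: "edge_head K a = edge_head K a'" and l: "label K a < label K a'" "label K b' < label K b"
  shows "below m' x' y' m x y"
proof -
  have lb: "label K e \<in> {1, 2}" if e: "e \<in> set (rt m x y)" and v0: "valid m x y" for m x y e
  proof -
    consider "e = lo_edge m x" | "e = hi_edge m y" | i where "e = InnerEdge i" "i \<in> {lo m x..<hi m y}"
      using e unfolding set_rt by blast
    then show ?thesis
    proof cases
      case (3 i)
      then have "label K e = lab m" using label_inner[OF inleg_between[OF v0], of i] by simp
      then show ?thesis by (simp add: lab_def)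
    qed (simp_all add: label_lo_edge label_hi_edge lab_def)
  qed
  have "label K a \<in> {1, 2}" "label K b \<in> {1, 2}" using lb[OF _ v] R by auto
  moreover have "label K a' \<in> {1, 2}" "label K b' \<in> {1, 2}" using lb[OF _ v'] S by auto
  ultimately have ll: "label K a = 1" "label K a' = 2" "label K b = 2" "label K b' = 1" using l by auto
  show ?thesis
  proof (cases c)
    case Nil
    have adj: "adjacent (rt m x y) a b" "adjacent (rt m' x' y') a' b'"
      using R S Nil by (auto simp: adjacent_def)
    have "\<exists>w. edge_head K a = Inner w"
    proof -
      have "junction m a b = edge_head K a \<or> junction m b a = edge_head K a"
        by (simp add: junction_def)
      then show ?thesis
        using adjacent_route[OF rt_route[OF v] adj(1)]
        by (cases a; cases b) auto
    qed
    then obtain w where w: "edge_head K a = Inner w" by blast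
    have "passes K (rt m x y) w 1 2" "passes K (rt m' x' y') w 2 1"
      using adj w h ll unfolding passes_adjacent by metis+
    then have *: "x \<noteq> y" "\<not> star_lo m x" "w = vx x" "x' \<noteq> y'" "\<not> star_hi m' y'" "w = vx y'"
      unfolding passes_out[OF v] passes_in[OF v'] by auto
    then have "m = m' \<and> x = y' \<or> m = nxt m' \<and> x = turn m \<and> y' = turn (Suc m')"
      using lonode_hinode[of m x m' y'] validD[OF v] validD[OF v']
      by (simp add: lonode_def hinode_def)
    then show ?thesis using * validD(4)[OF v] validD(4)[OF v'] by (auto simp: below_def)
  next
    case (Cons f cs)
    have "c \<noteq> []" using Cons by simp
    then obtain c0 g where c0: "c = c0 @ [g]" using rev_exhaust by blast
    note c = Cons
    have Rc: "rt m x y = (p @ [a] @ c0) @ [g, b] @ q" and Sc: "rt m' x' y' = (p' @ [a'] @ c0) @ [g, b'] @ q'"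
      using R S by (simp_all add: c0)
    have Rf: "adjacent (rt m x y) a f" and Sf: "adjacent (rt m' x' y') a' f"
      using R S c by (auto simp: adjacent_def)
    have Rg: "adjacent (rt m x y) g b" and Sg: "adjacent (rt m' x' y') g b'"
      using Rc Sc unfolding adjacent_def by blast+
    obtain f' where Rf': "adjacent (rt m x y) f f'"
    proof (cases cs)
      case Nil
      then have "rt m x y = (p @ [a]) @ [f, b] @ q" using R c by simp
      then show ?thesis using that unfolding adjacent_def by blast
    next
      case (Cons f' cs')
      then have "rt m x y = (p @ [a]) @ [f, f'] @ (cs' @ [b] @ q)" using R c by simp
      then show ?thesis using that unfolding adjacent_def by blast
    qed
    obtain g' where Rg': "adjacent (rt m x y) g' g"
    proof -
      obtain p0 h where "p @ [a] @ c0 = p0 @ [h]"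
        by (cases "p @ [a] @ c0" rule: rev_cases) auto
      then have "rt m x y = p0 @ [h, g] @ (b # q)" using Rc by simp
      then show ?thesis using that unfolding adjacent_def by blast
    qed
    \<comment> \<open>An edge with neighbours on both sides is inner; \<open>f'\<close> and
      \<open>g'\<close> serve only as such neighbours.\<close>
    have inner: "\<exists>i. e = InnerEdge i" if "step m x y d e" "step m x y e d'" for d e d'
      using that unfolding step_def by (auto simp: interval_step.simps)
    obtain i where i: "f = InnerEdge i"
      using inner Rf Rf' unfolding adjacent_rt[OF v] by (metis (full_types))
    obtain j where j: "g = InnerEdge j"
      using inner Rg Rg' unfolding adjacent_rt[OF v] by (metis (full_types))
    have "f \<in> set c" "g \<in> set c" by (simp add: c, simp add: c0)
    then have "f \<in> set (rt m x y)" "f \<in> set (rt m' x' y')" "g \<in> set (rt m' x' y')"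
      unfolding R S by simp_all
    then have il: "i \<in> {lo m x..<hi m y}" "i \<in> {lo m' x'..<hi m' y'}" "j \<in> {lo m' x'..<hi m' y'}"
      using i j by (auto simp: set_rt)
    have mm: "m' = m"
      using il inleg_between[OF v, of i] inleg_between[OF v', of i] inleg_unique by auto
    \<comment> \<open>Next to an inner edge, a label different from that of the leg marks the end of
      the route, while the label of the leg shows that its position lies strictly beyond.\<close>
    have st_lo_other: "\<not> star_lo m x \<and> i = x" if "valid m x y" "step m x y e (InnerEdge i)" "label K e \<noteq> lab m" for x y e i
      using step_lo[OF that] that(2) unfolding step_def
      by (auto simp: interval_step.simps lo_def star_lo_def)
    have st_lo_same: "x < i" if "valid m x y" "step m x y e (InnerEdge i)" "label K e = lab m" for x y e i
      using that(2)[unfolded step_def]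
    proof cases
      case first
      then have "star_lo m x" using that(3) lab_neq by (auto simp: label_lo_edge split: if_splits)
      then show ?thesis using first by (simp add: lo_def star_lo_def)
    qed (auto simp: lo_def)
    have st_hi_other: "\<not> star_hi m y \<and> Suc i = y" if "valid m x y" "step m x y (InnerEdge i) e" "label K e \<noteq> lab m" for x y e i
      using step_hi[OF that] that(2) unfolding step_def
      by (auto simp: interval_step.simps hi_def star_hi_def)
    have st_hi_same: "Suc i < y" if "valid m x y" "step m x y (InnerEdge i) e" "label K e = lab m" for x y e i
      using that(2)[unfolded step_def]
    proof cases
      case last
      then have "star_hi m y" using that(3) lab_neq by (auto simp: label_hi_edge split: if_splits)
      then show ?thesis using last by (simp add: hi_def star_hi_def)
    qed (auto simp: hi_def)
    have "x' < x \<and> x \<le> y' \<and> y' < y"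
    proof (cases "even m")
      case True
      have 1: "i = x" using st_lo_other[OF v, of a i] Rf True ll by (auto simp: adjacent_rt[OF v] i lab_def)
      have 2: "x' < i" using st_lo_same[OF v'[unfolded mm], of a' i] Sf True ll
        by (auto simp: adjacent_rt[OF v'[unfolded mm]] i lab_def mm)
      have 3: "Suc j < y" using st_hi_same[OF v, of j b] Rg True ll by (auto simp: adjacent_rt[OF v] j lab_def)
      have 4: "Suc j = y'" using st_hi_other[OF v'[unfolded mm], of j b'] Sg True ll
        by (auto simp: adjacent_rt[OF v'[unfolded mm]] j lab_def mm)
      show ?thesis using 1 2 3 4 il by (auto simp: mm hi_def)
    next
      case False
      \<comment> \<open>On an odd leg the route runs downwards, so the last common edge
        \<open>g\<close> is the lowest.\<close>
      have 1: "j = x" using st_lo_other[OF v, of b j] Rg False ll by (auto simp: adjacent_rt[OF v] j lab_def)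
      have 2: "x' < j" using st_lo_same[OF v'[unfolded mm], of b' j] Sg False ll
        by (auto simp: adjacent_rt[OF v'[unfolded mm]] j lab_def mm)
      have 3: "Suc i < y" using st_hi_same[OF v, of i a] Rf False ll by (auto simp: adjacent_rt[OF v] i lab_def)
      have 4: "Suc i = y'" using st_hi_other[OF v'[unfolded mm], of i a'] Sf False ll
        by (auto simp: adjacent_rt[OF v'[unfolded mm]] i lab_def mm)
      show ?thesis using 1 2 3 4 il by (auto simp: mm hi_def)
    qed
    then show ?thesis by (simp add: below_def mm)
  qed
qed

lemma conflict_rt:
  assumes v: "valid m x y" and v': "valid m' x' y'"
  shows "conflict K (rt m x y) (rt m' x' y') \<longleftrightarrow> below m' x' y' m x y \<or> below m x y m' x' y'"
proof
  assume "conflict K (rt m x y) (rt m' x' y')"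
  then obtain p a c b q p' a' b' q' where
    *: "rt m x y = p @ [a] @ c @ [b] @ q" "rt m' x' y' = p' @ [a'] @ c @ [b'] @ q'"
    "edge_head K a = edge_head K a'"
    "label K a < label K a' \<and> label K b > label K b' \<or> label K a' < label K a \<and> label K b' > label K b"
    unfolding conflict_def dag_simps by blast
  then show "below m' x' y' m x y \<or> below m x y m' x' y'"
    using conflict_below[OF v v' *(1,2,3)] conflict_below[OF v' v *(2,1) *(3)[symmetric]] by blast
next
  assume "below m' x' y' m x y \<or> below m x y m' x' y'"
  then show "conflict K (rt m x y) (rt m' x' y')"
    using below_conflict v v' conflict_sym by blast
qed

section \<open>The unrolled coherence diagram\<close>

text \<open>The encoded names of the end edges of a route.  At the upper end of the last leg of a cycle
  the vertex 1 is given the number \<open>Suc N\<close>; this places the two bottom rows below all others, and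
  only the identification with the top rows remains to be treated separately.\<close>

definition codeA :: "nat \<Rightarrow> nat \<Rightarrow> int" where
  "codeA m x = (if star_lo m x then 3 * int (turn m) - 1
     else if x = turn m \<and> \<not> (is_path K \<and> m = 0) then 3 * int x + 1 else 3 * int x)"

definition codeB :: "nat \<Rightarrow> nat \<Rightarrow> int" where
  "codeB m y = (if star_hi m y then 3 * int (turn (Suc m)) + 1
     else if y = turn (Suc m) \<and> \<not> (is_path K \<and> Suc m = r) then 3 * int y - 1 else 3 * int y)"

lemma short_lo_hi: "valid m x x \<longleftrightarrow> lov m x \<and> hiv m x"
  by (simp add: valid_def)

lemma short_edge_iff:
  "(\<exists>R. short_exceptional K R \<and> e \<in> set R) \<longleftrightarrow> (\<exists>m z. valid m z z \<and> (e = lo_edge m z \<or> e = hi_edge m z))"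
proof
  assume "\<exists>R. short_exceptional K R \<and> e \<in> set R"
  then obtain R where R: "short_exceptional K R" "e \<in> set R" by blast
  then have "R \<in> routes K" by (simp add: short_exceptional_def exceptional_def)
  then obtain m x y where v: "valid m x y" and r: "R = rt m x y" using route_form by blast
  then have "x = y" using R short_exceptional_rt by simp
  then show "\<exists>m z. valid m z z \<and> (e = lo_edge m z \<or> e = hi_edge m z)"
    using v R(2) short_pos[of m x] by (auto simp: r set_rt)
next
  assume "\<exists>m z. valid m z z \<and> (e = lo_edge m z \<or> e = hi_edge m z)"
  then obtain m z where v: "valid m z z" "e = lo_edge m z \<or> e = hi_edge m z" by blast
  then have "short_exceptional K (rt m z z)" "e \<in> set (rt m z z)"
    using short_exceptional_rt[OF v(1)] by (auto simp: set_rt)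
  then show "\<exists>R. short_exceptional K R \<and> e \<in> set R" by blast
qed

lemma edge_vertex_lo_hi: "edge_vertex (lo_edge m x) = vx (lo m x)" "edge_vertex (hi_edge m y) = vx (hi m y)"
  by (simp_all add: lo_edge_def hi_edge_def)

text \<open>The vertex determines leg and position of a real lower end. For a long exceptional edge
  the short route would sit at the lower turn, which is possible only at the start of a path, and
  there its edges are different from this one.\<close>

lemma lo_edge_short:
  assumes lo: "lov m x" and z: "valid m' z z" and e: "lo_edge m x = lo_edge m' z \<or> lo_edge m x = hi_edge m' z"
  shows "m' = m \<and> z = x"
proof -
  have m: "m < r" "turn m < turn (Suc m)" using lo turn_Suc[of m] by (auto simp: lov_def)
  have zp: "lov m' z" "\<not> star_lo m' z" "hi m' z = z" "lo m' z = z"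
    using z short_pos[OF z] by (auto simp: valid_def)
  have "vx (lo m x) = vx z"
    using e edge_vertex_lo_hi zp by metis
  then have zz: "vx (lo m x) = lonode m' z" using zp by (simp add: lonode_def)
  show ?thesis
  proof (cases "star_lo m x")
    case False
    then have "lonode m x = lonode m' z" using zz by (simp add: lonode_def star_lo_def lo_def)
    then show ?thesis using lonode_inj[OF lo zp(1)] False by simp
  next
    case True
    have "lov m (turn m)" using m by (simp add: lov_def)
    moreover have "\<not> star_lo m (turn m)" by (simp add: star_lo_def)
    moreover have "lonode m (turn m) = lonode m' z"
      using True zz by (simp add: lonode_def star_lo_def lo_def)
    ultimately have mz: "m = m'" "z = turn m" using lonode_inj[of m "turn m" m' z] zp by auto
    then have "m = 0" using z by (auto simp: valid_def hiv_def)
    then show ?thesis using e mz True by (simp add: lo_edge_def hi_edge_def star_lo_def)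
  qed
qed

lemma hi_edge_short:
  assumes hi: "hiv m y" and z: "valid m' z z" and e: "hi_edge m y = lo_edge m' z \<or> hi_edge m y = hi_edge m' z"
  shows "m' = m \<and> z = y"
proof -
  have m: "m < r" "turn m < turn (Suc m)" using hi turn_Suc[of m] by (auto simp: hiv_def)
  have zp: "hiv m' z" "\<not> star_hi m' z" "hi m' z = z" "lo m' z = z"
    using z short_pos[OF z] by (auto simp: valid_def)
  have "vx (hi m y) = vx z"
    using e edge_vertex_lo_hi zp by metis
  then have zz: "vx (hi m y) = hinode m' z" using zp by (simp add: hinode_def)
  show ?thesis
  proof (cases "star_hi m y")
    case False
    then have "hinode m y = hinode m' z" using zz by (simp add: hinode_def star_hi_def hi_def)
    then show ?thesis using hinode_inj[OF hi zp(1)] False by simp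
  next
    case True
    have "hiv m (turn (Suc m))" using m by (simp add: hiv_def)
    moreover have "\<not> star_hi m (turn (Suc m))" by (simp add: star_hi_def)
    moreover have "hinode m (turn (Suc m)) = hinode m' z"
      using True zz by (simp add: hinode_def star_hi_def hi_def)
    ultimately have mz: "m = m'" "z = turn (Suc m)" using hinode_inj[of m "turn (Suc m)" m' z] zp by auto
    then show ?thesis using e True by (auto simp: lo_edge_def hi_edge_def star_hi_def lo_def hi_def split: if_splits)
  qed
qed

lemma source_sink_arcs: "SourceEdge v l \<in> source_edges K \<longleftrightarrow> SourceEdge v l \<in> arcs (dag K)"
  "SinkEdge v l \<in> sink_edges K \<longleftrightarrow> SinkEdge v l \<in> arcs (dag K)"
  "SourceEdge v l \<notin> sink_edges K" "SinkEdge v l \<notin> source_edges K"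
  by (auto simp: dag_def inner_edges_def source_edges_def sink_edges_def)

lemma edge_name_lo:
  assumes lo: "lov m x" shows "edge_name K (lo_edge m x) = codeA m x"
proof -
  have arc: "lo_edge m x \<in> arcs (dag K)" using lo_edge_arc lo .
  have short: "(\<exists>R. short_exceptional K R \<and> lo_edge m x \<in> set R) \<longleftrightarrow> valid m x x"
    unfolding short_edge_iff using lo_edge_short[OF lo] by blast
  have vt: "vx (turn m) = turn m" using lo by (simp add: lov_def)
  show ?thesis
  proof (cases "valid m x x")
    case True
    then have "\<not> star_lo m x" "x \<noteq> turn m \<or> is_path K \<and> m = 0"
      by (auto simp: valid_def hiv_def star_lo_def)
    moreover have "vx (lo m x) = x" using True short_pos[OF True] lov_vx[OF lo] by simp
    ultimately show ?thesis
      using True by (simp add: edge_name_def short codeA_def edge_vertex_lo_hi)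
  next
    case False
    then have "star_lo m x \<or> x = turn m \<and> \<not> (is_path K \<and> m = 0)"
      using lo turn_Suc[of m] by (auto simp: short_lo_hi lov_def hiv_def star_lo_def)
    moreover have "vx (lo m x) = turn m" using calculation vt by (auto simp: lo_def star_lo_def)
    moreover have lab: "(lo_edge m x \<in> source_edges K \<and> label K (lo_edge m x) = 2 \<or>
        lo_edge m x \<in> sink_edges K \<and> label K (lo_edge m x) = 1) \<longleftrightarrow> star_lo m x"
      using arc by (cases "even m") (auto simp: lo_edge_def source_sink_arcs star_lo_def)
    ultimately show ?thesis
      using False lab unfolding edge_name_def short codeA_def edge_vertex_lo_hi by auto
  qed
qed

text \<open>These will be the routes of the two bottom rows; their unrolled row exceeds the name of
  the source edge by \<open>3 * int N\<close>.\<close>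

definition wraps :: "nat \<Rightarrow> nat \<Rightarrow> bool" where
  "wraps m y \<longleftrightarrow> \<not> is_path K \<and> Suc m = r \<and> turn (Suc m) \<le> y"

lemma edge_name_hi:
  assumes hi: "hiv m y"
  shows "edge_name K (hi_edge m y) = codeB m y - (if wraps m y then 3 * int N else 0)"
proof -
  have arc: "hi_edge m y \<in> arcs (dag K)" using hi_edge_arc hi .
  have short: "(\<exists>R. short_exceptional K R \<and> hi_edge m y \<in> set R) \<longleftrightarrow> valid m y y"
    unfolding short_edge_iff using hi_edge_short[OF hi] by blast
  have vt: "int (vx (turn (Suc m))) = int (turn (Suc m)) - (if \<not> is_path K \<and> Suc m = r then int N else 0)"
    using turn_less_N[of "Suc m"] hi turn_r by (auto simp: hiv_def vx_def)
  show ?thesis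
  proof (cases "valid m y y")
    case True
    then have "\<not> star_hi m y" "y \<noteq> turn (Suc m) \<or> is_path K \<and> Suc m = r" "\<not> wraps m y"
      by (auto simp: valid_def lov_def star_hi_def wraps_def)
    moreover have "vx (hi m y) = y"
      using True short_pos[OF True] lov_vx[of m y] by (simp add: valid_def)
    ultimately show ?thesis
      using True by (simp add: edge_name_def short codeB_def edge_vertex_lo_hi)
  next
    case False
    then have *: "star_hi m y \<or> y = turn (Suc m) \<and> \<not> (is_path K \<and> Suc m = r)"
      using hi turn_Suc[of m] by (auto simp: short_lo_hi lov_def hiv_def star_hi_def)
    then have "vx (hi m y) = vx (turn (Suc m))" by (auto simp: hi_def star_hi_def)
    then have vxi: "int (vx (hi m y)) = int (turn (Suc m)) - (if wraps m y then int N else 0)"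
      using vt * by (auto simp: wraps_def star_hi_def)
    have lab: "(hi_edge m y \<in> source_edges K \<and> label K (hi_edge m y) = 2 \<or>
        hi_edge m y \<in> sink_edges K \<and> label K (hi_edge m y) = 1) \<longleftrightarrow> \<not> star_hi m y"
      using arc by (cases "even m") (auto simp: hi_edge_def source_sink_arcs star_hi_def)
    have "edge_name K (hi_edge m y) = 3 * int (vx (hi m y)) + (if star_hi m y then 1 else -1)"
      unfolding edge_name_def short edge_vertex_lo_hi lab using False by simp
    moreover have "codeB m y = 3 * int (turn (Suc m)) + (if star_hi m y then 1 else -1)"
      using * by (auto simp: codeB_def)
    ultimately show ?thesis using vxi by simp
  qed
qed

section \<open>Rows and columns in unrolled coordinates\<close>

definition urow :: "nat \<Rightarrow> nat \<Rightarrow> nat \<Rightarrow> int" where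
  "urow m x y = (if even m then codeA m x else codeB m y)"

definition ucol :: "nat \<Rightarrow> nat \<Rightarrow> nat \<Rightarrow> int" where
  "ucol m x y = (if even m then codeB m y else codeA m x)"

text \<open>The last leg of a cycle runs downwards, so its upper end is a source edge: the seam
  shifts rows and never columns.\<close>

lemma wraps_odd: "wraps m y \<Longrightarrow> odd m"
proof -
  assume w: "wraps m y"
  then have "even r" and r: "Suc m = r" using cycle_even by (auto simp: wraps_def)
  then have "even (Suc m)" by (simp only: r)
  then show "odd m" by simp
qed

lemma row_rt: "valid m x y \<Longrightarrow> row K (rt m x y) = urow m x y - (if wraps m y then 3 * int N else 0)"
  using edge_name_lo[of m x] edge_name_hi[of m y] wraps_odd[of m y]
  by (auto simp: row_def rt_def urow_def valid_def)

lemma col_rt: "valid m x y \<Longrightarrow> col K (rt m x y) = ucol m x y"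
  using edge_name_lo[of m x] edge_name_hi[of m y] wraps_odd[of m y]
  by (auto simp: col_def rt_def ucol_def valid_def)

lemma codeB_wraps: "wraps m y \<Longrightarrow> codeB m y = 3 * int N + (if star_hi m y then 4 else 2)"
  using turn_r by (auto simp: wraps_def codeB_def star_hi_def)

lemma codeA_ge: "codeA m x \<ge> 3 * int (turn m) - 1"
  by (auto simp: codeA_def star_lo_def)

lemma codeB_le: "codeB m y \<le> 3 * int (turn (Suc m)) + 1"
  by (auto simp: codeB_def star_hi_def)

lemma codeA_le:
  assumes "lov m x" shows "codeA m x \<le> 3 * int (turn (Suc m)) - 2 \<or> is_path K \<and> Suc m = r"
  using assms turn_Suc[of m] by (auto simp: codeA_def lov_def star_lo_def)

lemma codeB_ge:
  assumes "hiv m y" shows "codeB m y \<ge> 3 * int (turn m) + 2 \<or> is_path K \<and> m = 0"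
  using assms turn_Suc[of m] by (auto simp: codeB_def hiv_def star_hi_def)

text \<open>Names increase with the legs. This discards two of the four two-leg patterns of
  \<open>legs_around\<close> in each of \<open>planar_NW\<close> and
  \<open>planar_NE\<close>.\<close>

lemma codeA_less_codeB:
  assumes "m' < m" "lov m' x'" "hiv m y"
  shows "codeA m' x' < codeB m y"
  using codeA_le[OF assms(2)] codeB_ge[OF assms(3)] assms turn_mono[of "Suc m'" m]
  by (auto simp: hiv_def)

text \<open>The two rows at the seam have the values \<open>3 * int N + 2\<close> and
  \<open>3 * int N + 4\<close>, and so they come after all others just as the bottom rows
  do.\<close>

lemma urow_bounds:
  assumes v: "valid m x y" and c: "\<not> is_path K"
  shows "wraps m y \<Longrightarrow> urow m x y = 3 * int N + (if star_hi m y then 4 else 2)"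
    "\<not> wraps m y \<Longrightarrow> urow m x y \<le> 3 * int N + 1" "2 \<le> urow m x y"
proof -
  show "wraps m y \<Longrightarrow> urow m x y = 3 * int N + (if star_hi m y then 4 else 2)"
    using codeB_wraps[of m y] wraps_odd[of m y] by (simp add: urow_def)
  show "urow m x y \<le> 3 * int N + 1" if w: "\<not> wraps m y"
  proof (cases "even m")
    case True
    then show ?thesis using codeA_le[of m x] v c turn_le_N[of "Suc m"] by (auto simp: urow_def valid_def lov_def)
  next
    case odd: False
    show ?thesis
    proof (cases "Suc m = r")
      case True
      then have "y < turn (Suc m)" using w c by (auto simp: wraps_def)
      then show ?thesis using odd turn_r True by (auto simp: urow_def codeB_def star_hi_def)
    next
      case False
      then have "turn (Suc m) \<le> N" using v turn_less_N[of "Suc m"] by (simp add: valid_def lov_def)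
      then show ?thesis using odd codeB_le[of m y] by (simp add: urow_def)
    qed
  qed
  show "2 \<le> urow m x y"
    using codeA_ge[of m x] codeB_ge[of m y] turn_pos[of m] v c by (auto simp: urow_def valid_def)
qed

lemma code_parity: "codeA m x = 2 \<Longrightarrow> lov m x \<Longrightarrow> star_lo m x \<and> turn m = 1"
  "codeA m x = 4 \<Longrightarrow> lov m x \<Longrightarrow> x = turn m \<and> turn m = 1"
  by (auto simp: codeA_def split: if_splits) presburger+

lemma turn_eq_1: "m < r \<Longrightarrow> turn m = 1 \<Longrightarrow> m = 0"
  using turn_less[of 0 m] by (cases m) auto

text \<open>A route in row \<open>1^-\<close> or \<open>1^+\<close> that does not end at the seam
  lies on leg 0 and contains the inner edge 1, which is not on the last leg; odd legs have larger
  row codes.\<close>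

lemma bottom_rt:
  assumes v: "valid m x y"
  shows "bottom K (rt m x y) \<longleftrightarrow> wraps m y"
proof (cases K)
  case (Path ks)
  then have "is_path K" by (simp add: is_path_def)
  then have "\<not> wraps m y" by (simp add: wraps_def)
  moreover have "\<not> bottom K (rt m x y)" using Path by simp
  ultimately show ?thesis by simp
next
  case (Cycle ks)
  then have c: "\<not> is_path K" by (simp add: is_path_def)
  have "bottom K (rt m x y) \<longleftrightarrow> row K (rt m x y) \<in> {2, 4} \<and>
      (\<forall>i. InnerEdge i \<in> set (rt m x y) \<longrightarrow> block K i = r)"
    by (simp add: Cycle)
  also have "\<dots> \<longleftrightarrow> wraps m y"
  proof
    assume w: "wraps m y"
    have "block K i = r" if "InnerEdge i \<in> set (rt m x y)" for i
    proof -
      have "inleg m i" using that inleg_between[OF v] by (auto simp: set_rt)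
      then show ?thesis using block_inleg w by (simp add: wraps_def)
    qed
    then show "row K (rt m x y) \<in> {2, 4} \<and> (\<forall>i. InnerEdge i \<in> set (rt m x y) \<longrightarrow> block K i = r)"
      using row_rt[OF v] urow_bounds(1)[OF v c w] w by auto
  next
    assume *: "row K (rt m x y) \<in> {2, 4} \<and> (\<forall>i. InnerEdge i \<in> set (rt m x y) \<longrightarrow> block K i = r)"
    show "wraps m y"
    proof (rule ccontr)
      assume w: "\<not> wraps m y"
      then have u: "urow m x y = 2 \<or> urow m x y = 4" using * row_rt[OF v] by auto
      show False
      proof (cases "even m")
        case True
        then have t: "turn m = 1" "x \<le> turn m"
          using u code_parity[of m x] v by (auto simp: urow_def valid_def star_lo_def)
        then have "m = 0" using turn_eq_1 v by (simp add: valid_def lov_def)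
        moreover have "turn m < y" using v c by (auto simp: valid_def hiv_def)
        ultimately have "InnerEdge 1 \<in> set (rt m x y)"
          using t turn_Suc[of 0] r_pos by (auto simp: set_rt lo_def hi_def)
        moreover have "inleg 0 1" using turn_Suc[of 0] r_pos by (simp add: inleg_def)
        ultimately show False using * block_inleg[of 0 1] cycle_r[OF c] by auto
      next
        case False
        then have "0 < m" by (cases m) auto
        then have "turn m \<ge> 2" using turn_less[of 0 m] v by (simp add: valid_def lov_def)
        then show False using u False codeB_ge[of m y] v c by (auto simp: urow_def valid_def)
      qed
    qed
  qed
  finally show ?thesis .
qed

lemma above_rt:
  assumes v: "valid m x y" and v': "valid m' x' y'"
  shows "above K (rt m x y) (rt m' x' y') \<longleftrightarrow> ucol m x y = ucol m' x' y' \<and> urow m x y < urow m' x' y'"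
proof (cases "is_path K")
  case True
  then have "\<not> wraps m y" "\<not> wraps m' y'" by (simp_all add: wraps_def)
  then show ?thesis
    unfolding above_def col_rt[OF v] col_rt[OF v'] bottom_rt[OF v] bottom_rt[OF v'] row_rt[OF v] row_rt[OF v']
    by simp
next
  case False
  have "wraps m y \<Longrightarrow> \<not> wraps m' y' \<Longrightarrow> urow m' x' y' < urow m x y"
    "wraps m' y' \<Longrightarrow> \<not> wraps m y \<Longrightarrow> urow m x y < urow m' x' y'"
    using urow_bounds(1,2)[OF v False] urow_bounds(1,2)[OF v' False] by (auto split: if_splits)
  then show ?thesis
    unfolding above_def col_rt[OF v] col_rt[OF v'] bottom_rt[OF v] bottom_rt[OF v'] row_rt[OF v] row_rt[OF v']
    by (cases "wraps m y"; cases "wraps m' y'") simp_all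
qed

text \<open>The difference \<open>3 * int N\<close> compares the same row name read at position
  \<open>Suc N\<close> and at position 1; this disjunct is the identification.\<close>

lemma left_of_rt:
  assumes v: "valid m x y" and v': "valid m' x' y'"
  shows "left_of K (rt m x y) (rt m' x' y') \<longleftrightarrow> urow m x y = urow m' x' y' \<and> ucol m x y < ucol m' x' y' \<or>
     wraps m y \<and> \<not> wraps m' y' \<and> urow m x y = urow m' x' y' + 3 * int N"
proof (cases "is_path K")
  case True
  then have "\<not> wraps m y" "\<not> wraps m' y'" by (simp_all add: wraps_def)
  then show ?thesis
    unfolding left_of_def col_rt[OF v] col_rt[OF v'] bottom_rt[OF v] bottom_rt[OF v'] row_rt[OF v] row_rt[OF v']
    by simp
next
  case False
  have "wraps m y \<Longrightarrow> \<not> wraps m' y' \<Longrightarrow> urow m' x' y' \<noteq> urow m x y"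
    "wraps m' y' \<Longrightarrow> \<not> wraps m y \<Longrightarrow> urow m x y \<noteq> urow m' x' y'"
    using urow_bounds(1,2)[OF v False] urow_bounds(1,2)[OF v' False] by (auto split: if_splits)
  then show ?thesis
    unfolding left_of_def col_rt[OF v] col_rt[OF v'] bottom_rt[OF v] bottom_rt[OF v'] row_rt[OF v] row_rt[OF v']
    by (cases "wraps m y"; cases "wraps m' y'") auto
qed

text \<open>An edge at the turning vertex between the legs \<open>m'\<close> and \<open>m\<close> lies on the long exceptional route
  of exactly one of the two legs.\<close>

definition link :: "nat \<Rightarrow> nat \<Rightarrow> nat \<Rightarrow> nat \<Rightarrow> bool" where
  "link m' y' m x \<longleftrightarrow> star_lo m x \<and> y' = turn (Suc m') \<or> x = turn m \<and> star_hi m' y'"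

section \<open>When two routes share a row or a column\<close>

lemma lov_star: "lov m x \<Longrightarrow> star_lo m x \<Longrightarrow> x = turn m - 1"
  by (auto simp: lov_def star_lo_def)

lemma hiv_star: "hiv m y \<Longrightarrow> star_hi m y \<Longrightarrow> y = Suc (turn (Suc m))"
  by (auto simp: hiv_def star_hi_def)

text \<open>The residues 0, 1, 2 stand for the names \<open>i\<close>, \<open>i^+\<close>,
  \<open>i^-\<close>, so an equation of codes can be split by kind.\<close>

lemma codeA_mod: "codeA m x mod 3 =
    (if star_lo m x then 2 else if x = turn m \<and> \<not> (is_path K \<and> m = 0) then 1 else 0)"
proof -
  have "(3 * int a - 1) mod 3 = 2" "(3 * int a + 1) mod 3 = 1" for a by presburger+
  then show ?thesis by (auto simp: codeA_def)
qed

lemma codeB_mod: "codeB m y mod 3 =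
    (if star_hi m y then 1 else if y = turn (Suc m) \<and> \<not> (is_path K \<and> Suc m = r) then 2 else 0)"
proof -
  have "(3 * int a - 1) mod 3 = 2" "(3 * int a + 1) mod 3 = 1" for a by presburger+
  then show ?thesis by (auto simp: codeB_def)
qed

lemma codeA_inj:
  assumes "lov m x" "lov m' x'" "codeA m x = codeA m' x'"
  shows "m = m' \<and> x = x'"
proof -
  have m: "m < r" "m' < r" using assms by (auto simp: lov_def)
  consider "star_lo m x" "star_lo m' x'" "turn m = turn m'" |
    "x = turn m" "x' = turn m'" "turn m = turn m'" | "\<not> star_lo m x" "\<not> star_lo m' x'" "x = x'"
  proof -
    have "codeA m x mod 3 = codeA m' x' mod 3" using assms(3) by simp
    then have "star_lo m x \<and> star_lo m' x' \<and> turn m = turn m' \<or>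
        x = turn m \<and> x' = turn m' \<and> turn m = turn m' \<or> \<not> star_lo m x \<and> \<not> star_lo m' x' \<and> x = x'"
      using assms(3) unfolding codeA_mod by (simp add: codeA_def split: if_split_asm)
    then show ?thesis using that by blast
  qed
  then show ?thesis
  proof cases
    case 1
    then show ?thesis using turn_inj[of m m'] m lov_star assms by auto
  next
    case 2
    then show ?thesis using turn_inj[of m m'] m by auto
  next
    case 3
    then have "lonode m x = lonode m' x'" by (simp add: lonode_def)
    then show ?thesis using lonode_inj[OF assms(1,2)] 3 by simp
  qed
qed

lemma codeB_inj:
  assumes "hiv m y" "hiv m' y'" "codeB m y = codeB m' y'"
  shows "m = m' \<and> y = y'"
proof -
  have m: "m < r" "m' < r" using assms by (auto simp: hiv_def)
  consider "star_hi m y" "star_hi m' y'" "turn (Suc m) = turn (Suc m')" |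
    "y = turn (Suc m)" "y' = turn (Suc m')" "turn (Suc m) = turn (Suc m')" |
    "\<not> star_hi m y" "\<not> star_hi m' y'" "y = y'"
  proof -
    have "codeB m y mod 3 = codeB m' y' mod 3" using assms(3) by simp
    then have "star_hi m y \<and> star_hi m' y' \<and> turn (Suc m) = turn (Suc m') \<or>
        y = turn (Suc m) \<and> y' = turn (Suc m') \<and> turn (Suc m) = turn (Suc m') \<or>
        \<not> star_hi m y \<and> \<not> star_hi m' y' \<and> y = y'"
      using assms(3) unfolding codeB_mod by (simp add: codeB_def split: if_split_asm)
    then show ?thesis using that by blast
  qed
  then show ?thesis
  proof cases
    case 1
    then show ?thesis using turn_inj[of "Suc m" "Suc m'"] m hiv_star assms by auto
  next
    case 2
    then show ?thesis using turn_inj[of "Suc m" "Suc m'"] m by auto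
  next
    case 3
    then have "hinode m y = hinode m' y'" by (simp add: hinode_def)
    then show ?thesis using hinode_inj[OF assms(1,2)] 3 by simp
  qed
qed

text \<open>A plain name \<open>i\<close> belongs to the two end edges of one short route and so to
  one leg; different legs can only share a name at the turning vertex between them.\<close>

lemma codeA_codeB:
  assumes lo: "lov m x" and hi: "hiv m' y" and eq: "codeA m x = codeB m' y" and ne: "m \<noteq> m'"
  shows "m = Suc m' \<and> link m' y m x"
proof -
  have m: "m < r" "m' < r" using assms by (auto simp: lov_def hiv_def)
  consider "star_lo m x" "y = turn (Suc m')" "turn m = turn (Suc m')" |
    "x = turn m" "star_hi m' y" "turn m = turn (Suc m')" |
    "\<not> star_lo m x" "\<not> star_hi m' y" "x = y" "x \<noteq> turn m \<or> m = 0"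
  proof -
    have "codeA m x mod 3 = codeB m' y mod 3" using eq by simp
    then have "star_lo m x \<and> y = turn (Suc m') \<and> turn m = turn (Suc m') \<or>
        x = turn m \<and> star_hi m' y \<and> turn m = turn (Suc m') \<or>
        \<not> star_lo m x \<and> \<not> star_hi m' y \<and> x = y \<and> (x \<noteq> turn m \<or> m = 0)"
      using eq unfolding codeA_mod codeB_mod by (simp add: codeA_def codeB_def split: if_split_asm)
    then show ?thesis using that by blast
  qed
  then show ?thesis
  proof cases
    case 1
    then show ?thesis using turn_inj[of m "Suc m'"] m by (auto simp: link_def)
  next
    case 2
    then show ?thesis using turn_inj[of m "Suc m'"] m by (auto simp: link_def)
  next
    case 3
    then have "vx y = x" using lov_vx lo by simp
    then have "lonode m x = hinode m' y" using 3 lov_vx[OF lo] by (simp add: lonode_def hinode_def)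
    then have "m = nxt m'" "x = turn m" "y = turn (Suc m')"
      using lonode_hinode[OF lo _ hi] 3 ne by auto
    then have "y = 1" "m = 0" using 3 by auto
    then have "turn (Suc m') = turn 0" using \<open>y = turn (Suc m')\<close> by simp
    then show ?thesis using turn_inj[of "Suc m'" 0] m by simp
  qed
qed

lemma codeA_less: "lov m x \<Longrightarrow> lov m x' \<Longrightarrow> codeA m x < codeA m x' \<longleftrightarrow> x < x'"
  by (auto simp: codeA_def lov_def star_lo_def)

lemma codeB_less: "hiv m y \<Longrightarrow> hiv m y' \<Longrightarrow> codeB m y < codeB m y' \<longleftrightarrow> y < y'"
  by (auto simp: codeB_def hiv_def star_hi_def)

lemma link_codes:
  assumes lo: "lov m x" and hi: "hiv m' y" and l: "link m' y m x" and m: "m = Suc m'"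
  shows "codeA m x = codeB m' y"
proof -
  have "m \<noteq> 0" "Suc m' \<noteq> r" using m lo by (auto simp: lov_def)
  then show ?thesis using l m by (auto simp: link_def codeA_def codeB_def star_lo_def star_hi_def)
qed

text \<open>A row is a source edge, which is the lower end on an even leg and the upper end on an
  odd one. So an even leg shares rows with its predecessor and an odd leg with its successor; for
  columns it is the reverse.\<close>

lemma same_row:
  assumes v: "valid m x y" and v': "valid m' x' y'"
  shows "urow m x y = urow m' x' y' \<longleftrightarrow>
    m = m' \<and> (if even m then x = x' else y = y') \<or>
    even m \<and> m = Suc m' \<and> link m' y' m x \<or> odd m \<and> m' = Suc m \<and> link m y m' x'"
proof -
  have lv: "lov m x" "lov m' x'" "hiv m y" "hiv m' y'" using v v' by (simp_all add: valid_def)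
  have AA: "codeA m x = codeA m' x' \<longleftrightarrow> m = m' \<and> x = x'" using codeA_inj lv by blast
  have BB: "codeB m y = codeB m' y' \<longleftrightarrow> m = m' \<and> y = y'" using codeB_inj lv by blast
  have AB: "codeA m x = codeB m' y' \<longleftrightarrow> m = Suc m' \<and> link m' y' m x" if "even m \<noteq> even m'"
    using codeA_codeB[OF lv(1,4)] link_codes[OF lv(1,4)] that by blast
  have BA: "codeB m y = codeA m' x' \<longleftrightarrow> m' = Suc m \<and> link m y m' x'" if "even m \<noteq> even m'"
    using codeA_codeB[OF lv(2,3)] link_codes[OF lv(2,3)] that by metis
  show ?thesis
  proof (cases "even m \<longleftrightarrow> even m'")
    case True
    then have "m \<noteq> Suc m'" "m' \<noteq> Suc m" by auto
    then show ?thesis using True by (simp add: urow_def AA BB)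
  next
    case False
    then have "m \<noteq> m'" by auto
    then show ?thesis using False by (cases "even m") (simp_all add: urow_def AB BA)
  qed
qed

lemma same_col:
  assumes v: "valid m x y" and v': "valid m' x' y'"
  shows "ucol m x y = ucol m' x' y' \<longleftrightarrow>
    m = m' \<and> (if even m then y = y' else x = x') \<or>
    odd m \<and> m = Suc m' \<and> link m' y' m x \<or> even m \<and> m' = Suc m \<and> link m y m' x'"
proof -
  have lv: "lov m x" "lov m' x'" "hiv m y" "hiv m' y'" using v v' by (simp_all add: valid_def)
  have AA: "codeA m x = codeA m' x' \<longleftrightarrow> m = m' \<and> x = x'" using codeA_inj lv by blast
  have BB: "codeB m y = codeB m' y' \<longleftrightarrow> m = m' \<and> y = y'" using codeB_inj lv by blast
  have AB: "codeA m x = codeB m' y' \<longleftrightarrow> m = Suc m' \<and> link m' y' m x" if "even m \<noteq> even m'"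
    using codeA_codeB[OF lv(1,4)] link_codes[OF lv(1,4)] that by blast
  have BA: "codeB m y = codeA m' x' \<longleftrightarrow> m' = Suc m \<and> link m y m' x'" if "even m \<noteq> even m'"
    using codeA_codeB[OF lv(2,3)] link_codes[OF lv(2,3)] that by metis
  show ?thesis
  proof (cases "even m \<longleftrightarrow> even m'")
    case True
    then have "m \<noteq> Suc m'" "m' \<noteq> Suc m" by auto
    then show ?thesis using True by (simp add: ucol_def AA BB)
  next
    case False
    then have "m \<noteq> m'" by auto
    then show ?thesis using False by (cases "even m") (simp_all add: ucol_def AB BA)
  qed
qed

text \<open>A shared row leads from a leg to its neighbour on one side and a shared column to its neighbour
  on the other side.  Without the identification in a cycle, the four corners of an array therefore
  lie on at most two legs.\<close>

lemma legs_around: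
  assumes "m = m1 \<or> even m \<and> m = Suc m1 \<or> odd m \<and> m1 = Suc m"
    and "m1 = m' \<or> odd m1 \<and> m1 = Suc m' \<or> even m1 \<and> m' = Suc m1"
    and "m' = m2 \<or> even m' \<and> m' = Suc m2 \<or> odd m' \<and> m2 = Suc m'"
    and "m2 = m \<or> odd m2 \<and> m2 = Suc m \<or> even m2 \<and> m = Suc m2"
  obtains "m1 = m" "m' = m" "m2 = m"
  | "m1 = m" "m2 = m'" "even m" "m' = Suc m" | "m1 = m" "m2 = m'" "odd m" "m = Suc m'"
  | "m1 = m'" "m2 = m" "even m" "m = Suc m'" | "m1 = m'" "m2 = m" "odd m" "m' = Suc m"
proof -
  have "m1 = m \<and> m' = m \<and> m2 = m \<or> m1 = m \<and> m2 = m' \<and> even m \<and> m' = Suc m \<or>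
      m1 = m \<and> m2 = m' \<and> odd m \<and> m = Suc m' \<or> m1 = m' \<and> m2 = m \<and> even m \<and> m = Suc m' \<or>
      m1 = m' \<and> m2 = m \<and> odd m \<and> m' = Suc m"
    using assms by (elim disjE; auto)
  then show ?thesis using that by blast
qed

text \<open>Two positions at each end and two legs: the eight anomalous routes.\<close>

definition anom :: "nat \<Rightarrow> nat \<Rightarrow> nat \<Rightarrow> bool" where
  "anom m x y \<longleftrightarrow> \<not> is_path K \<and> r = 2 \<and> x \<le> turn m \<and> turn (Suc m) \<le> y"

text \<open>On one leg the upper ends are exchanged. At a turn each route switches to the edge of
  its own long exceptional route, \<open>Suc y'\<close> and \<open>x - 1\<close> being the virtual
  positions. The pair is unordered because the parity of the legs decides which corner lies to the
  west.\<close>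

definition corners :: "nat \<Rightarrow> nat \<Rightarrow> nat \<Rightarrow> nat \<Rightarrow> nat \<Rightarrow> nat \<Rightarrow> route \<Rightarrow> route \<Rightarrow> bool" where
  "corners m' x' y' m x y T1 T2 \<longleftrightarrow>
     m = m' \<and> {T1, T2} = {rt m x y', rt m x' y} \<or>
     m = nxt m' \<and> x = turn m \<and> y' = turn (Suc m') \<and> {T1, T2} = {rt m' x' (Suc y'), rt m (x - 1) y}"

lemma nxt_Suc: "Suc m < r \<Longrightarrow> nxt m = Suc m"
  by (simp add: nxt_def)

lemma link_less_lo: "link m' y' m x1 \<Longrightarrow> link m' y m x \<Longrightarrow> x1 < x \<Longrightarrow> lov m x1 \<Longrightarrow> lov m x \<Longrightarrow>
   star_lo m x1 \<and> x = turn m \<and> y' = turn (Suc m') \<and> star_hi m' y"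
  by (auto simp: link_def star_lo_def lov_def)

lemma link_less_hi: "link m' y1 m x' \<Longrightarrow> link m' y m x \<Longrightarrow> y1 < y \<Longrightarrow> hiv m' y1 \<Longrightarrow> hiv m' y \<Longrightarrow>
   star_lo m x' \<and> x = turn m \<and> y1 = turn (Suc m') \<and> star_hi m' y"
  by (auto simp: link_def star_hi_def hiv_def)

text \<open>Neither row is continued across the seam. A single leg gives the interlacing intervals,
  two legs give the array around their turn, and two of the patterns contradict the order of the
  names.\<close>

lemma planar_NW:
  assumes v: "valid m x y" "valid m' x' y'" "valid m1 x1 y1" "valid m2 x2 y2"
    and 1: "urow m x y = urow m1 x1 y1" "ucol m1 x1 y1 < ucol m x y"
    and 2: "ucol m1 x1 y1 = ucol m' x' y'" "urow m' x' y' < urow m1 x1 y1"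
    and 3: "ucol m2 x2 y2 = ucol m x y" "urow m2 x2 y2 < urow m x y"
    and 4: "urow m' x' y' = urow m2 x2 y2" "ucol m' x' y' < ucol m2 x2 y2"
  shows "below m' x' y' m x y \<and> corners m' x' y' m x y (rt m1 x1 y1) (rt m2 x2 y2)"
proof -
  have lv: "lov m x" "lov m' x'" "lov m1 x1" "lov m2 x2" "hiv m y" "hiv m' y'" "hiv m1 y1" "hiv m2 y2"
    using v by (auto simp: valid_def)
  note e = 1(1)[unfolded same_row[OF v(1,3)]] 2(1)[unfolded same_col[OF v(3,2)]]
    4(1)[unfolded same_row[OF v(2,4)]] 3(1)[unfolded same_col[OF v(4,1)]]
  have "m = m1 \<or> even m \<and> m = Suc m1 \<or> odd m \<and> m1 = Suc m" using e(1) by blast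
  moreover have "m1 = m' \<or> odd m1 \<and> m1 = Suc m' \<or> even m1 \<and> m' = Suc m1" using e(2) by blast
  moreover have "m' = m2 \<or> even m' \<and> m' = Suc m2 \<or> odd m' \<and> m2 = Suc m'" using e(3) by blast
  moreover have "m2 = m \<or> odd m2 \<and> m2 = Suc m \<or> even m2 \<and> m = Suc m2" using e(4) by blast
  ultimately show ?thesis
  proof (rule legs_around)
    assume l: "m1 = m" "m' = m" "m2 = m"
    show ?thesis
    proof (cases "even m")
      case True
      then have "x1 = x" "y1 = y'" "x2 = x'" "y2 = y" using e l by auto
      moreover have "x' < x" "y' < y"
        using 1 2 3 4 True l codeA_less[of m x' x] codeB_less[of m y' y] lv calculation
        by (auto simp: urow_def ucol_def)
      ultimately show ?thesis using v(3) l by (auto simp: below_def corners_def valid_def)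
    next
      case False
      then have "y1 = y" "x1 = x'" "y2 = y'" "x2 = x" using e l by auto
      moreover have "x' < x" "y' < y"
        using 1 2 3 4 False l codeA_less[of m x' x] codeB_less[of m y' y] lv calculation
        by (auto simp: urow_def ucol_def)
      ultimately show ?thesis using v(4) l by (auto simp: below_def corners_def valid_def)
    qed
  next
    assume l: "m1 = m" "m2 = m'" "even m" "m' = Suc m"
    then show ?thesis
      using 2(2) codeA_less_codeB[of m m' x1 y'] lv by (simp add: urow_def)
  next
    assume l: "m1 = m" "m2 = m'" "odd m" "m = Suc m'"
    then have "y1 = y" "x2 = x'" "link m' y' m x1" "link m' y2 m x" using e by auto
    moreover have "x1 < x" using 1(2) l codeA_less[of m x1 x] lv by (simp add: ucol_def)
    ultimately have "x1 = turn m - 1" "x = turn m" "y' = turn (Suc m')" "y2 = Suc (turn (Suc m'))"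
      using link_less_lo[of m' y' m x1 y2 x] lv l lov_star[of m x1] hiv_star[of m' y2] by auto
    moreover have "m = nxt m'" using l lv nxt_Suc[of m'] by (simp add: lov_def)
    ultimately show ?thesis
      using l \<open>y1 = y\<close> \<open>x2 = x'\<close> by (auto simp: below_def corners_def)
  next
    assume l: "m1 = m'" "m2 = m" "even m" "m = Suc m'"
    then have "x1 = x'" "y2 = y" "link m' y1 m x" "link m' y' m x2" using e by auto
    moreover have "y' < y1" using 2(2) l codeB_less[of m' y' y1] lv by (simp add: urow_def)
    ultimately have "x2 = turn m - 1" "x = turn m" "y' = turn (Suc m')" "y1 = Suc (turn (Suc m'))"
      using link_less_hi[of m' y' m x2 y1 x] lv l lov_star[of m x2] hiv_star[of m' y1] by auto
    moreover have "m = nxt m'" using l lv nxt_Suc[of m'] by (simp add: lov_def)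
    ultimately show ?thesis
      using l \<open>y2 = y\<close> \<open>x1 = x'\<close> by (auto simp: below_def corners_def)
  next
    assume l: "m1 = m'" "m2 = m" "odd m" "m' = Suc m"
    then show ?thesis
      using 1(2) codeA_less_codeB[of m m' x y1] lv by (simp add: ucol_def)
  qed
qed

lemma planar_NE:
  assumes v: "valid m x y" "valid m' x' y'" "valid m1 x1 y1" "valid m2 x2 y2"
    and 1: "urow m x y = urow m1 x1 y1" "ucol m x y < ucol m1 x1 y1"
    and 2: "ucol m1 x1 y1 = ucol m' x' y'" "urow m' x' y' < urow m1 x1 y1"
    and 3: "ucol m2 x2 y2 = ucol m x y" "urow m2 x2 y2 < urow m x y"
    and 4: "urow m' x' y' = urow m2 x2 y2" "ucol m2 x2 y2 < ucol m' x' y'"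
  shows "m = m' \<and> (x' < x \<and> y < y' \<or> x < x' \<and> y' < y) \<or>
     m' = nxt m \<and> star_hi m y \<and> star_lo m' x' \<or> m = nxt m' \<and> star_hi m' y' \<and> star_lo m x"
proof -
  have lv: "lov m x" "lov m' x'" "lov m1 x1" "lov m2 x2" "hiv m y" "hiv m' y'" "hiv m1 y1" "hiv m2 y2"
    using v by (auto simp: valid_def)
  note e = 1(1)[unfolded same_row[OF v(1,3)]] 2(1)[unfolded same_col[OF v(3,2)]]
    4(1)[unfolded same_row[OF v(2,4)]] 3(1)[unfolded same_col[OF v(4,1)]]
  have "m = m1 \<or> even m \<and> m = Suc m1 \<or> odd m \<and> m1 = Suc m" using e(1) by blast
  moreover have "m1 = m' \<or> odd m1 \<and> m1 = Suc m' \<or> even m1 \<and> m' = Suc m1" using e(2) by blast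
  moreover have "m' = m2 \<or> even m' \<and> m' = Suc m2 \<or> odd m' \<and> m2 = Suc m'" using e(3) by blast
  moreover have "m2 = m \<or> odd m2 \<and> m2 = Suc m \<or> even m2 \<and> m = Suc m2" using e(4) by blast
  ultimately show ?thesis
  proof (rule legs_around)
    assume l: "m1 = m" "m' = m" "m2 = m"
    show ?thesis
    proof (cases "even m")
      case True
      then have "x1 = x" "y1 = y'" "x2 = x'" "y2 = y" using e l by auto
      moreover have "x' < x" "y < y'"
        using 1 2 3 4 True l codeA_less[of m x' x] codeB_less[of m y y'] lv calculation
        by (auto simp: urow_def ucol_def)
      ultimately show ?thesis using l by simp
    next
      case False
      then have "y1 = y" "x1 = x'" "y2 = y'" "x2 = x" using e l by auto
      moreover have "x < x'" "y' < y"
        using 1 2 3 4 False l codeA_less[of m x x'] codeB_less[of m y' y] lv calculation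
        by (auto simp: urow_def ucol_def)
      ultimately show ?thesis using l by simp
    qed
  next
    assume l: "m1 = m" "m2 = m'" "even m" "m' = Suc m"
    then show ?thesis
      using 2(2) codeA_less_codeB[of m m' x1 y'] lv by (simp add: urow_def)
  next
    assume l: "m1 = m" "m2 = m'" "odd m" "m = Suc m'"
    then have "link m' y' m x1" "link m' y2 m x" using e by auto
    moreover have "x < x1" using 1(2) l codeA_less[of m x x1] lv by (simp add: ucol_def)
    ultimately have "star_lo m x" "star_hi m' y'"
      using link_less_lo[of m' y2 m x y' x1] lv l by auto
    moreover have "m = nxt m'" using l lv nxt_Suc[of m'] by (simp add: lov_def)
    ultimately show ?thesis by simp
  next
    assume l: "m1 = m'" "m2 = m" "even m" "m = Suc m'"
    then show ?thesis
      using 1(2) codeA_less_codeB[of m' m x1 y] lv by (simp add: ucol_def)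
  next
    assume l: "m1 = m'" "m2 = m" "odd m" "m' = Suc m"
    then have "link m y m' x1" "link m y2 m' x'" using e by auto
    moreover have "x' < x1" using 2(2) l codeA_less[of m' x' x1] lv by (simp add: urow_def)
    ultimately have "star_lo m' x'" "star_hi m y"
      using link_less_lo[of m y2 m' x' y x1] lv l by auto
    moreover have "m' = nxt m" using l lv nxt_Suc[of m] by (simp add: lov_def)
    ultimately show ?thesis by simp
  qed
qed

text \<open>Apart from the seam, source edges at vertex 1 belong to leg 0 only: the source ends of
  odd legs are at higher positions.\<close>

lemma wrap_link:
  assumes v: "valid m x y" "valid m1 x1 y1" and w: "wraps m y" "\<not> wraps m1 y1"
    and u: "urow m x y = urow m1 x1 y1 + 3 * int N"
  shows "m1 = 0 \<and> link m y 0 x1"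
proof -
  have c: "\<not> is_path K" "turn (Suc m) \<le> y" using w by (auto simp: wraps_def)
  have u1: "urow m1 x1 y1 = (if star_hi m y then 4 else 2)"
    using u urow_bounds(1)[OF v(1) c(1) w(1)] by simp
  have lv: "lov m1 x1" "hiv m1 y1" "m1 < r" using v by (auto simp: valid_def lov_def)
  have ev: "even m1"
  proof (rule ccontr)
    assume o: "odd m1"
    then have "0 < m1" by (cases m1) auto
    then have "turn m1 \<ge> 2" using turn_less[of 0 m1] lv by simp
    then show False using u1 o codeB_ge[OF lv(2)] c by (auto simp: urow_def split: if_splits)
  qed
  show ?thesis
  proof (cases "star_hi m y")
    case True
    then have "x1 = turn m1" "turn m1 = 1" using u1 ev code_parity(2)[of m1 x1] lv by (auto simp: urow_def)
    then show ?thesis using turn_eq_1 lv True by (auto simp: link_def)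
  next
    case False
    then have "star_lo m1 x1" "turn m1 = 1" using u1 ev code_parity(1)[of m1 x1] lv by (auto simp: urow_def)
    then show ?thesis using turn_eq_1 lv False c by (auto simp: link_def star_hi_def)
  qed
qed

text \<open>A route of leg 1 in the same column has a larger row, so the upper route is on leg 0
  too.\<close>

lemma above_first_leg:
  assumes v: "valid 0 x y" "valid m2 x2 y2" and a: "ucol m2 x2 y2 = ucol 0 x y" "urow m2 x2 y2 < urow 0 x y"
  shows "m2 = 0 \<and> y2 = y \<and> x2 < x"
proof -
  have lv: "lov 0 x" "hiv m2 y2" "lov m2 x2" using v by (auto simp: valid_def)
  from a(1)[unfolded same_col[OF v(2,1)]] consider "m2 = 0" "y2 = y" | "odd m2" "m2 = 1" by auto
  then show ?thesis
  proof cases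
    case 1
    then show ?thesis using a(2) codeA_less[of 0 x2 x] lv by (simp add: urow_def)
  next
    case 2
    then show ?thesis using a(2) codeA_less_codeB[of 0 m2 x y2] lv by (simp add: urow_def)
  qed
qed

lemma link_hi_cases: "link m y m' x \<Longrightarrow> hiv m y \<Longrightarrow> y = turn (Suc m) \<or> y = Suc (turn (Suc m))"
  using hiv_star by (auto simp: link_def)

lemma link_lo_cases: "link m y m' x \<Longrightarrow> lov m' x \<Longrightarrow> x = turn m' - 1 \<or> x = turn m'"
  using lov_star by (auto simp: link_def)

text \<open>Split by which of the two horizontal relations crosses the seam. If neither does, the
  array is planar; if both do, it surrounds the turning vertex 1. If just one does, a column joins
  the last leg to leg 0, which forces two legs and makes both routes anomalous.\<close>

lemma NW_analysis:
  assumes v: "valid m x y" "valid m' x' y'" "valid m1 x1 y1" "valid m2 x2 y2"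
    and 1: "left_of K (rt m1 x1 y1) (rt m x y)" and 2: "above K (rt m' x' y') (rt m1 x1 y1)"
    and 3: "above K (rt m2 x2 y2) (rt m x y)" and 4: "left_of K (rt m' x' y') (rt m2 x2 y2)"
  shows "below m' x' y' m x y \<and>
    (anom m x y \<and> anom m' x' y' \<or> corners m' x' y' m x y (rt m1 x1 y1) (rt m2 x2 y2))"
proof -
  have lv: "lov m x" "lov m' x'" "lov m1 x1" "lov m2 x2" "hiv m y" "hiv m' y'" "hiv m1 y1" "hiv m2 y2"
    using v by (auto simp: valid_def)
  note a2 = 2[unfolded above_rt[OF v(2,3)]] and a3 = 3[unfolded above_rt[OF v(4,1)]]
  from 1[unfolded left_of_rt[OF v(3,1)]] show ?thesis
  proof
    assume p1: "urow m1 x1 y1 = urow m x y \<and> ucol m1 x1 y1 < ucol m x y"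
    from 4[unfolded left_of_rt[OF v(2,4)]] show ?thesis
    proof
      assume p4: "urow m' x' y' = urow m2 x2 y2 \<and> ucol m' x' y' < ucol m2 x2 y2"
      show ?thesis
        using planar_NW[OF v p1[THEN conjunct1, symmetric] p1[THEN conjunct2]
            a2[THEN conjunct1, symmetric] a2[THEN conjunct2] a3[THEN conjunct1] a3[THEN conjunct2]
            p4[THEN conjunct1] p4[THEN conjunct2]] by blast
    next
      assume w: "wraps m' y' \<and> \<not> wraps m2 y2 \<and> urow m' x' y' = urow m2 x2 y2 + 3 * int N"
      then have w': "wraps m' y'" "m2 = 0" "link m' y' 0 x2" using wrap_link[OF v(2,4)] by auto
      have c: "\<not> is_path K" "Suc m' = r" "odd m'" using w' wraps_odd by (auto simp: wraps_def)
      have "urow m1 x1 y1 > 3 * int N + 1" using a2 urow_bounds(1)[OF v(2) c(1) w'(1)] by (simp split: if_splits)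
      then have w1: "wraps m1 y1" "wraps m y"
        using urow_bounds(2)[OF v(3) c(1)] urow_bounds(2)[OF v(1) c(1)] p1 by linarith+
      then have mm: "m1 = m'" "m = m'" using c by (auto simp: wraps_def)
      have yy: "y1 = y" using p1[unfolded same_row[OF v(3,1)]] mm c by simp
      have xx: "x1 = x'" using a2[unfolded same_col[OF v(2,3)]] mm c by simp
      have "m' = 1" and l: "link 0 y2 m x"
        using a3[unfolded same_col[OF v(4,1)]] mm c w' by auto
      have "x' < x" using p1 codeA_less[of m' x' x] mm xx c lv by (simp add: ucol_def)
      moreover have "y' < y" using a2 codeB_less[of m' y' y] mm yy c lv by (simp add: urow_def)
      moreover have "turn (Suc m') \<le> y'" "y' \<ge> turn m" using w1 w' mm turn_Suc[of m'] c by (auto simp: wraps_def)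
      moreover have "x \<le> turn m" using link_lo_cases[OF l] lv by auto
      moreover have "r = 2" using c \<open>m' = 1\<close> by simp
      ultimately show ?thesis using c mm by (simp add: below_def anom_def numeral_2_eq_2)
    qed
  next
    assume w: "wraps m1 y1 \<and> \<not> wraps m y \<and> urow m1 x1 y1 = urow m x y + 3 * int N"
    then have w': "wraps m1 y1" "m = 0" "link m1 y1 0 x" using wrap_link[OF v(3,1)] by auto
    have c0: "\<not> is_path K" "Suc m1 = r" "odd m1" using w' wraps_odd[of m1 y1] by (auto simp: wraps_def)
    have "m1 \<noteq> 0" using c0(3) by (cases m1) auto
    note c = c0 this
    have t2: "m2 = 0" "y2 = y" "x2 < x" using above_first_leg[of x y m2 x2 y2] v a3 w' by auto
    have x: "x2 = turn 0 - 1" "x = turn 0" "star_lo 0 x2"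
      using link_lo_cases[OF w'(3)] lv t2 w' by (auto simp: lov_def star_lo_def)
    have y1: "star_hi m1 y1" "y1 = Suc (turn (Suc m1))"
      using w'(3) x hiv_star[OF lv(7)] by (auto simp: link_def star_lo_def)
    from 4[unfolded left_of_rt[OF v(2,4)]] show ?thesis
    proof
      assume p4: "urow m' x' y' = urow m2 x2 y2 \<and> ucol m' x' y' < ucol m2 x2 y2"
      then have m': "m' = 0" "x' = x2" using same_row[OF v(2,4)] t2 by auto
      then have "y' < y" using p4 t2 lv w' codeB_less[of 0 y' y] by (simp add: ucol_def)
      have "m1 = 1" and l: "link m' y' m1 x1" using a2[unfolded same_col[OF v(2,3)]] c m' by auto
      then have "r = 2" using c by simp
      moreover have "turn (Suc m') \<le> y'" using link_hi_cases[OF l lv(6)] by auto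
      moreover have "x \<le> y'" using x calculation turn_Suc[of 0] r_pos m' by simp
      ultimately show ?thesis using c m' w' t2 x \<open>y' < y\<close> by (simp add: below_def anom_def)
    next
      assume "wraps m' y' \<and> \<not> wraps m2 y2 \<and> urow m' x' y' = urow m2 x2 y2 + 3 * int N"
      then have w2: "wraps m' y'" "link m' y' 0 x2" using wrap_link[OF v(2,4)] by auto
      then have mm: "m' = m1" using c by (auto simp: wraps_def)
      then have "x1 = x'" using a2[unfolded same_col[OF v(2,3)]] c by simp
      have "y' = turn (Suc m')" using w2(2) x by (auto simp: link_def)
      moreover have "m = nxt m'" using c mm w' by (simp add: nxt_def)
      ultimately show ?thesis
        using w' x y1 t2 mm \<open>x1 = x'\<close> by (simp add: below_def corners_def)
    qed
  qed
qed

text \<open>The diagonal opposite to \<open>below\<close>: one interval inside the other, or routes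
  on neighbouring legs that both take their long exceptional edge at the common turn.\<close>

definition nested :: "nat \<Rightarrow> nat \<Rightarrow> nat \<Rightarrow> nat \<Rightarrow> nat \<Rightarrow> nat \<Rightarrow> bool" where
  "nested m' x' y' m x y \<longleftrightarrow> m = m' \<and> (x' < x \<and> y < y' \<or> x < x' \<and> y' < y) \<or>
     m' = nxt m \<and> star_hi m y \<and> star_lo m' x' \<or> m = nxt m' \<and> star_hi m' y' \<and> star_lo m x"

text \<open>As in \<open>NW_analysis\<close>, except that a crossing by the first relation already
  places both routes at the turning vertex 1; a crossing by the second alone forces two
  legs.\<close>

lemma NE_analysis:
  assumes v: "valid m x y" "valid m' x' y'" "valid m1 x1 y1" "valid m2 x2 y2"
    and 1: "left_of K (rt m x y) (rt m1 x1 y1)" and 2: "above K (rt m' x' y') (rt m1 x1 y1)"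
    and 3: "above K (rt m2 x2 y2) (rt m x y)" and 4: "left_of K (rt m2 x2 y2) (rt m' x' y')"
  shows "anom m x y \<and> anom m' x' y' \<or> nested m' x' y' m x y"
proof -
  have lv: "lov m x" "lov m' x'" "lov m1 x1" "lov m2 x2" "hiv m y" "hiv m' y'" "hiv m1 y1" "hiv m2 y2"
    using v by (auto simp: valid_def)
  note a2 = 2[unfolded above_rt[OF v(2,3)]] and a3 = 3[unfolded above_rt[OF v(4,1)]]
  from 1[unfolded left_of_rt[OF v(1,3)]] show ?thesis
  proof
    assume p1: "urow m x y = urow m1 x1 y1 \<and> ucol m x y < ucol m1 x1 y1"
    from 4[unfolded left_of_rt[OF v(4,2)]] show ?thesis
    proof
      assume p4: "urow m2 x2 y2 = urow m' x' y' \<and> ucol m2 x2 y2 < ucol m' x' y'"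
      show ?thesis
        using planar_NE[OF v p1[THEN conjunct1] p1[THEN conjunct2]
            a2[THEN conjunct1, symmetric] a2[THEN conjunct2] a3[THEN conjunct1] a3[THEN conjunct2]
            p4[THEN conjunct1, symmetric] p4[THEN conjunct2]] unfolding nested_def by blast
    next
      assume "wraps m2 y2 \<and> \<not> wraps m' y' \<and> urow m2 x2 y2 = urow m' x' y' + 3 * int N"
      then have w': "wraps m2 y2" "m' = 0" "link m2 y2 0 x'" using wrap_link[OF v(4,2)] by auto
      have c: "\<not> is_path K" "Suc m2 = r" "odd m2" using w' wraps_odd by (auto simp: wraps_def)
      have "urow m x y > 3 * int N + 1" using a3 urow_bounds(1)[OF v(4) c(1) w'(1)] by (simp split: if_splits)
      then have w1: "wraps m1 y1" "wraps m y"
        using urow_bounds(2)[OF v(3) c(1)] urow_bounds(2)[OF v(1) c(1)] p1 by linarith+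
      then have mm: "m1 = m2" "m = m2" using c by (auto simp: wraps_def)
      have l: "link m' y' m1 x1" and r: "r = 2"
        using a2[unfolded same_col[OF v(2,3)]] mm c w' by auto
      have "x < x1" using p1 codeA_less[of m2 x x1] mm c lv by (simp add: ucol_def)
      then have "x \<le> turn m" using link_lo_cases[OF l] lv mm by auto
      moreover have "turn (Suc m) \<le> y" using w1 unfolding wraps_def by blast
      moreover have "turn (Suc m') \<le> y'" using link_hi_cases[OF l lv(6)] by auto
      moreover have "x' \<le> turn m'" using link_lo_cases[OF w'(3)] lv w' by auto
      ultimately show ?thesis using c r by (simp add: anom_def)
    qed
  next
    assume "wraps m y \<and> \<not> wraps m1 y1 \<and> urow m x y = urow m1 x1 y1 + 3 * int N"
    then have w': "wraps m y" "m1 = 0" "link m y 0 x1" using wrap_link[OF v(1,3)] by auto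
    have c0: "\<not> is_path K" "Suc m = r" "odd m" using w' wraps_odd[of m y] by (auto simp: wraps_def)
    have "m \<noteq> 0" using c0(3) by (cases m) auto
    note c = c0 this
    have s: "m' = 0" "y' = y1" "x' < x1" using above_first_leg[of x1 y1 m' x' y'] v a2 w' by auto
    have x: "x' = turn 0 - 1" "x1 = turn 0" "star_lo 0 x'"
      using link_lo_cases[OF w'(3)] lv s w' by (auto simp: lov_def star_lo_def)
    have y: "star_hi m y" using w'(3) x by (auto simp: link_def star_lo_def)
    have "m' = nxt m" using c s by (simp add: nxt_def)
    then show ?thesis using x y s by (simp add: nested_def)
  qed
qed

section \<open>Construction of the corners\<close>

lemma left_of_same_leg:
  assumes "valid m x y" "valid m x' y'" "if even m then x = x' \<and> y < y' else y = y' \<and> x < x'"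
  shows "left_of K (rt m x y) (rt m x' y')"
  using assms codeA_less[of m x x'] codeB_less[of m y y']
  unfolding left_of_rt[OF assms(1,2)] by (auto simp: urow_def ucol_def valid_def split: if_splits)

lemma above_same_leg:
  assumes "valid m x y" "valid m x' y'" "if even m then y = y' \<and> x < x' else x = x' \<and> y < y'"
  shows "above K (rt m x y) (rt m x' y')"
  using assms codeA_less[of m x x'] codeB_less[of m y y']
  unfolding above_rt[OF assms(1,2)] by (auto simp: urow_def ucol_def valid_def split: if_splits)

text \<open>Above an even leg the two legs meet head to head, so the shared edge is a sink edge,
  that is, a column. The seam, above an odd leg, does not occur here.\<close>

lemma above_turn:
  assumes v: "valid m x y" "valid m' x' y'" and l: "m' = nxt m" "even m" "link m y m' x'"
  shows "above K (rt m x y) (rt m' x' y')"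
proof -
  have m: "m < r" "m' < r" using v by (auto simp: valid_def lov_def)
  have s: "m' = Suc m"
  proof (rule ccontr)
    assume "m' \<noteq> Suc m"
    then have "even m'" using l by (auto simp: nxt_def split: if_splits)
    then show False using nxt_parity[of m] m l by simp
  qed
  then have "odd m'" using l by simp
  then show ?thesis
    using link_codes[of m' x' m y] codeA_less_codeB[of m m' x y'] v l s
    unfolding above_rt[OF v] by (simp add: urow_def ucol_def valid_def)
qed

text \<open>The legs meet tail to tail and share a source edge. If the turn is vertex 1 of a cycle,
  the relation is the one across the identification.\<close>

lemma left_of_turn:
  assumes v: "valid m x y" "valid m' x' y'" and l: "m' = nxt m" "odd m" "link m y m' x'"
  shows "left_of K (rt m x y) (rt m' x' y')"
proof -
  have m: "m < r" "m' < r" using v by (auto simp: valid_def lov_def)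
  have ev: "even m'" using nxt_parity[of m] m l by simp
  show ?thesis
  proof (cases "m' = Suc m")
    case True
    then show ?thesis
      using link_codes[of m' x' m y] codeA_less_codeB[of m m' x y'] v l ev
      unfolding left_of_rt[OF v] by (simp add: urow_def ucol_def valid_def)
  next
    case False
    then have c: "\<not> is_path K" "Suc m = r" "m' = 0" using l by (auto simp: nxt_def split: if_splits)
    then have w: "wraps m y" using l(3) by (auto simp: link_def star_hi_def wraps_def)
    have w': "\<not> wraps m' y'" using wraps_odd ev by blast
    have "urow m' x' y' = (if star_hi m y then 4 else 2)"
      using l(3) c by (auto simp: link_def urow_def codeA_def star_lo_def star_hi_def)
    then show ?thesis
      using urow_bounds(1)[OF v(1) c(1) w] w w' unfolding left_of_rt[OF v] by simp
  qed
qed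

lemma turn_valid:
  assumes v: "valid m x y" and nx: "m = nxt m'" "m' < r"
  shows "x \<le> turn m \<Longrightarrow> valid m (turn m) y" "x \<le> turn m \<Longrightarrow> valid m (turn m - 1) y"
  using v nx turn_Suc[of m] turn_pos[of m]
  by (auto simp: valid_def lov_def hiv_def nxt_def split: if_splits)

lemma turn_valid':
  assumes v: "valid m' x' y'" and nx: "m = nxt m'" "m < r"
  shows "turn (Suc m') \<le> y' \<Longrightarrow> valid m' x' (turn (Suc m'))" "turn (Suc m') \<le> y' \<Longrightarrow> valid m' x' (Suc (turn (Suc m')))"
  using v nx turn_Suc[of m']
  by (auto simp: valid_def lov_def hiv_def nxt_def split: if_splits)

lemma NW_cornersI:
  assumes "valid m x y" "valid m' x' y'" "valid m1 x1 y1" "valid m2 x2 y2"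
    and "left_of K (rt m1 x1 y1) (rt m x y)" "above K (rt m' x' y') (rt m1 x1 y1)"
    and "above K (rt m2 x2 y2) (rt m x y)" "left_of K (rt m' x' y') (rt m2 x2 y2)"
  shows "rt m' x' y' \<in> regNW K (rt m x y)"
  using assms rt_route
  unfolding regNW_def NW_corners_def regW_def regS_def regN_def regE_def by blast

lemma NE_cornersI:
  assumes "valid m x y" "valid m' x' y'" "valid m1 x1 y1" "valid m2 x2 y2"
    and "left_of K (rt m x y) (rt m1 x1 y1)" "above K (rt m' x' y') (rt m1 x1 y1)"
    and "above K (rt m2 x2 y2) (rt m x y)" "left_of K (rt m2 x2 y2) (rt m' x' y')"
  shows "rt m' x' y' \<in> regNE K (rt m x y)"
  using assms rt_route
  unfolding regNE_def regW_def regS_def regN_def regE_def by blast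

lemma below_NW:
  assumes v: "valid m x y" "valid m' x' y'" and b: "below m' x' y' m x y"
  shows "rt m' x' y' \<in> regNW K (rt m x y)"
proof (cases "m = m' \<and> x' < x \<and> x \<le> y' \<and> y' < y")
  case True
  then have v': "valid m x y'" "valid m x' y" using v by (auto simp: valid_def)
  have v2: "valid m x' y'" using v True by simp
  show ?thesis
  proof (cases "even m")
    case ev: True
    have "rt m x' y' \<in> regNW K (rt m x y)"
      by (rule NW_cornersI[OF v(1) v2 v'])
        (use True ev left_of_same_leg above_same_leg v' v v2 in \<open>simp_all\<close>)
    then show ?thesis using True by simp
  next
    case od: False
    have "rt m x' y' \<in> regNW K (rt m x y)"
      by (rule NW_cornersI[OF v(1) v2 v'(2,1)])
        (use True od left_of_same_leg above_same_leg v' v v2 in \<open>simp_all\<close>)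
    then show ?thesis using True by simp
  qed
next
  case False
  then have *: "m = nxt m'" "x = turn m" "y' = turn (Suc m')" using b by (auto simp: below_def)
  have m: "m < r" "m' < r" using v by (auto simp: valid_def lov_def)
  have v': "valid m (turn m - 1) y" "valid m' x' (Suc (turn (Suc m')))"
    using turn_valid[OF v(1) *(1)] turn_valid'[OF v(2) *(1)] * m by auto
  have lk: "link m' y' m (turn m - 1)" "link m' (Suc (turn (Suc m'))) m x"
    using * turn_pos[of m] by (auto simp: link_def star_lo_def star_hi_def)
  have lt: "turn m - 1 < x" using * turn_pos[of m] by simp
  show ?thesis
  proof (cases "even m'")
    case ev: True
    then have od: "odd m" using nxt_parity[of m'] m * by simp
    show ?thesis
    proof (rule NW_cornersI[OF v v'])
      show "left_of K (rt m (turn m - 1) y) (rt m x y)"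
        using left_of_same_leg[OF v'(1) v(1)] od lt by simp
      show "above K (rt m' x' y') (rt m (turn m - 1) y)" using above_turn[OF v(2) v'(1) *(1) ev] lk by simp
      show "above K (rt m' x' (Suc (turn (Suc m')))) (rt m x y)" using above_turn[OF v'(2) v(1) *(1) ev] lk by simp
      show "left_of K (rt m' x' y') (rt m' x' (Suc (turn (Suc m'))))"
        using left_of_same_leg[OF v(2) v'(2)] ev * by simp
    qed
  next
    case od: False
    then have ev: "even m" using nxt_parity[of m'] m * by simp
    show ?thesis
    proof (rule NW_cornersI[OF v v'(2,1)])
      show "left_of K (rt m' x' (Suc (turn (Suc m')))) (rt m x y)" using left_of_turn[OF v'(2) v(1) *(1) od] lk by simp
      show "above K (rt m' x' y') (rt m' x' (Suc (turn (Suc m'))))"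
        using above_same_leg[OF v(2) v'(2)] od * by simp
      show "above K (rt m (turn m - 1) y) (rt m x y)"
        using above_same_leg[OF v'(1) v(1)] ev lt by simp
      show "left_of K (rt m' x' y') (rt m (turn m - 1) y)" using left_of_turn[OF v(2) v'(1) *(1) od] lk by simp
    qed
  qed
qed

text \<open>Which of the routes lies to the north-east depends on parity, because rows follow the
  lower ends on even legs and the upper ends on odd legs.\<close>

lemma nested_NE:
  assumes v: "valid m x y" "valid m' x' y'" and b: "m = m' \<and> x' < x \<and> y < y' \<or> m' = nxt m \<and> star_hi m y \<and> star_lo m' x'"
  shows "rt m' x' y' \<in> regNE K (rt m x y) \<or> rt m x y \<in> regNE K (rt m' x' y')"
proof (cases "m = m' \<and> x' < x \<and> y < y'")
  case True
  then have v': "valid m x y'" "valid m x' y" using v by (auto simp: valid_def)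
  have v2: "valid m x' y'" using v True by simp
  show ?thesis
  proof (cases "even m")
    case ev: True
    have "rt m x' y' \<in> regNE K (rt m x y)"
      by (rule NE_cornersI[OF v(1) v2 v'])
        (use True ev left_of_same_leg above_same_leg v' v v2 in \<open>simp_all\<close>)
    then show ?thesis using True by simp
  next
    case od: False
    have "rt m x y \<in> regNE K (rt m x' y')"
      by (rule NE_cornersI[OF v2 v(1) v'])
        (use True od left_of_same_leg above_same_leg v' v v2 in \<open>simp_all\<close>)
    then show ?thesis using True by simp
  qed
next
  case False
  then have *: "m' = nxt m" "star_hi m y" "star_lo m' x'" using b by auto
  have m: "m < r" "m' < r" using v by (auto simp: valid_def lov_def)
  have xy: "x' = turn m' - 1" "y = Suc (turn (Suc m))"
    using * v lov_star hiv_star by (auto simp: valid_def)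
  have v': "valid m' (turn m') y'" "valid m x (turn (Suc m))"
    using turn_valid[OF v(2) *(1)] turn_valid'[OF v(1) *(1)] xy m by auto
  have lk: "link m y m' (turn m')" "link m (turn (Suc m)) m' x'"
    using * by (auto simp: link_def)
  have lt: "x' < turn m'" "turn (Suc m) < y" using xy turn_pos[of m'] by auto
  show ?thesis
  proof (cases "even m")
    case ev: True
    then have od: "odd m'" using nxt_parity[of m] m * by simp
    have "rt m x y \<in> regNE K (rt m' x' y')"
    proof (rule NE_cornersI[OF v(2,1) v'])
      show "left_of K (rt m' x' y') (rt m' (turn m') y')"
        using left_of_same_leg[OF v(2) v'(1)] od lt by simp
      show "above K (rt m x y) (rt m' (turn m') y')" using above_turn[OF v(1) v'(1) *(1) ev] lk by simp
      show "above K (rt m x (turn (Suc m))) (rt m' x' y')" using above_turn[OF v'(2) v(2) *(1) ev] lk by simp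
      show "left_of K (rt m x (turn (Suc m))) (rt m x y)"
        using left_of_same_leg[OF v'(2) v(1)] ev lt by simp
    qed
    then show ?thesis ..
  next
    case od: False
    then have ev: "even m'" using nxt_parity[of m] m * by simp
    have "rt m' x' y' \<in> regNE K (rt m x y)"
    proof (rule NE_cornersI[OF v v'])
      show "left_of K (rt m x y) (rt m' (turn m') y')" using left_of_turn[OF v(1) v'(1) *(1) od] lk by simp
      show "above K (rt m' x' y') (rt m' (turn m') y')"
        using above_same_leg[OF v(2) v'(1)] ev lt by simp
      show "above K (rt m x (turn (Suc m))) (rt m x y)"
        using above_same_leg[OF v'(2) v(1)] od lt by simp
      show "left_of K (rt m x (turn (Suc m))) (rt m' x' y')" using left_of_turn[OF v'(2) v(2) *(1) od] lk by simp
    qed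
    then show ?thesis ..
  qed
qed

lemma regSE_iff: "R \<in> routes K \<Longrightarrow> S \<in> routes K \<Longrightarrow> S \<in> regSE K R \<longleftrightarrow> R \<in> regNW K S"
  unfolding regSE_def regNW_def NW_corners_def regW_def regS_def regN_def regE_def by blast

lemma regSW_iff: "R \<in> routes K \<Longrightarrow> S \<in> routes K \<Longrightarrow> S \<in> regSW K R \<longleftrightarrow> R \<in> regNE K S"
  unfolding regSW_def regNE_def regW_def regS_def regN_def regE_def by blast

lemma NW_corners_rt:
  assumes v: "valid m x y" "valid m' x' y'" and c: "NW_corners K (rt m x y) (rt m' x' y') T1 T2"
  shows "below m' x' y' m x y" "anom m x y \<and> anom m' x' y' \<or> corners m' x' y' m x y T1 T2"
proof -
  have T: "T1 \<in> routes K" "T2 \<in> routes K" "left_of K T1 (rt m x y)" "above K (rt m' x' y') T1"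
    "above K T2 (rt m x y)" "left_of K (rt m' x' y') T2"
    using c by (auto simp: NW_corners_def regW_def regS_def regN_def regE_def)
  obtain m1 x1 y1 where 1: "valid m1 x1 y1" "T1 = rt m1 x1 y1" using route_form T(1) by blast
  obtain m2 x2 y2 where 2: "valid m2 x2 y2" "T2 = rt m2 x2 y2" using route_form T(2) by blast
  show "below m' x' y' m x y" "anom m x y \<and> anom m' x' y' \<or> corners m' x' y' m x y T1 T2"
    using NW_analysis[OF v 1(1) 2(1)] T 1(2) 2(2) by simp_all
qed

lemma regNW_rt:
  assumes v: "valid m x y" "valid m' x' y'"
  shows "rt m' x' y' \<in> regNW K (rt m x y) \<longleftrightarrow> below m' x' y' m x y"
  using below_NW[OF v] NW_corners_rt(1)[OF v] unfolding regNW_def by blast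

lemma regNE_rt:
  assumes v: "valid m x y" "valid m' x' y'" and ne: "rt m' x' y' \<in> regNE K (rt m x y)"
  shows "anom m x y \<and> anom m' x' y' \<or> nested m' x' y' m x y"
proof -
  obtain T1 T2 where T: "T1 \<in> routes K" "T2 \<in> routes K" "left_of K (rt m x y) T1" "above K (rt m' x' y') T1"
    "above K T2 (rt m x y)" "left_of K T2 (rt m' x' y')"
    using ne by (auto simp: regNE_def regW_def regS_def regN_def regE_def)
  obtain m1 x1 y1 where 1: "valid m1 x1 y1" "T1 = rt m1 x1 y1" using route_form T(1) by blast
  obtain m2 x2 y2 where 2: "valid m2 x2 y2" "T2 = rt m2 x2 y2" using route_form T(2) by blast
  show ?thesis using NE_analysis[OF v 1(1) 2(1)] T 1(2) 2(2) by simp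
qed

lemma nested_sym: "nested m' x' y' m x y \<longleftrightarrow> nested m x y m' x' y'"
  by (auto simp: nested_def)

lemma NE_SW_rt:
  assumes v: "valid m x y" "valid m' x' y'"
  shows "rt m' x' y' \<in> regNE K (rt m x y) \<union> regSW K (rt m x y) \<Longrightarrow>
      anom m x y \<and> anom m' x' y' \<or> nested m' x' y' m x y"
    "nested m' x' y' m x y \<Longrightarrow> rt m' x' y' \<in> regNE K (rt m x y) \<union> regSW K (rt m x y)"
  using regNE_rt[OF v] regNE_rt[OF v(2,1)] nested_NE[OF v] nested_NE[OF v(2,1)] nested_sym
    regSW_iff[OF rt_route[OF v(1)] rt_route[OF v(2)]]
  by (auto simp: nested_def)

section \<open>Faces spanned by two routes\<close>

lemma two_leg_cycle: "(\<exists>k1 k2. K = Cycle [k1, k2]) \<longleftrightarrow> \<not> is_path K \<and> r = 2"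
proof (cases K)
  case (Cycle ks)
  then show ?thesis by (auto simp: is_path_def length_Suc_conv numeral_2_eq_2)
qed (auto simp: is_path_def)

lemma long_exceptional_valid: "m < r \<Longrightarrow> valid m (turn m - 1) (Suc (turn (Suc m)))"
  using turn_Suc[of m] turn_pos[of m] by (auto simp: valid_def lov_def hiv_def)

lemma lo_edge_turn:
  assumes "m = nxt m'" "m < r" "m' < r"
  shows "lo_edge m (turn m) = hi_edge m' (Suc (turn (Suc m')))" "hi_edge m' (turn (Suc m')) = lo_edge m (turn m - 1)"
  using assms nxt_parity[of m'] nxt_vx[of m'] turn_pos[of m]
  by (auto simp: lo_edge_def hi_edge_def lo_def hi_def)

lemma nxt_two: "\<not> is_path K \<Longrightarrow> r = 2 \<Longrightarrow> m < r \<Longrightarrow> m' < r \<Longrightarrow> m \<noteq> m' \<Longrightarrow> m = nxt m'"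
  by (auto simp: nxt_def)

text \<open>Legs that are neighbours at both ends exist only in a cycle of two legs; through this
  fact the exclusion of anomalous pairs takes effect.\<close>

lemma nxt_nxt:
  assumes "m = nxt m'" "m' = nxt m" "m < r" "m' < r" shows "\<not> is_path K \<and> r = 2"
  using assms cycle_r by (auto simp: nxt_def split: if_splits)

text \<open>With two legs, an end edge at a turning vertex is long exceptional for its own leg or,
  seen from there, for the other one. Conversely, long exceptional routes have their end edges at
  turning vertices only.\<close>

lemma anomalous_rt:
  assumes v: "valid m x y"
  shows "anomalous K (rt m x y) \<longleftrightarrow> anom m x y"
proof (cases "\<not> is_path K \<and> r = 2")
  case False
  then show ?thesis unfolding anomalous_def two_leg_cycle anom_def by blast
next
  case True
  define U where "U = (\<Union>L\<in>{L. long_exceptional K L}. set L)"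
  have lv: "lov m x" "hiv m y" and m: "m < r" using v by (auto simp: valid_def lov_def)
  have U: "e \<in> U \<longleftrightarrow> (\<exists>k<r. e \<in> set (rt k (turn k - 1) (Suc (turn (Suc k)))))" for e
  proof
    assume "e \<in> U"
    then obtain L where L: "long_exceptional K L" "e \<in> set L" by (auto simp: U_def)
    then have "L \<in> routes K" by (simp add: long_exceptional_def exceptional_def)
    then obtain k a b where k: "valid k a b" "L = rt k a b" using route_form by blast
    then have "star_lo k a" "star_hi k b" using L long_exceptional_rt by auto
    then have "a = turn k - 1" "b = Suc (turn (Suc k))" "k < r"
      using k lov_star hiv_star by (auto simp: valid_def lov_def)
    then show "\<exists>k<r. e \<in> set (rt k (turn k - 1) (Suc (turn (Suc k))))" using L k by blast
  next
    assume "\<exists>k<r. e \<in> set (rt k (turn k - 1) (Suc (turn (Suc k))))"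
    then obtain k where k: "k < r" "e \<in> set (rt k (turn k - 1) (Suc (turn (Suc k))))" by blast
    have "long_exceptional K (rt k (turn k - 1) (Suc (turn (Suc k))))"
      using long_exceptional_rt[OF long_exceptional_valid[OF k(1)]] turn_pos[of k]
      by (simp add: star_lo_def star_hi_def)
    then show "e \<in> U" using k by (auto simp: U_def)
  qed
  obtain m' where m': "m' < r" "m' \<noteq> m" using True by (metis One_nat_def less_2_cases_iff zero_neq_one)
  have nx: "m = nxt m'" "m' = nxt m" using nxt_two True m m' by blast+
  have ends: "edge_vertex e \<noteq> i" if "e \<in> U" "e = SourceEdge w l \<or> e = SinkEdge w l" "inleg m i" "turn m < i" for e w l i
  proof
    assume i: "edge_vertex e = i"
    obtain k where k: "k < r" "e \<in> set (rt k (turn k - 1) (Suc (turn (Suc k))))" using U \<open>e \<in> U\<close> by blast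
    then have "e = lo_edge k (turn k - 1) \<or> e = hi_edge k (Suc (turn (Suc k)))"
      using that(2) by (auto simp: set_rt)
    then have "i = turn k \<or> i = vx (turn (Suc k))"
      using i k edge_vertex_lo_hi by (auto simp: lo_def hi_def)
    then have "i \<in> {turn k, turn (Suc k), turn 0}" by (auto simp: vx_def split: if_splits)
    moreover have "k \<le> r" "Suc k \<le> r" "0 \<le> r" using k by simp_all
    ultimately obtain j where "j \<le> r" "i = turn j" by blast
    then show False using that(3,4) inleg_at_turn[of j m] by simp
  qed
  have "set (rt m x y) \<subseteq> U \<longleftrightarrow> x \<le> turn m \<and> turn (Suc m) \<le> y"
  proof
    assume s: "set (rt m x y) \<subseteq> U"
    then have e: "lo_edge m x \<in> U" "hi_edge m y \<in> U" by (auto simp: set_rt)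
    show "x \<le> turn m \<and> turn (Suc m) \<le> y"
    proof (rule ccontr)
      assume "\<not> (x \<le> turn m \<and> turn (Suc m) \<le> y)"
      then consider "turn m < x" | "y < turn (Suc m)" by linarith
      then show False
      proof cases
        case 1
        then have "inleg m x" using lv True by (auto simp: lov_def inleg_def)
        moreover have "edge_vertex (lo_edge m x) = x"
          using 1 calculation inleg_le by (simp add: edge_vertex_lo_hi lo_def)
        ultimately show False using ends[OF e(1)] 1 unfolding lo_edge_def by (metis (full_types))
      next
        case 2
        then have "inleg m y" "turn m < y" using lv True by (auto simp: hiv_def inleg_def)
        moreover have "edge_vertex (hi_edge m y) = y"
          using 2 calculation inleg_le by (simp add: edge_vertex_lo_hi hi_def)
        ultimately show False using ends[OF e(2)] unfolding hi_edge_def by (metis (full_types))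
      qed
    qed
  next
    assume xy: "x \<le> turn m \<and> turn (Suc m) \<le> y"
    have star: "lo_edge k (turn k - 1) \<in> U" "hi_edge k (Suc (turn (Suc k))) \<in> U"
      "inleg k i \<Longrightarrow> InnerEdge i \<in> U" if "k < r" for k i
      using that U turn_pos[of k] by (auto simp: set_rt lo_def hi_def inleg_def)
    have "x = turn m - 1 \<or> x = turn m" "y = turn (Suc m) \<or> y = Suc (turn (Suc m))"
      using xy lv by (auto simp: lov_def hiv_def)
    then have "lo_edge m x \<in> U" "hi_edge m y \<in> U"
      using star[OF m] star[OF m'(1)] lo_edge_turn(1)[OF nx(1) m m'(1)] lo_edge_turn(2)[OF nx(2) m'(1) m] by auto
    then show "set (rt m x y) \<subseteq> U"
      using star(3)[OF m] inleg_between[OF v] by (auto simp: set_rt)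
  qed
  then show ?thesis
    using True rt_route[OF v] unfolding anomalous_def two_leg_cycle anom_def U_def by blast
qed

section \<open>The digraph of the framed DAG and its root polytope\<close>

definition arc_set :: "(nat \<times> nat) set" where
  "arc_set = {(lonode m x, hinode m y) | m x y. valid m x y}"

lemma arc_setI: "valid m x y \<Longrightarrow> (lonode m x, hinode m y) \<in> arc_set"
  by (auto simp: arc_set_def)

text \<open>A nonzero node is a lower end at one position of one leg only, so all arcs leaving it
  come from there.\<close>

lemma out_arc:
  assumes "lov m x" "\<not> star_lo m x" "(lonode m x, w) \<in> arc_set"
  obtains y where "valid m x y" "w = hinode m y"
proof -
  obtain m' x' y where v: "valid m' x' y" "lonode m x = lonode m' x'" "w = hinode m' y"
    using assms(3) by (auto simp: arc_set_def)
  then have "m = m' \<and> x = x'" using lonode_inj[OF assms(1) _ v(2) assms(2)] by (simp add: valid_def)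
  then show ?thesis using that v by auto
qed

lemma in_arc:
  assumes "hiv m y" "\<not> star_hi m y" "(w, hinode m y) \<in> arc_set"
  obtains x where "valid m x y" "w = lonode m x"
proof -
  obtain m' x y' where v: "valid m' x y'" "hinode m y = hinode m' y'" "w = lonode m' x"
    using assms(3) by (auto simp: arc_set_def)
  then have "m = m' \<and> y = y'" using hinode_inj[OF assms(1) _ v(2) assms(2)] by (simp add: valid_def)
  then show ?thesis using that v by auto
qed

text \<open>Every vertex is a real upper and a real lower position on some leg; the virtual position
  at the opposite end of that leg supplies the node 0.\<close>

lemma star_arcs:
  assumes "w \<in> {1..n}" shows "(0, w) \<in> arc_set \<and> (w, 0) \<in> arc_set"
proof
  have w: "1 \<le> w" "w \<le> n" using assms by auto
  have vw: "vx w = w" using w n_eq by (auto simp: vx_def split: if_splits)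
  have pv: "valid m (turn m - 1) y \<longleftrightarrow> hiv m y" for m y
    using turn_pos[of m] turn_Suc[of m] by (auto simp: valid_def lov_def hiv_def)
  have st: "star_lo m (turn m - 1)" "star_hi m (Suc (turn (Suc m)))" for m
    using turn_pos[of m] by (auto simp: star_lo_def star_hi_def)
  have "\<exists>m y. hiv m y \<and> \<not> star_hi m y \<and> vx y = w"
  proof (cases "w = 1")
    case True
    show ?thesis
    proof (cases "is_path K")
      case p: True
      then have "hiv 0 1" "\<not> star_hi 0 1" using r_pos turn_Suc[of 0] by (auto simp: hiv_def star_hi_def)
      then show ?thesis using vw True by blast
    next
      case False
      \<comment> \<open>In a cycle vertex 1 is an upper position only as
        \<open>Suc N\<close>.\<close>
      have "hiv (r - 1) (Suc N)" "\<not> star_hi (r - 1) (Suc N)"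
        using r_pos turn_r turn_less_N[of "r - 1"] by (auto simp: hiv_def star_hi_def)
      then show ?thesis using False True by (metis vx_def)
    qed
  next
    case False
    then obtain z where z: "w = Suc z" "1 \<le> z" "z \<le> N" using w n_eq by (cases w) (auto split: if_splits)
    then obtain m where "inleg m z" using inleg_ex by blast
    then have "hiv m w" "\<not> star_hi m w" using z by (auto simp: inleg_def hiv_def star_hi_def)
    then show ?thesis using vw by blast
  qed
  then obtain m y where "hiv m y" "\<not> star_hi m y" "vx y = w" by blast
  then show "(0, w) \<in> arc_set"
    using arc_setI[of m "turn m - 1" y] pv st by (simp add: lonode_def hinode_def)
  have "\<exists>m. lov m w \<and> \<not> star_lo m w"
  proof (cases "w \<le> N")
    case True
    then obtain m where "inleg m w" using inleg_ex w by blast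
    then show ?thesis by (auto simp: inleg_def lov_def star_lo_def)
  next
    case False
    then have "is_path K" "w = Suc N" using w n_eq by (auto split: if_splits)
    then have "lov (r - 1) w" "\<not> star_lo (r - 1) w"
      using r_pos turn_r turn_less_N[of "r - 1"] by (auto simp: lov_def star_lo_def)
    then show ?thesis by blast
  qed
  then obtain k where k: "lov k w" "\<not> star_lo k w" by blast
  then have "valid k w (Suc (turn (Suc k)))"
    using turn_Suc[of k] by (auto simp: valid_def lov_def hiv_def)
  then show "(w, 0) \<in> arc_set"
    using arc_setI[of k w "Suc (turn (Suc k))"] k st vw by (simp add: lonode_def hinode_def)
qed

lemma n_ge_2: "2 \<le> n"
proof (cases "is_path K")
  case True
  then show ?thesis using n_eq turn_less_N[of 0] r_pos by simp
next
  case False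
  then show ?thesis using n_eq turn_less[of 0 1] turn_less_N[of 1] cycle_r by simp
qed

end

locale lab_polytope = lab_framing +
  fixes vtx :: "'n::finite \<Rightarrow> nat"
  assumes vtx_bij: "bij_betw vtx UNIV {1..num_inner K}"

sublocale lab_polytope \<subseteq> root_polytope vtx "num_inner K" arc_set
  by unfold_locales
    (use vtx_bij star_arcs n_ge_2 lonode_le hinode_le in \<open>auto simp: arc_set_def valid_def\<close>)

context lab_polytope begin

definition arc :: "nat \<Rightarrow> nat \<Rightarrow> nat \<Rightarrow> nat \<times> nat" where "arc m x y = (lonode m x, hinode m y)"

lemma gvec_arc: "valid m x y \<Longrightarrow> gvec vtx K (rt m x y) = g (arc m x y)"
  using gvec_rt vtx_bij by (simp add: arc_def)

lemma arc_in: "valid m x y \<Longrightarrow> arc m x y \<in> arc_set"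
  using arc_setI by (simp add: arc_def)

lemma gpolytope_eq: "gpolytope vtx K = P"
proof -
  have "gvec vtx K ` routes K = g ` arc_set"
  proof
    show "gvec vtx K ` routes K \<subseteq> g ` arc_set"
    proof
      fix z assume "z \<in> gvec vtx K ` routes K"
      then obtain R where R: "R \<in> routes K" "z = gvec vtx K R" by blast
      obtain m x y where "valid m x y" "R = rt m x y" using route_form R(1) by blast
      then show "z \<in> g ` arc_set" using R gvec_arc arc_in by auto
    qed
    show "g ` arc_set \<subseteq> gvec vtx K ` routes K"
    proof
      fix z assume "z \<in> g ` arc_set"
      then obtain m x y where "valid m x y" "z = g (arc m x y)" by (auto simp: arc_set_def arc_def)
      then show "z \<in> gvec vtx K ` routes K" using gvec_arc rt_route by force
    qed
  qed
  then show ?thesis by (simp add: gpolytope_def P_def)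
qed

lemma exceptional_arc: "valid m x y \<Longrightarrow> exceptional K (rt m x y) \<longleftrightarrow> fst (arc m x y) = snd (arc m x y)"
  using lonode_eq_hinode by (simp add: arc_def)

lemma exceptional_zero: "valid m x y \<Longrightarrow> exceptional K (rt m x y) \<Longrightarrow> g (arc m x y) = 0"
  using exceptional_arc by (simp add: arc_vec_def)

lemma sum_same_leg: "g (arc m x y) + g (arc m x' y') = g (arc m x y') + g (arc m x' y)"
  by (simp add: arc_def arc_vec_def)

lemma turn_node:
  assumes "m = nxt m'" "m < r" "m' < r"
  shows "hinode m' (turn (Suc m')) = turn m" "lonode m (turn m) = turn m"
    "hinode m' (Suc (turn (Suc m'))) = 0" "lonode m (turn m - 1) = 0"
  using nxt_vx[of m'] assms turn_pos[of m] by (auto simp: hinode_def lonode_def star_hi_def star_lo_def)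

lemma sum_turn:
  assumes "m = nxt m'" "m < r" "m' < r"
  shows "g (arc m (turn m) y) + g (arc m' x' (turn (Suc m'))) =
    g (arc m' x' (Suc (turn (Suc m')))) + g (arc m (turn m - 1) y)"
  using turn_node[OF assms] by (simp add: arc_def arc_vec_def)

lemma below_not_exceptional:
  assumes v: "valid m x y" "valid m' x' y'" and b: "below m' x' y' m x y"
  shows "\<not> exceptional K (rt m x y)" "\<not> exceptional K (rt m' x' y')"
proof -
  from b have "\<not> star_lo m x \<and> \<not> star_hi m' y' \<and> x \<noteq> y \<and> x' \<noteq> y'"
    using v by (auto simp: below_def valid_def lov_def hiv_def star_lo_def star_hi_def nxt_def split: if_splits)
  then show "\<not> exceptional K (rt m x y)" "\<not> exceptional K (rt m' x' y')"
    using exceptional_rt[OF v(1)] exceptional_rt[OF v(2)] by auto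
qed

text \<open>Node 0 does not reveal the leg, but a nonexceptional route has a nonzero end node, which
  does. An end at 0 is then the unique virtual position on that side of the leg.\<close>

lemma arc_inj:
  assumes v: "valid m x y" "valid m' x' y'" and ne: "\<not> exceptional K (rt m x y)"
    and eq: "arc m x y = arc m' x' y'"
  shows "m = m' \<and> x = x' \<and> y = y'"
proof -
  have lv: "lov m x" "lov m' x'" "hiv m y" "hiv m' y'" using v by (auto simp: valid_def)
  have e: "lonode m x = lonode m' x'" "hinode m y = hinode m' y'" using eq by (auto simp: arc_def)
  have star: "star_lo m x \<longleftrightarrow> star_lo m' x'" "star_hi m y \<longleftrightarrow> star_hi m' y'"
    using e node_pos lv by metis+
  show ?thesis
  proof (cases "star_lo m x")
    case False
    then have *: "m = m'" "x = x'" using lonode_inj lv e by auto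
    moreover have "y = y'"
    proof (cases "star_hi m y")
      case True
      then show ?thesis using star hiv_star lv * by auto
    qed (use hinode_inj lv e in auto)
    ultimately show ?thesis by simp
  next
    case True
    then have "\<not> star_hi m y" using ne exceptional_rt[OF v(1)] by auto
    then have "m = m'" "y = y'" using hinode_inj lv e by auto
    then show ?thesis using True star lov_star lv by auto
  qed
qed

text \<open>If no array is subtended, then 0 is the only intermediate node of a two-step walk between
  the outer end nodes, and the potential of \<open>face_two_step\<close> for \<open>z = 0\<close> singles out the two routes.\<close>

lemma face_consecutive:
  assumes v: "valid m x y" "valid m' x' y'"
    and ne: "\<not> exceptional K (rt m x y)" "\<not> exceptional K (rt m' x' y')"
    and nb: "\<not> below m' x' y' m x y" "\<not> below m x y m' x' y'" and nn: "\<not> nested m' x' y' m x y"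
    and eq: "hinode m y = lonode m' x'"
  shows "convex hull (g ` {arc m x y, arc m' x' y'}) face_of P"
proof -
  have lv: "lov m x" "lov m' x'" "hiv m y" "hiv m' y'" "x \<le> y" "x' \<le> y'" using v by (auto simp: valid_def)
  have xy: "x \<noteq> y" "x' \<noteq> y'" using ne exceptional_rt v by auto
  show ?thesis
  proof (cases "star_hi m y")
    case False
    then have "\<not> star_lo m' x'" using eq node_pos lv by metis
    then have "m' = m \<and> x' = y \<or> m' = nxt m \<and> x' = turn m' \<and> y = turn (Suc m)"
      using lonode_hinode[OF lv(2) _ lv(3) False] eq by auto
    then have "below m x y m' x' y'" using lv xy by (auto simp: below_def)
    then show ?thesis using nb by simp
  next
    case sy: True
    then have sx: "star_lo m' x'" using eq node_pos lv by metis
    have nsx: "\<not> star_lo m x" and nsy: "\<not> star_hi m' y'"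
      using ne exceptional_rt v sx sy by auto
    have zero: "hinode m y = 0" "lonode m' x' = 0" using sx sy by (simp_all add: hinode_def lonode_def)
    have nm: "m' \<noteq> nxt m" using nn sx sy by (auto simp: nested_def)
    \<comment> \<open>On a common leg \<open>x'\<close> and \<open>y\<close> are the two virtual
      positions, so \<open>x \<le> y'\<close> would make the intervals interlace.\<close>
    have cross: "\<not> (m = m' \<and> x \<le> y')"
    proof
      assume c: "m = m' \<and> x \<le> y'"
      then have "x' < x" "y' < y" using sx sy nsx nsy by (auto simp: star_lo_def star_hi_def)
      then show False using nb c by (simp add: below_def)
    qed
    have "lonode m x \<noteq> hinode m' y'"
    proof
      assume "lonode m x = hinode m' y'"
      then have "m = m' \<and> x = y' \<or> m = nxt m' \<and> x = turn m \<and> y' = turn (Suc m')"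
        using lonode_hinode[OF lv(1) nsx lv(4) nsy] by simp
      then show False using cross nb by (auto simp: below_def)
    qed
    moreover have "(lonode m x, hinode m' y') \<notin> arc_set"
    proof
      assume "(lonode m x, hinode m' y') \<in> arc_set"
      then obtain y2 where y2: "valid m x y2" "hinode m' y' = hinode m y2"
        using out_arc[OF lv(1) nsx] by metis
      then have "m' = m \<and> y' = y2" using hinode_inj[OF lv(4) _ y2(2) nsy] by (simp add: valid_def)
      then show False using cross y2(1) by (auto simp: valid_def)
    qed
    \<comment> \<open>Any other intermediate node is upper on \<open>m\<close> and lower on
      \<open>m'\<close>, hence on a common leg or at the turn from \<open>m\<close> to
      \<open>m'\<close>; both are excluded.\<close>
    moreover have mid: "w = 0" if w: "(lonode m x, w) \<in> arc_set" "(w, hinode m' y') \<in> arc_set" for w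
    proof (rule ccontr)
      assume "w \<noteq> 0"
      obtain yw where yw: "valid m x yw" "w = hinode m yw" using out_arc[OF lv(1) nsx w(1)] by blast
      obtain xw where xw: "valid m' xw y'" "w = lonode m' xw" using in_arc[OF lv(4) nsy w(2)] by blast
      have "\<not> star_lo m' xw" "\<not> star_hi m yw"
        using \<open>w \<noteq> 0\<close> xw(2) yw(2) by (auto simp: lonode_def hinode_def)
      then have "m' = m \<and> xw = yw \<or> m' = nxt m"
        using lonode_hinode[of m' xw m yw] xw yw by (auto simp: valid_def)
      then show False using nm cross xw(1) yw(1) by (auto simp: valid_def)
    qed
    moreover have "lonode m x \<noteq> 0" "hinode m' y' \<noteq> 0" using node_pos lv nsx nsy by auto
    moreover have "(lonode m x, 0) \<in> arc_set" "(0, hinode m' y') \<in> arc_set"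
      using arc_setI[OF v(1)] arc_setI[OF v(2)] zero by auto
    ultimately have "convex hull (g ` {(lonode m x, 0), (0, hinode m' y'), (lonode m x, 0), (0, hinode m' y')}) face_of P"
      by (intro face_two_step) auto
    then show ?thesis by (simp add: arc_def zero insert_commute)
  qed
qed

text \<open>A common tail or head gives an edge at once, and head meeting tail is
  \<open>face_consecutive\<close>. Otherwise one of the exchanged arcs is missing: if both existed,
  the intervals would share a leg and be \<open>below\<close> or \<open>nested\<close>.\<close>

lemma face_unrelated:
  assumes v: "valid m x y" "valid m' x' y'"
    and ne: "\<not> exceptional K (rt m x y)" "\<not> exceptional K (rt m' x' y')"
    and nb: "\<not> below m' x' y' m x y" "\<not> below m x y m' x' y'" and nn: "\<not> nested m' x' y' m x y"
    and neq: "rt m x y \<noteq> rt m' x' y'"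
  shows "convex hull (g ` {arc m x y, arc m' x' y'}) face_of P"
proof -
  define a b c d where abcd: "a = lonode m x" "b = hinode m y" "c = lonode m' x'" "d = hinode m' y'"
  have lv: "lov m x" "lov m' x'" "hiv m y" "hiv m' y'" using v by (auto simp: valid_def)
  have D: "(a, b) \<in> arc_set" "(c, d) \<in> arc_set" using arc_setI v by (auto simp: abcd)
  have ab: "a \<noteq> b" "c \<noteq> d" using ne exceptional_arc v by (auto simp: abcd arc_def)
  have eq: "arc m x y = (a, b)" "arc m' x' y' = (c, d)" by (simp_all add: arc_def abcd)
  have nd: "(a, b) \<noteq> (c, d)"
    using arc_inj[OF v ne(1)] eq neq by auto
  consider "a = c" | "b = d" | "b = c" | "d = a" | "a \<noteq> c" "b \<noteq> d" "b \<noteq> c" "a \<noteq> d" by blast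
  then show ?thesis
  proof cases
    case 1
    then show ?thesis using edge_common_tail[of a b d] D ab eq by auto
  next
    case 2
    then show ?thesis using edge_common_head[of a b c] D ab eq by auto
  next
    case 3
    then show ?thesis using face_consecutive[OF v ne nb nn] abcd by simp
  next
    case 4
    then show ?thesis
      using face_consecutive[OF v(2,1) ne(2,1) nb(2,1)] nn nested_sym[of m x y m' x' y'] abcd
      by (simp add: insert_commute)
  next
    case 5
    have star: "a = 0 \<longleftrightarrow> star_lo m x" "b = 0 \<longleftrightarrow> star_hi m y" "c = 0 \<longleftrightarrow> star_lo m' x'" "d = 0 \<longleftrightarrow> star_hi m' y'"
      using node_pos lv by (auto simp: abcd)
    have "\<not> ((a, d) \<in> arc_set \<and> (c, b) \<in> arc_set)"
    proof
      assume D': "(a, d) \<in> arc_set \<and> (c, b) \<in> arc_set"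
      have ad: "m = m' \<and> x \<le> y'" if nz: "a \<noteq> 0" "d \<noteq> 0"
      proof -
        have "(lonode m x, d) \<in> arc_set" "\<not> star_lo m x" using D' nz star by (auto simp: abcd)
        then obtain y2 where y2: "valid m x y2" "d = hinode m y2"
          using out_arc[OF lv(1)] by blast
        have "\<not> star_hi m' y'" "hinode m' y' = hinode m y2" using nz(2) star(4) y2(2) abcd(4) by (blast, simp)
        then have "m' = m" "y' = y2"
          using hinode_inj[OF lv(4), of m y2] y2(1) by (simp_all add: valid_def)
        then show ?thesis using y2(1) by (simp add: valid_def)
      qed
      have cb: "m = m' \<and> x' \<le> y" if nz: "c \<noteq> 0" "b \<noteq> 0"
      proof -
        have "(lonode m' x', b) \<in> arc_set" "\<not> star_lo m' x'" using D' nz star by (auto simp: abcd)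
        then obtain y2 where y2: "valid m' x' y2" "b = hinode m' y2"
          using out_arc[OF lv(2)] by blast
        have "\<not> star_hi m y" "hinode m y = hinode m' y2" using nz(2) star(2) y2(2) abcd(2) by (blast, simp)
        then have "m = m'" "y = y2"
          using hinode_inj[OF lv(3), of m' y2] y2(1) by (simp_all add: valid_def)
        then show ?thesis using y2(1) by (simp add: valid_def)
      qed
      \<comment> \<open>The four nodes are distinct, so at most one is 0; one of the exchanged arcs
        has two nonzero ends and ties the legs together.\<close>
      have mm: "m = m'" using ad cb 5 ab by metis
      have t: "turn m < turn (Suc m)" using lv turn_Suc by (simp add: lov_def)
      \<comment> \<open>A virtual position at either end makes the inequality automatic.\<close>
      have star_le: "u \<le> w" if "lov m u" "hiv m w" "star_lo m u \<or> star_hi m w" for u w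
        using that t by (auto simp: lov_def hiv_def star_lo_def star_hi_def)
      have le: "x \<le> y'"
        using ad star_le[of x y'] star(1,4) lv(1,4) unfolding mm by blast
      have le': "x' \<le> y"
        using cb star_le[of x' y] star(2,3) lv(2,3) unfolding mm by blast
      have "x \<noteq> x'" "y \<noteq> y'" using 5(1,2) unfolding abcd mm by blast+
      then consider "x' < x" "y' < y" | "x < x'" "y < y'" | "x' < x \<and> y < y' \<or> x < x' \<and> y' < y"
        by linarith
      then show False
      proof cases
        case 1
        then have "below m' x' y' m x y" unfolding below_def using mm le by blast
        then show False using nb by blast
      next
        case 2
        then have "below m x y m' x' y'" unfolding below_def using mm le' by blast
        then show False using nb by blast
      next
        case 3
        then have "nested m' x' y' m x y" unfolding nested_def using mm by blast
        then show False using nn by blast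
      qed
    qed
    then consider "(c, b) \<notin> arc_set" | "(a, d) \<notin> arc_set" by blast
    then show ?thesis
    proof cases
      case 1
      then show ?thesis using edge_missing_corner[of a b c d] D ab 5 eq by auto
    next
      case 2
      have "convex hull (g ` {(c, d), (a, b)}) face_of P"
        using edge_missing_corner[of c d a b] D ab 5 2 by auto
      then show ?thesis by (simp add: eq insert_commute)
    qed
  qed
qed

text \<open>On one leg the four arcs are the square of \<open>face_crossing\<close>. At a turn the
  two routes form a walk of two steps through its node and the corners form the walk through 0, so
  \<open>face_two_step\<close> applies.\<close>

lemma below_corners:
  assumes v: "valid m x y" "valid m' x' y'" and b: "below m' x' y' m x y"
    and c: "corners m' x' y' m x y T1 T2" and na: "\<not> (anom m x y \<and> anom m' x' y')"
  shows "\<exists>t1 t2. t1 \<in> arc_set \<and> t2 \<in> arc_set \<and> gvec vtx K T1 = g t1 \<and> gvec vtx K T2 = g t2 \<and>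
    g (arc m x y) + g (arc m' x' y') = g t1 + g t2 \<and>
    (exceptional K T1 \<longleftrightarrow> fst t1 = snd t1) \<and> (exceptional K T2 \<longleftrightarrow> fst t2 = snd t2) \<and>
    (fst t1 \<noteq> snd t1 \<and> fst t2 \<noteq> snd t2 \<longrightarrow>
      convex hull (g ` {arc m x y, arc m' x' y', t1, t2}) face_of P)"
proof -
  define ok where "ok T1 T2 t1 t2 \<longleftrightarrow> t1 \<in> arc_set \<and> t2 \<in> arc_set \<and> gvec vtx K T1 = g t1 \<and> gvec vtx K T2 = g t2 \<and>
    g (arc m x y) + g (arc m' x' y') = g t1 + g t2 \<and>
    (exceptional K T1 \<longleftrightarrow> fst t1 = snd t1) \<and> (exceptional K T2 \<longleftrightarrow> fst t2 = snd t2) \<and>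
    (fst t1 \<noteq> snd t1 \<and> fst t2 \<noteq> snd t2 \<longrightarrow>
      convex hull (g ` {arc m x y, arc m' x' y', t1, t2}) face_of P)" for T1 T2 t1 t2
  have ok_swap: "ok T2 T1 t2 t1" if "ok T1 T2 t1 t2" for T1 T2 t1 t2
    using that by (auto simp: ok_def insert_commute add.commute)
  have lv: "lov m x" "lov m' x'" "hiv m y" "hiv m' y'" "m < r" "m' < r" using v by (auto simp: valid_def lov_def)
  have ne: "\<not> exceptional K (rt m x y)" "\<not> exceptional K (rt m' x' y')"
    using below_not_exceptional[OF v b] by auto
  have "\<exists>S1 S2 t1 t2. {T1, T2} = {S1, S2} \<and> ok S1 S2 t1 t2"
  proof (cases "m = m'")
    case True
    then have *: "x' < x" "x \<le> y'" "y' < y" and T: "{T1, T2} = {rt m x y', rt m x' y}"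
      using b c nxt_neq[of m'] lv by (auto simp: below_def corners_def)
    have v': "valid m x y'" "valid m x' y" "valid m x' y'" using v * True by (auto simp: valid_def)
    have "ok (rt m x y') (rt m x' y) (arc m x y') (arc m x' y)"
      unfolding ok_def
    proof (intro conjI impI)
      show "g (arc m x y) + g (arc m' x' y') = g (arc m x y') + g (arc m x' y)"
        using sum_same_leg True by simp
      assume ne': "fst (arc m x y') \<noteq> snd (arc m x y') \<and> fst (arc m x' y) \<noteq> snd (arc m x' y)"
      have "convex hull (g ` {(lonode m x, hinode m y), (lonode m x', hinode m y'),
          (lonode m x, hinode m y'), (lonode m x', hinode m y)}) face_of P"
        by (rule face_crossing)
          (use ne ne' v v' exceptional_arc arc_setI True in \<open>auto simp: arc_def\<close>)
      then show "convex hull (g ` {arc m x y, arc m' x' y', arc m x y', arc m x' y}) face_of P"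
        using True by (simp add: arc_def)
    qed (use v' arc_in gvec_arc exceptional_arc in auto)
    then show ?thesis using T by blast
  next
    case False
    then have *: "m = nxt m'" "x = turn m" "y' = turn (Suc m')"
      and T: "{T1, T2} = {rt m' x' (Suc y'), rt m (x - 1) y}"
      using b c by (auto simp: below_def corners_def)
    have v': "valid m' x' (Suc (turn (Suc m')))" "valid m (turn m - 1) y"
      using turn_valid[OF v(1) *(1)] turn_valid'[OF v(2) *(1)] * lv by auto
    note tn = turn_node[OF *(1) lv(5,6)]
    let ?c = "lonode m' x'" and ?b = "hinode m y" and ?z = "turn m"
    have arcs: "arc m x y = (?z, ?b)" "arc m' x' y' = (?c, ?z)"
      "arc m' x' (Suc (turn (Suc m'))) = (?c, 0)" "arc m (turn m - 1) y = (0, ?b)"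
      using * tn by (simp_all add: arc_def)
    have "ok (rt m' x' (Suc y')) (rt m (x - 1) y) (?c, 0) (0, ?b)"
      unfolding ok_def
    proof (intro conjI impI)
      show "g (arc m x y) + g (arc m' x' y') = g (?c, 0) + g (0, ?b)"
        by (simp add: arcs arc_vec_def)
      show "(?c, 0) \<in> arc_set" "(0, ?b) \<in> arc_set" using arc_in[OF v'(1)] arc_in[OF v'(2)] arcs by auto
      show "gvec vtx K (rt m' x' (Suc y')) = g (?c, 0)" "gvec vtx K (rt m (x - 1) y) = g (0, ?b)"
        using gvec_arc[OF v'(1)] gvec_arc[OF v'(2)] arcs * by auto
      show "exceptional K (rt m' x' (Suc y')) = (fst (?c, 0::nat) = snd (?c, 0::nat))"
        "exceptional K (rt m (x - 1) y) = (fst (0::nat, ?b) = snd (0::nat, ?b))"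
        using exceptional_arc[OF v'(1)] exceptional_arc[OF v'(2)] arcs * by auto
      assume "fst (?c, 0::nat) \<noteq> snd (?c, 0::nat) \<and> fst (0::nat, ?b) \<noteq> snd (0::nat, ?b)"
      then have c0: "?c \<noteq> 0" "?b \<noteq> 0" by auto
      then have ns: "\<not> star_lo m' x'" "\<not> star_hi m y" by (auto simp: lonode_def hinode_def)
      \<comment> \<open>Equality would mean that the legs meet at both ends and both routes run from
        turn to turn: an anomalous pair.\<close>
      have "?c \<noteq> ?b"
      proof
        assume "?c = ?b"
        then have "m' = nxt m" "x' = turn m'" "y = turn (Suc m)"
          using lonode_hinode[OF lv(2) ns(1) lv(3) ns(2)] False by auto
        then show False using na nxt_nxt[OF *(1)] lv * by (simp add: anom_def)
      qed
      moreover have "(?c, ?b) \<notin> arc_set"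
      proof
        assume "(?c, ?b) \<in> arc_set"
        then obtain y2 where y2: "valid m' x' y2" "?b = hinode m' y2" using out_arc[OF lv(2) ns(1)] by blast
        then have "m = m'" using hinode_inj[OF lv(3) _ y2(2) ns(2)] by (simp add: valid_def)
        then show False using False by simp
      qed
      moreover have "w = 0 \<or> w = ?z" if w: "(?c, w) \<in> arc_set" "(w, ?b) \<in> arc_set" for w
      proof (cases "w = 0")
        case w0: False
        obtain yw where yw: "valid m' x' yw" "w = hinode m' yw" using out_arc[OF lv(2) ns(1) w(1)] by blast
        obtain xw where xw: "valid m xw y" "w = lonode m xw" using in_arc[OF lv(3) ns(2) w(2)] by blast
        have "\<not> star_lo m xw" "\<not> star_hi m' yw" using w0 xw(2) yw(2) by (auto simp: lonode_def hinode_def)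
        then have "xw = turn m"
          using lonode_hinode[of m xw m' yw] xw yw False by (auto simp: valid_def)
        then show ?thesis using xw tn by simp
      qed simp
      moreover have "?c \<noteq> ?z" "?z \<noteq> ?b" "(?c, ?z) \<in> arc_set" "(?z, ?b) \<in> arc_set"
        using ne exceptional_arc v arcs arc_in[OF v(1)] arc_in[OF v(2)] by auto
      moreover have "(?c, 0) \<in> arc_set" "(0, ?b) \<in> arc_set" using arc_in[OF v'(1)] arc_in[OF v'(2)] arcs by auto
      ultimately have "convex hull (g ` {(?c, ?z), (?z, ?b), (?c, 0), (0, ?b)}) face_of P"
        using c0 by (intro face_two_step) auto
      then show "convex hull (g ` {arc m x y, arc m' x' y', (?c, 0), (0, ?b)}) face_of P"
        by (simp add: arcs insert_commute)
    qed
    then show ?thesis using T by blast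
  qed
  then obtain S1 S2 t1 t2 where T: "{T1, T2} = {S1, S2}" and S: "ok S1 S2 t1 t2" by blast
  from T consider "T1 = S1" "T2 = S2" | "T1 = S2" "T2 = S1" unfolding doubleton_eq_iff by blast
  then have "ok T1 T2 t1 t2 \<or> ok T1 T2 t2 t1"
    using S ok_swap by cases blast+
  then show ?thesis unfolding ok_def by blast
qed

text \<open>The opposite diagonal of the array is a different pair of arcs with the same
  sum.\<close>

lemma nested_not_edge:
  assumes v: "valid m x y" "valid m' x' y'" and nn: "nested m' x' y' m x y"
  shows "\<not> closed_segment (g (arc m x y)) (g (arc m' x' y')) edge_of P"
proof -
  have main: "\<not> closed_segment (g (arc m x y)) (g (arc m' x' y')) edge_of P"
    if v: "valid m x y" "valid m' x' y'" and n: "m' = nxt m \<and> star_hi m y \<and> star_lo m' x'" for m x y m' x' y'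
  proof -
    have lv: "lov m x" "lov m' x'" "hiv m y" "hiv m' y'" "m < r" "m' < r" using v by (auto simp: valid_def lov_def)
    have xy: "x' = turn m' - 1" "y = Suc (turn (Suc m))" using n lv lov_star hiv_star by auto
    have v': "valid m' (turn m') y'" "valid m x (turn (Suc m))"
      using turn_valid[OF v(2)] turn_valid'[OF v(1)] n xy lv by auto
    have nx: "m' = nxt m" using n by simp
    note tn = turn_node[OF nx lv(6,5)]
    have arcs: "arc m x y = (lonode m x, 0)" "arc m' x' y' = (0, hinode m' y')"
      "arc m x (turn (Suc m)) = (lonode m x, turn m')" "arc m' (turn m') y' = (turn m', hinode m' y')"
      using tn xy by (simp_all add: arc_def)
    have "turn m' \<noteq> y'"
      using lv nx by (auto simp: hiv_def nxt_def split: if_splits)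
    then have "\<not> exceptional K (rt m' (turn m') y')"
      using exceptional_rt[OF v'(1)] by (simp add: star_lo_def)
    then have "turn m' \<noteq> hinode m' y'" using exceptional_arc[OF v'(1)] arcs by simp
    moreover have "turn m' \<noteq> 0" using turn_pos[of m'] by simp
    moreover have "(lonode m x, turn m') \<in> arc_set" "(turn m', hinode m' y') \<in> arc_set"
      "(lonode m x, 0) \<in> arc_set" "(0, hinode m' y') \<in> arc_set"
      using arc_in[OF v'(2)] arc_in[OF v'(1)] arc_in[OF v(1)] arc_in[OF v(2)] arcs by auto
    ultimately show ?thesis
      unfolding arcs by (intro not_edge[where c = "(lonode m x, turn m')" and d = "(turn m', hinode m' y')"])
        (auto simp: arc_vec_def)
  qed
  consider "m = m'" "x' < x \<and> y < y' \<or> x < x' \<and> y' < y" | "m' = nxt m \<and> star_hi m y \<and> star_lo m' x'"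
    | "m = nxt m' \<and> star_hi m' y' \<and> star_lo m x"
    using nn unfolding nested_def by blast
  then show ?thesis
  proof cases
    case 1
    have v': "valid m x y'" "valid m x' y" using v 1 by (auto simp: valid_def)
    have lv: "lov m x" "lov m x'" "hiv m y" "hiv m y'" using v 1 by (auto simp: valid_def)
    have "lonode m x \<noteq> lonode m x'"
    proof
      assume e: "lonode m x = lonode m x'"
      show False
      proof (cases "star_lo m x")
        case True
        then have "star_lo m x'" using e node_pos lv by metis
        then show False using True lov_star lv 1 by auto
      qed (use lonode_inj[of m x m x'] lv e 1 in auto)
    qed
    moreover have "hinode m y \<noteq> hinode m y'"
    proof
      assume e: "hinode m y = hinode m y'"
      show False
      proof (cases "star_hi m y")
        case True
        then have "star_hi m y'" using e node_pos lv by metis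
        then show False using True hiv_star lv 1 by auto
      qed (use hinode_inj[of m y m y'] lv e 1 in auto)
    qed
    ultimately have "arc m x y' \<noteq> arc m x y" "arc m x y' \<noteq> arc m' x' y'"
      using 1 by (auto simp: arc_def)
    then show ?thesis
      using not_edge[OF arc_in[OF v(1)] arc_in[OF v(2)] arc_in[OF v'(1)] arc_in[OF v'(2)]] sum_same_leg 1 by simp
  next
    case 2
    then show ?thesis using main v by blast
  next
    case 3
    show ?thesis using main[OF v(2,1) 3] by (subst closed_segment_commute)
  qed
qed

text \<open>Both relations can hold only if one uses the turn at one end of the legs and the other
  the turn at the opposite end, which takes a cycle with two legs.\<close>

lemma nested_not_below:
  assumes v: "valid m x y" "valid m' x' y'" and nn: "nested m' x' y' m x y" and na: "\<not> (anom m x y \<and> anom m' x' y')"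
  shows "\<not> below m' x' y' m x y"
proof
  assume b: "below m' x' y' m x y"
  have lv: "m < r" "m' < r" using v by (auto simp: valid_def lov_def)
  show False
  proof (cases "m = m'")
    case True
    then show False using b nn nxt_neq[of m] lv by (auto simp: below_def nested_def)
  next
    case False
    then have *: "m = nxt m'" "x = turn m" "y' = turn (Suc m')" using b by (auto simp: below_def)
    then have "m' = nxt m" "star_hi m y" "star_lo m' x'"
      using nn False by (auto simp: nested_def star_lo_def)
    then show False using na * nxt_nxt[OF *(1)] lv by (auto simp: anom_def star_hi_def star_lo_def)
  qed
qed

section \<open>Anomalous pairs and the final case distinction\<close>

lemma minimal_face_swap: "minimal_face Q {a, b} = minimal_face Q {b, a}"
  by (simp add: insert_commute)

text \<open>Rewriting the sum of the two vectors always yields a summand 0, which brings 0 into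
  every face containing both.\<close>

lemma anomalous_below_face:
  assumes v: "valid m x y" "valid m' x' y'" and an: "anom m x y" "anom m' x' y'"
    and b: "below m' x' y' m x y"
  shows "minimal_face P {g (arc m x y), g (arc m' x' y')} = P"
proof -
  have lv: "m < r" "m' < r" "turn m < turn (Suc m)" "lov m x" "lov m' x'" "hiv m y" "hiv m' y'"
    using v turn_Suc by (auto simp: valid_def lov_def)
  have c: "\<not> is_path K" "r = 2" "x \<le> turn m" "turn (Suc m) \<le> y" "x' \<le> turn m'" "turn (Suc m') \<le> y'"
    using an by (auto simp: anom_def)
  have "\<exists>s t. s \<in> arc_set \<and> t \<in> arc_set \<and> g (arc m x y) + g (arc m' x' y') = g s + g t \<and> (g s = 0 \<or> g t = 0)"
  proof (cases "m = m'")
    case True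
    then have *: "x' < x" "x \<le> y'" "y' < y" using b nxt_neq[of m'] lv by (auto simp: below_def)
    have v': "valid m x y'" "valid m x' y" using v * True by (auto simp: valid_def)
    \<comment> \<open>For positions at or beyond the turns a strict inequality leaves only the
      virtual one.\<close>
    have "star_lo m x'" "star_hi m y" using * c True by (auto simp: star_lo_def star_hi_def)
    then have "g (arc m x' y) = 0" using exceptional_zero[OF v'(2)] exceptional_rt[OF v'(2)] by simp
    then show ?thesis using sum_same_leg[of m x y x' y'] arc_in[OF v'(1)] arc_in[OF v'(2)] True by metis
  next
    case False
    then have *: "m = nxt m'" "x = turn m" "y' = turn (Suc m')" using b by (auto simp: below_def)
    have v': "valid m' x' (Suc (turn (Suc m')))" "valid m (turn m - 1) y"
      using turn_valid[OF v(1) *(1)] turn_valid'[OF v(2) *(1)] * lv by auto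
    have sum: "g (arc m x y) + g (arc m' x' y') = g (arc m' x' (Suc (turn (Suc m')))) + g (arc m (turn m - 1) y)"
      using sum_turn[OF *(1) lv(1,2)] * by simp
    show ?thesis
    proof (cases "star_lo m' x' \<or> star_hi m y")
      case True
      then have "g (arc m' x' (Suc (turn (Suc m')))) = 0 \<or> g (arc m (turn m - 1) y) = 0"
        using exceptional_zero[OF v'(1)] exceptional_zero[OF v'(2)] exceptional_rt[OF v'(1)]
          exceptional_rt[OF v'(2)] turn_pos[of m] by (auto simp: star_lo_def star_hi_def)
      then show ?thesis using sum arc_in[OF v'(1)] arc_in[OF v'(2)] by blast
    next
      case False
      \<comment> \<open>Both routes run from turn to turn in opposite senses, so their vectors
        cancel; the loop \<open>(0, 0)\<close> of a long exceptional route replaces the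
        corners.\<close>
      then have "x' = turn m'" "y = turn (Suc m)" using c lv by (auto simp: star_lo_def star_hi_def)
      moreover have "m' = nxt m" using nxt_two c lv \<open>m \<noteq> m'\<close> by blast
      then have "arc m x y = (turn m, turn m')" "arc m' x' y' = (turn m', turn m)"
        using calculation turn_node(1,2)[OF _ lv(2,1)] turn_node(1,2)[OF *(1) lv(1,2)] *(2,3)
        unfolding arc_def by blast+
      then have "g (arc m x y) + g (arc m' x' y') = g (0, 0) + g (0, 0)"
        by (simp add: arc_vec_def)
      moreover have "(0, 0) \<in> arc_set"
        using arc_in[OF long_exceptional_valid[OF lv(1)]] turn_pos[of m]
        by (simp add: arc_def lonode_def hinode_def star_lo_def star_hi_def)
      moreover have "g (0, 0) = 0" by (simp add: arc_vec_def)
      ultimately show ?thesis by blast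
    qed
  qed
  then obtain s t where st: "s \<in> arc_set" "t \<in> arc_set" "g (arc m x y) + g (arc m' x' y') = g s + g t"
    "g s = 0 \<or> g t = 0" by blast
  show ?thesis
  proof (rule minimal_face_all)
    show "0 \<in> F" if "F face_of P" "g (arc m x y) \<in> F" "g (arc m' x' y') \<in> F" for F
      using sum_arcs[OF that st(1,2,3)] st(4) by auto
  qed (use arc_in v in auto)
qed

text \<open>On one leg the larger interval would be exceptional; on two legs the nonexceptional
  routes would be \<open>below\<close> at the other turn.\<close>

lemma anomalous_not_nested:
  assumes v: "valid m x y" "valid m' x' y'" and an: "anom m x y" "anom m' x' y'"
    and ne: "\<not> exceptional K (rt m x y)" "\<not> exceptional K (rt m' x' y')"
    and nb: "\<not> below m' x' y' m x y" "\<not> below m x y m' x' y'"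
  shows "\<not> nested m' x' y' m x y"
proof
  assume nn: "nested m' x' y' m x y"
  have lv: "m < r" "m' < r" "lov m x" "lov m' x'" "hiv m y" "hiv m' y'"
    using v by (auto simp: valid_def lov_def)
  have c: "\<not> is_path K" "r = 2" "x \<le> turn m" "turn (Suc m) \<le> y" "x' \<le> turn m'" "turn (Suc m') \<le> y'"
    using an by (auto simp: anom_def)
  have ns: "\<not> (star_lo m x \<and> star_hi m y)" "\<not> (star_lo m' x' \<and> star_hi m' y')"
    using ne exceptional_rt[OF v(1)] exceptional_rt[OF v(2)] by auto
  consider "m = m'" "x' < x \<and> y < y' \<or> x < x' \<and> y' < y" | "m' = nxt m" "star_hi m y" "star_lo m' x'"
    | "m = nxt m'" "star_hi m' y'" "star_lo m x"
    using nn unfolding nested_def by blast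
  then show False
  proof cases
    case 1
    then show False using ns c by (auto simp: star_lo_def star_hi_def)
  next
    case 2
    then have "x = turn m" "y' = turn (Suc m')" using ns c by (auto simp: star_lo_def star_hi_def)
    moreover have "m \<noteq> m'" using 2 nxt_neq lv by metis
    then have "m = nxt m'" using nxt_two c lv by blast
    ultimately show False using nb(1) by (simp add: below_def)
  next
    case 3
    then have "x' = turn m'" "y = turn (Suc m)" using ns c by (auto simp: star_lo_def star_hi_def)
    moreover have "m \<noteq> m'" using 3 nxt_neq lv by metis
    then have "m' = nxt m" using nxt_two c lv by metis
    ultimately show False using nb(2) by (simp add: below_def)
  qed
qed

lemma edge_unrelated:
  assumes v: "valid m x y" "valid m' x' y'"
    and ne: "\<not> exceptional K (rt m x y)" "\<not> exceptional K (rt m' x' y')"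
    and nb: "\<not> below m' x' y' m x y" "\<not> below m x y m' x' y'" and nn: "\<not> nested m' x' y' m x y"
    and neq: "rt m x y \<noteq> rt m' x' y'"
  shows "closed_segment (g (arc m x y)) (g (arc m' x' y')) edge_of P"
    "minimal_face P {g (arc m x y), g (arc m' x' y')} = closed_segment (g (arc m x y)) (g (arc m' x' y'))"
proof -
  have "g (arc m x y) \<noteq> g (arc m' x' y')"
  proof
    assume "g (arc m x y) = g (arc m' x' y')"
    then have "arc m' x' y' = arc m x y"
      using arc_in_segment[of "lonode m x" "hinode m y" "arc m' x' y'" "arc m' x' y'"]
        arc_in[OF v(1)] arc_in[OF v(2)] nodes ne(1) exceptional_arc[OF v(1)]
      by (simp add: arc_def)
    then show False using arc_inj[OF v ne(1)] neq by auto
  qed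
  then show "closed_segment (g (arc m x y)) (g (arc m' x' y')) edge_of P"
    "minimal_face P {g (arc m x y), g (arc m' x' y')} = closed_segment (g (arc m x y)) (g (arc m' x' y'))"
    using edge_iff_face face_unrelated[OF v ne nb nn neq] by auto
qed

lemma subtended_below:
  assumes v: "valid m x y" "valid m' x' y'" and na: "\<not> (anom m x y \<and> anom m' x' y')"
    and c: "NW_corners K (rt m x y) (rt m' x' y') T1 T2"
  shows "exceptional K T1 \<or> exceptional K T2 \<Longrightarrow> on_different_facets P (g (arc m x y)) (g (arc m' x' y'))"
    "\<not> (exceptional K T1 \<or> exceptional K T2) \<Longrightarrow> minimal_face P {g (arc m x y), g (arc m' x' y')} =
       convex hull (gvec vtx K ` {rt m x y, rt m' x' y', T1, T2})"
proof -
  note b = NW_corners_rt(1)[OF v c]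
  have "corners m' x' y' m x y T1 T2" using NW_corners_rt(2)[OF v c] na by blast
  then obtain t1 t2 where t: "t1 \<in> arc_set" "t2 \<in> arc_set" "gvec vtx K T1 = g t1" "gvec vtx K T2 = g t2"
    "g (arc m x y) + g (arc m' x' y') = g t1 + g t2"
    "exceptional K T1 \<longleftrightarrow> fst t1 = snd t1" "exceptional K T2 \<longleftrightarrow> fst t2 = snd t2"
    "fst t1 \<noteq> snd t1 \<and> fst t2 \<noteq> snd t2 \<longrightarrow> convex hull (g ` {arc m x y, arc m' x' y', t1, t2}) face_of P"
    using below_corners[OF v b _ na] by blast
  note av = arc_in[OF v(1)] arc_in[OF v(2)]
  show "on_different_facets P (g (arc m x y)) (g (arc m' x' y'))" if "exceptional K T1 \<or> exceptional K T2"
  proof (rule different_facets[OF av])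
    show "fst (arc m x y) \<noteq> snd (arc m x y)" "fst (arc m' x' y') \<noteq> snd (arc m' x' y')"
      using below_not_exceptional[OF v b] exceptional_arc v by auto
    have "g t1 = 0 \<or> g t2 = 0" using that t(6,7) by (auto simp: arc_vec_def)
    then show "0 \<in> F" if "F face_of P" "g (arc m x y) \<in> F" "g (arc m' x' y') \<in> F" for F
      using sum_arcs[OF that t(1,2,5)] by auto
  qed
  show "minimal_face P {g (arc m x y), g (arc m' x' y')} =
       convex hull (gvec vtx K ` {rt m x y, rt m' x' y', T1, T2})" if "\<not> (exceptional K T1 \<or> exceptional K T2)"
    using minimal_face_quad[OF av t(1,2,5)] t that gvec_arc[OF v(1)] gvec_arc[OF v(2)] by simp
qed

end

theorem lemma4p26:
  fixes K :: shape and vtx :: "'n::finite \<Rightarrow> nat" and R S :: route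
  assumes "wf_shape K"
    and "bij_betw vtx UNIV {1..num_inner K}"
    and "R \<in> routes K" and "S \<in> routes K"
  shows
    "(anomalous K R \<and> anomalous K S \<longrightarrow>
       (S \<in> regNW K R \<union> regSE K R \<longleftrightarrow> conflict K R S) \<and>
       (conflict K R S \<longrightarrow>
          minimal_face (gpolytope vtx K) {gvec vtx K R, gvec vtx K S} = gpolytope vtx K) \<and>
       (coherent K R S \<longrightarrow>
          (exceptional K R \<or> exceptional K S \<longrightarrow>
             minimal_face (gpolytope vtx K) {gvec vtx K R, gvec vtx K S} = gpolytope vtx K) \<and>
          (\<not> (exceptional K R \<or> exceptional K S) \<and> R \<noteq> S \<longrightarrow>
             closed_segment (gvec vtx K R) (gvec vtx K S) edge_of gpolytope vtx K \<and>
             minimal_face (gpolytope vtx K) {gvec vtx K R, gvec vtx K S} =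
               closed_segment (gvec vtx K R) (gvec vtx K S)))) \<and>
     (\<not> (anomalous K R \<and> anomalous K S) \<longrightarrow>
       (S \<in> regNW K R \<union> regSE K R \<longleftrightarrow> conflict K S R) \<and>
       (\<forall>T\<^sub>1 T\<^sub>2. subtended K R S T\<^sub>1 T\<^sub>2 \<longrightarrow>
          (exceptional K T\<^sub>1 \<or> exceptional K T\<^sub>2 \<longrightarrow>
             on_different_facets (gpolytope vtx K) (gvec vtx K R) (gvec vtx K S)) \<and>
          (\<not> (exceptional K T\<^sub>1 \<or> exceptional K T\<^sub>2) \<longrightarrow>
             minimal_face (gpolytope vtx K) {gvec vtx K R, gvec vtx K S} =
               convex hull (gvec vtx K ` {R, S, T\<^sub>1, T\<^sub>2}))) \<and>
       (S \<in> regNE K R \<union> regSW K R \<longrightarrow>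
          coherent K S R \<and>
          \<not> closed_segment (gvec vtx K R) (gvec vtx K S) edge_of gpolytope vtx K) \<and>
       (coherent K S R \<and>
        closed_segment (gvec vtx K R) (gvec vtx K S) edge_of gpolytope vtx K \<longrightarrow>
          S \<notin> regNW K R \<union> regNE K R \<union> regSE K R \<union> regSW K R) \<and>
       (R \<noteq> S \<and> \<not> exceptional K R \<and> \<not> exceptional K S \<longrightarrow>
          (S \<in> regNE K R \<union> regSW K R \<longleftrightarrow>
             coherent K S R \<and>
             \<not> closed_segment (gvec vtx K R) (gvec vtx K S) edge_of gpolytope vtx K) \<and>
          (S \<notin> regNW K R \<union> regNE K R \<union> regSE K R \<union> regSW K R \<longleftrightarrow>
             coherent K S R \<and>
             closed_segment (gvec vtx K R) (gvec vtx K S) edge_of gpolytope vtx K)))"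
proof -
  interpret lab_polytope K vtx using assms(1,2) by unfold_locales
  obtain m x y where v: "valid m x y" and R: "R = rt m x y" using route_form assms(3) by blast
  obtain m' x' y' where v': "valid m' x' y'" and S: "S = rt m' x' y'" using route_form assms(4) by blast
  have gR: "gvec vtx K R = g (arc m x y)" and gS: "gvec vtx K S = g (arc m' x' y')"
    using gvec_arc v v' R S by auto
  let ?rel = "below m' x' y' m x y \<or> below m x y m' x' y'"
  let ?nested = "nested m' x' y' m x y"
  let ?edge = "closed_segment (gvec vtx K R) (gvec vtx K S) edge_of gpolytope vtx K"
  let ?min = "minimal_face (gpolytope vtx K) {gvec vtx K R, gvec vtx K S}"
  have anR: "anomalous K R \<longleftrightarrow> anom m x y" and anS: "anomalous K S \<longleftrightarrow> anom m' x' y'"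
    using anomalous_rt v v' R S by auto
  have NWSE: "S \<in> regNW K R \<union> regSE K R \<longleftrightarrow> ?rel"
    using regNW_rt[OF v v'] regNW_rt[OF v' v] regSE_iff[OF assms(3,4)] R S by auto
  have conf: "conflict K R S \<longleftrightarrow> ?rel" "conflict K S R \<longleftrightarrow> ?rel"
    using conflict_rt[OF v v'] conflict_sym R S by auto
  have NESW: "S \<in> regNE K R \<union> regSW K R \<longleftrightarrow> ?nested" if "\<not> (anomalous K R \<and> anomalous K S)"
    using NE_SW_rt[OF v v'] that R S anR anS by blast
  have anom_conf: "?min = gpolytope vtx K" if an: "anomalous K R \<and> anomalous K S" "?rel"
    using an(2)
  proof
    assume "below m' x' y' m x y"
    then show ?thesis
      using anomalous_below_face[OF v v'] an(1) anR anS gR gS gpolytope_eq by simp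
  next
    assume "below m x y m' x' y'"
    then show ?thesis
      using anomalous_below_face[OF v' v] an(1) anR anS gR gS gpolytope_eq minimal_face_swap by metis
  qed
  have exc: "?min = gpolytope vtx K" if "exceptional K R \<or> exceptional K S"
  proof -
    have "g (arc m x y) = 0 \<or> g (arc m' x' y') = 0"
      using that exceptional_zero v v' R S by auto
    then have "minimal_face P {g (arc m x y), g (arc m' x' y')} = P"
      using arc_in v v' by (intro minimal_face_all) auto
    then show ?thesis using gR gS gpolytope_eq by simp
  qed
  have edge: "?edge" "?min = closed_segment (gvec vtx K R) (gvec vtx K S)"
    if "\<not> exceptional K R" "\<not> exceptional K S" "\<not> ?rel" "\<not> ?nested" "R \<noteq> S"
    using edge_unrelated[OF v v'] that R S gR gS gpolytope_eq by auto
  have nn: "\<not> ?nested" if "anomalous K R \<and> anomalous K S" "\<not> exceptional K R" "\<not> exceptional K S" "\<not> ?rel"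
    using anomalous_not_nested[OF v v'] that anR anS R S by auto
  have nest: "\<not> ?rel \<and> \<not> ?edge" if "\<not> (anomalous K R \<and> anomalous K S)" "?nested"
    using nested_not_below[OF v v'] nested_not_below[OF v' v] nested_sym[of m x y m' x' y']
      nested_not_edge[OF v v' that(2)] that anR anS gR gS gpolytope_eq by auto
  have sub: "(exceptional K T\<^sub>1 \<or> exceptional K T\<^sub>2 \<longrightarrow>
             on_different_facets (gpolytope vtx K) (gvec vtx K R) (gvec vtx K S)) \<and>
          (\<not> (exceptional K T\<^sub>1 \<or> exceptional K T\<^sub>2) \<longrightarrow>
             ?min = convex hull (gvec vtx K ` {R, S, T\<^sub>1, T\<^sub>2}))"
    if na: "\<not> (anomalous K R \<and> anomalous K S)" and "subtended K R S T\<^sub>1 T\<^sub>2" for T\<^sub>1 T\<^sub>2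
    using that(2) unfolding subtended_def
  proof
    assume "NW_corners K R S T\<^sub>1 T\<^sub>2"
    then show ?thesis
      using subtended_below[OF v v'] na anR anS R S gR gS gpolytope_eq by simp
  next
    assume c: "NW_corners K S R T\<^sub>1 T\<^sub>2"
    have na': "\<not> (anom m' x' y' \<and> anom m x y)" using na anR anS by blast
    note s = subtended_below[OF v' v na' c[unfolded R S]]
    have "on_different_facets P (g (arc m x y)) (g (arc m' x' y'))" if "exceptional K T\<^sub>1 \<or> exceptional K T\<^sub>2"
      using s(1)[OF that] unfolding on_different_facets_def by blast
    moreover have "minimal_face P {g (arc m x y), g (arc m' x' y')} = convex hull (gvec vtx K ` {R, S, T\<^sub>1, T\<^sub>2})"
      if "\<not> (exceptional K T\<^sub>1 \<or> exceptional K T\<^sub>2)"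
      using s(2)[OF that] unfolding R S minimal_face_swap[of P "g (arc m x y)"] by (simp add: insert_commute)
    ultimately show ?thesis using gR gS gpolytope_eq by simp
  qed
  show ?thesis
  proof (cases "anomalous K R \<and> anomalous K S")
    case True
    then show ?thesis using NWSE conf anom_conf exc edge nn unfolding coherent_def by blast
  next
    case False
    \<comment> \<open>The four regions are exactly the two diagonals, so the remaining pairs are the
      edges.\<close>
    have all: "S \<in> regNW K R \<union> regNE K R \<union> regSE K R \<union> regSW K R \<longleftrightarrow> ?rel \<or> ?nested"
      using NWSE NESW[OF False] by blast
    show ?thesis
      unfolding coherent_def all conf NWSE NESW[OF False]
      using False sub[OF False] nest[OF False] edge by blast
  qed
qed

end
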